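(* Let $K$ be a commutative locally compact hypergroup with Haar measure $m$, let $\alpha\in\widehat K$, and suppose that $UC(K)$ is $\alpha$-amenable and has a unique $\alpha$-mean $m_\alpha^{uc}$. Then $m_\alpha^{uc}$ belongs to $L^1(K)\cap L^2(K)$ (i.e. it is given by integration against a function in $L^1(K)\cap L^2(K)$), $\alpha$ is an isolated point of $\mathcal S$ (i.e. $\alpha\in\mathcal S$ and $\{\alpha\}$ is open in $\mathcal S$), and $m_\alpha^{uc}$ is the functional determined by $\alpha/\|\alpha\|_2^2$ under the canonical embedding of $L^1(K)$ into its bidual, that is, $$m_\alpha^{uc}(f)=\frac{1}{\|\alpha\|_2^2}\int_K f(x)\,\overline{\alpha(x)}\,dm(x)\qquad (f\in UC(K)).$$ If moreover $\alpha$ is positive, then $K$ is compact.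
   Context: A locally compact hypergroup (in the sense of Jewett) is denoted $(K,\omega,\sim)$, with convolution $\omega:K\times K\to M^1(K)$ (probability measures on $K$) and involution $x\mapsto\tilde x$; it is commutative if $\omega(x,y)=\omega(y,x)$ for all $x,y$. A commutative hypergroup has a Haar measure $m$, unique up to a multiplicative constant. Translation is $T_xf(y)=\int_K f(t)\,d\omega(x,y)(t)$. The spaces $L^p(K)$ are taken with respect to $m$. Character space: $\widehat K=\{\alpha\in C^b(K):\alpha\neq 0,\ \int_K\alpha\,d\omega(x,y)=\alpha(x)\alpha(y)\text{ and }\alpha(\tilde x)=\overline{\alpha(x)}\ \forall x,y\in K\}$ with the compact-open topology, where $C^b(K)$ is the space of bounded continuous complex functions with the sup norm. The Fourier transform of $f\in L^1(K)$ is $\widehat f(\alpha)=\int_K f(x)\overline{\alpha(x)}\,dm(x)$. The Plancherel measure is the unique regular positive Borel measure on $\widehat K$ such that $\int_K|f|^2\,dm=\int_{\widehat K}|\widehat f|^2$ (integral with respect to that measure) for all $f\in L^1(K)\cap L^2(K)$; $\mathcal S\subseteq\widehat K$ denotes its (closed) support. $UC(K)=\{f\in C^b(K): x\mapsto T_xf \text{ is continuous from } K \text{ to } (C^b(K),\|\cdot\|_\infty)\}$; it is a translation invariant, conjugation closed subspace containing $\widehat K$. An $\alpha$-mean on $UC(K)$ is a bounded linear functional $M\in UC(K)^*$ with $M(\alpha)=1$ and $M(T_xf)=\alpha(x)M(f)$ for all $f\in UC(K)$, $x\in K$; $UC(K)$ is $\alpha$-amenable if an $\alpha$-mean on it exists.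 *)

theory Defs
  imports "HOL-Probability.Probability"
begin

section \<open>Radon measures\<close>

definition borel_of :: "'a topology \<Rightarrow> 'a measure" where
  "borel_of X = sigma (topspace X) {U. openin X U}"

lemma borel_of_euclidean: "borel_of euclidean = borel"
  by (simp add: borel_of_def borel_def)

text \<open>Regular positive Borel measures: finite on compact sets, outer regular on Borel sets, inner
  regular on open sets. No countability is assumed, so regularity is not automatic.\<close>

definition radon_measure :: "'a topology \<Rightarrow> 'a measure \<Rightarrow> bool" where
  "radon_measure X \<mu> \<longleftrightarrow>
     sets \<mu> = sets (borel_of X) \<and>
     (\<forall>C. compactin X C \<longrightarrow> emeasure \<mu> C < \<infinity>) \<and>
     (\<forall>A\<in>sets \<mu>. emeasure \<mu> A = (INF U\<in>{U. openin X U \<and> A \<subseteq> U}. emeasure \<mu> U)) \<and>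
     (\<forall>U. openin X U \<longrightarrow> emeasure \<mu> U = (SUP C\<in>{C. compactin X C \<and> C \<subseteq> U}. emeasure \<mu> C))"

definition measure_support :: "'a topology \<Rightarrow> 'a measure \<Rightarrow> 'a set" where
  "measure_support X \<mu> =
     {x \<in> topspace X. \<forall>U. openin X U \<and> x \<in> U \<longrightarrow> emeasure \<mu> U > 0}"

section \<open>Hypergroups\<close>

text \<open>The Michael topology on the nonempty compact subsets.\<close>

definition michael_topology :: "'a::topological_space set topology" where
  "michael_topology = topology_generated_by
     {{C. compact C \<and> C \<noteq> {} \<and> C \<inter> U \<noteq> {} \<and> C \<subseteq> V} | U V. open U \<and> open V}"

text \<open>Hypergroups in the sense of Jewett, on the whole of a Hausdorff type. The convolution of point
  masses \<open>\<omega> x y\<close> extends to bounded Radon measures by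
  \<open>(\<mu> * \<nu>)(f) = \<integral>\<integral> \<omega> x y (f) d\<mu>(x) d\<nu>(y)\<close>; the axiom \<open>assoc\<close> is
  \<open>\<delta>\<^sub>x * \<omega> y z = \<omega> x y * \<delta>\<^sub>z\<close>, where equality of bounded Radon measures is equality
  of the integrals of all bounded continuous functions. Continuity of \<open>\<omega>\<close> is with respect to the
  weak topology on the probability measures. As \<open>bar\<close> is an involution, its continuity makes it a
  homeomorphism.\<close>

locale hypergroup =
  fixes \<omega> :: "'a::t2_space \<Rightarrow> 'a \<Rightarrow> 'a measure"
    and bar :: "'a \<Rightarrow> 'a"
  assumes locally_compact: "locally_compact_space (euclidean :: 'a topology)"
    and prob: "prob_space (\<omega> x y)"
    and radon: "radon_measure euclidean (\<omega> x y)"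
    and compact_support: "compact (measure_support euclidean (\<omega> x y))"
    and weakly_continuous:
      "(f :: 'a \<Rightarrow> complex) \<in> bcontfun \<Longrightarrow> continuous_on UNIV (\<lambda>(x, y). \<integral>t. f t \<partial>\<omega> x y)"
    and support_continuous:
      "continuous_map euclidean michael_topology (\<lambda>(x, y). measure_support euclidean (\<omega> x y))"
    and assoc:
      "(f :: 'a \<Rightarrow> complex) \<in> bcontfun \<Longrightarrow>
         (\<integral>t. (\<integral>s. f s \<partial>\<omega> x t) \<partial>\<omega> y z) = (\<integral>t. (\<integral>s. f s \<partial>\<omega> t z) \<partial>\<omega> x y)"
    and bar_continuous: "continuous_on UNIV bar"
    and bar_bar: "bar (bar x) = x"
    and bar_convolution: "distr (\<omega> x y) borel bar = \<omega> (bar y) (bar x)"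
    and unit:
      "\<exists>e. (\<forall>x. \<omega> e x = return borel x \<and> \<omega> x e = return borel x) \<and>
           (\<forall>x y. e \<in> measure_support euclidean (\<omega> x (bar y)) \<longleftrightarrow> x = y)"

locale commutative_hypergroup = hypergroup +
  assumes commute: "\<omega> x y = \<omega> y x"

definition translate ::
    "('a \<Rightarrow> 'a \<Rightarrow> 'a measure) \<Rightarrow> 'a \<Rightarrow> ('a \<Rightarrow> complex) \<Rightarrow> 'a \<Rightarrow> complex" where
  "translate \<omega> x f y = (\<integral>t. f t \<partial>\<omega> x y)"

definition haar_measure ::
    "('a::t2_space \<Rightarrow> 'a \<Rightarrow> 'a measure) \<Rightarrow> 'a measure \<Rightarrow> bool" where
  "haar_measure \<omega> m \<longleftrightarrow>
     radon_measure euclidean m \<and> emeasure m UNIV \<noteq> 0 \<and>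
     (\<forall>f x. continuous_on UNIV f \<and> compact (closure {y. f y \<noteq> 0}) \<longrightarrow>
        (\<integral>y. translate \<omega> x f y \<partial>m) = (\<integral>y. f y \<partial>m))"

definition L1_L2 :: "'a measure \<Rightarrow> ('a \<Rightarrow> complex) set" where
  "L1_L2 m = {f. integrable m f \<and> integrable m (\<lambda>x. (cmod (f x))\<^sup>2)}"

section \<open>Characters and the Plancherel measure\<close>

definition dual_space ::
    "('a::t2_space \<Rightarrow> 'a \<Rightarrow> 'a measure) \<Rightarrow> ('a \<Rightarrow> 'a) \<Rightarrow> ('a \<Rightarrow> complex) set" where
  "dual_space \<omega> bar =
     {\<alpha> \<in> bcontfun. \<alpha> \<noteq> (\<lambda>_. 0) \<and>
        (\<forall>x y. (\<integral>t. \<alpha> t \<partial>\<omega> x y) = \<alpha> x * \<alpha> y) \<and> (\<forall>x. \<alpha> (bar x) = cnj (\<alpha> x))}"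

definition compact_open_topology ::
    "('a::topological_space \<Rightarrow> 'b::topological_space) topology" where
  "compact_open_topology = topology_generated_by
     {{f. continuous_on UNIV f \<and> f ` C \<subseteq> U} | C U. compact C \<and> open U}"

definition dual_topology ::
    "('a::t2_space \<Rightarrow> 'a \<Rightarrow> 'a measure) \<Rightarrow> ('a \<Rightarrow> 'a) \<Rightarrow> ('a \<Rightarrow> complex) topology" where
  "dual_topology \<omega> bar = subtopology compact_open_topology (dual_space \<omega> bar)"

definition fourier_transform ::
    "'a measure \<Rightarrow> ('a \<Rightarrow> complex) \<Rightarrow> ('a \<Rightarrow> complex) \<Rightarrow> complex" where
  "fourier_transform m f \<alpha> = (\<integral>x. f x * cnj (\<alpha> x) \<partial>m)"

text \<open>The integrals are taken in \<open>[0, \<infinity>]\<close>, so that the identity includes square integrability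
  of the Fourier transform.\<close>

definition plancherel_measure ::
    "('a::t2_space \<Rightarrow> 'a \<Rightarrow> 'a measure) \<Rightarrow> ('a \<Rightarrow> 'a) \<Rightarrow> 'a measure \<Rightarrow>
     ('a \<Rightarrow> complex) measure \<Rightarrow> bool" where
  "plancherel_measure \<omega> bar m \<pi> \<longleftrightarrow>
     radon_measure (dual_topology \<omega> bar) \<pi> \<and>
     (\<forall>f\<in>L1_L2 m. (\<integral>\<^sup>+x. ennreal ((cmod (f x))\<^sup>2) \<partial>m) =
        (\<integral>\<^sup>+\<alpha>. ennreal ((cmod (fourier_transform m f \<alpha>))\<^sup>2) \<partial>\<pi>))"

section \<open>Means\<close>

text \<open>On a hypergroup the translates of a bounded continuous function are bounded and continuous, so
  that \<open>Bcontfun\<close> is applied to elements of \<open>bcontfun\<close> only; continuity is with respect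
  to the supremum norm of the type of bounded continuous functions.\<close>

definition UC :: "('a::t2_space \<Rightarrow> 'a \<Rightarrow> 'a measure) \<Rightarrow> ('a \<Rightarrow> complex) set" where
  "UC \<omega> = {f \<in> bcontfun. continuous_on UNIV (\<lambda>x. Bcontfun (translate \<omega> x f))}"

text \<open>Functionals on \<open>UC \<omega>\<close> are total functions whose values outside \<open>UC \<omega>\<close> are irrelevant;
  two of them are to be identified when they agree on \<open>UC \<omega>\<close>.\<close>

definition bounded_functional_UC ::
    "('a::t2_space \<Rightarrow> 'a \<Rightarrow> 'a measure) \<Rightarrow> (('a \<Rightarrow> complex) \<Rightarrow> complex) \<Rightarrow> bool" where
  "bounded_functional_UC \<omega> M \<longleftrightarrow>
     (\<forall>f\<in>UC \<omega>. \<forall>g\<in>UC \<omega>. M (\<lambda>x. f x + g x) = M f + M g) \<and>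
     (\<forall>c. \<forall>f\<in>UC \<omega>. M (\<lambda>x. c * f x) = c * M f) \<and>
     (\<exists>B. \<forall>f\<in>UC \<omega>. cmod (M f) \<le> B * norm (Bcontfun f))"

definition alpha_mean ::
    "('a::t2_space \<Rightarrow> 'a \<Rightarrow> 'a measure) \<Rightarrow> ('a \<Rightarrow> complex) \<Rightarrow>
     (('a \<Rightarrow> complex) \<Rightarrow> complex) \<Rightarrow> bool" where
  "alpha_mean \<omega> \<alpha> M \<longleftrightarrow>
     bounded_functional_UC \<omega> M \<and> M \<alpha> = 1 \<and>
     (\<forall>f\<in>UC \<omega>. \<forall>x. M (translate \<omega> x f) = \<alpha> x * M f)"

end

theory Submission
  imports Defs
begin

text \<open>If \<open>\<alpha>\<close> did not vanish at infinity, one could choose points \<open>y\<^sub>n\<close> going to infinity with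
  \<open>|\<alpha>(y\<^sub>n)|\<close> bounded below, and a function \<open>f\<close> in \<open>UC(K)\<close> such that, for every \<open>x\<close>, the quotient
  \<open>T\<^sub>x f(y\<^sub>n) / \<alpha>(y\<^sub>n)\<close> is eventually \<open>c \<alpha>(x)\<close> with \<open>c \<noteq> 0\<close> along one subsequence, and eventually \<open>0\<close>
  along another. Cluster points \<open>p\<close> of the functionals \<open>g \<mapsto> g(y\<^sub>n) / \<alpha>(y\<^sub>n)\<close> along the two
  subsequences give \<open>\<alpha>\<close>-means \<open>g \<mapsto> M(x \<mapsto> p(T\<^sub>x g))\<close> with different values at \<open>f\<close>. So uniqueness
  makes \<open>\<alpha>\<close> vanish at infinity. Then \<open>M(\<phi>) \<noteq> 0\<close> for some compactly supported \<open>\<phi>\<close>, and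
  \<open>M(\<integral> g(x) T\<^sub>x \<phi> dm(x)) = M(\<phi>) \<integral> g \<alpha> dm\<close> bounds \<open>\<integral> |\<alpha>| dm\<close>. Once \<open>\<alpha>\<close> is integrable,
  \<open>f \<mapsto> \<integral> f cnj(\<alpha>) dm / \<parallel>\<alpha>\<parallel>\<^sup>2\<close> is an \<open>\<alpha>\<close>-mean, hence equals \<open>M\<close>; the Fourier transform of \<open>\<alpha>\<close> is
  continuous and vanishes off \<open>\<alpha>\<close>, so \<open>{\<alpha>}\<close> is open and has positive Plancherel measure. If
  \<open>\<alpha> \<ge> 0\<close>, then \<open>M(1) \<noteq> 0\<close> forces \<open>\<alpha> = 1\<close>, and a space on which 1 vanishes at infinity is compact.\<close>

section \<open>Integration against compactly supported weights\<close>

text \<open>Haar measure need not be sigma-finite, so product measures give no Fubini theorem, and a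
  mean is bounded for the supremum norm only, so no convergence theorem moves it under an integral.
  Both exchanges are made with Riemann sums that are uniform in a parameter, for weights carried by
  compact sets.

  The quotients at the points going to infinity are made eventually constant, not just convergent,
  so every cluster point takes the prescribed value. The functional \<open>p\<close> has no
  equivariance of its own; that comes from \<open>M\<close>, and the composition needs
  \<open>x \<mapsto> p (T x g)\<close> to stay in \<open>UC \<omega>\<close>.

  An oscillating multiple of \<alpha> is only bounded and continuous; convolution with a bump near
  the unit puts it into \<open>UC \<omega>\<close>. This rests on translation by
  \<open>bar x\<close> being adjoint to translation by \<open>x\<close>, which has to be derived
  from invariance.

  As the space need not be sigma-compact, the oscillation is timed by compact stages inside cosets
  of a subhypergroup, not by an exhaustion of the whole space.\<close>

lemma disjoint_refinement:
  assumes "finite I" "\<And>i. i \<in> I \<Longrightarrow> N i \<in> sets M"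
  shows "\<exists>B. (\<forall>i\<in>I. B i \<in> sets M \<and> B i \<subseteq> N i) \<and> disjoint_family_on B I \<and>
    (\<Union>i\<in>I. B i) = (\<Union>i\<in>I. N i)"
  using assms
proof (induction I)
  case empty
  then show ?case by (simp add: disjoint_family_on_def)
next
  case (insert j I)
  then obtain B where B: "\<forall>i\<in>I. B i \<in> sets M \<and> B i \<subseteq> N i" "disjoint_family_on B I"
    "(\<Union>i\<in>I. B i) = (\<Union>i\<in>I. N i)"
    by auto
  define B' where "B' = B(j := N j - (\<Union>i\<in>I. N i))"
  have "disjoint_family_on B' (insert j I)"
    unfolding B'_def disjoint_family_on_def
  proof (intro ballI impI)
    fix a b assume ab: "a \<in> insert j I" "b \<in> insert j I" "a \<noteq> b"
    have "B i \<subseteq> (\<Union>i\<in>I. N i)" if "i \<in> I" for i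
      using B(1) that by blast
    then show "(B(j := N j - (\<Union>i\<in>I. N i))) a \<inter> (B(j := N j - (\<Union>i\<in>I. N i))) b = {}"
      using ab disjoint_family_onD[OF B(2), of a b] by auto
  qed
  moreover have "\<forall>i\<in>insert j I. B' i \<in> sets M \<and> B' i \<subseteq> N i"
    using B(1) insert by (auto simp: B'_def intro!: sets.Diff sets.finite_UN)
  moreover have "(\<Union>i\<in>insert j I. B' i) = (\<Union>i\<in>insert j I. N i)"
  proof -
    have "(\<Union>i\<in>I. B' i) = (\<Union>i\<in>I. B i)"
      using insert(2) by (auto simp: B'_def)
    then show ?thesis
      using B(3) by (auto simp: B'_def)
  qed
  ultimately show ?case by blast
qed

text \<open>For non-integrable \<open>f\<close> the integral is 0 by convention, and the right side
  is nonnegative because \<open>g\<close> dominates a norm almost everywhere.\<close>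

lemma norm_integral_le_AE:
  fixes f :: "'a \<Rightarrow> 'b::{banach, second_countable_topology}"
  assumes "integrable M g" "AE x in M. norm (f x) \<le> g x"
  shows "norm (\<integral>x. f x \<partial>M) \<le> (\<integral>x. g x \<partial>M)"
proof (cases "integrable M f")
  case True
  then show ?thesis
    by (intro order_trans[OF integral_norm_bound integral_mono_AE] integrable_norm assms)
next
  case False
  have "AE x in M. 0 \<le> g x"
    using assms(2) by eventually_elim (use norm_ge_zero order_trans in blast)
  then show ?thesis
    using False by (simp add: not_integrable_integral_eq integral_nonneg_AE)
qed

text \<open>One notion covers two uses: functions in \<open>CC\<close> against Haar measure, and the
  constant weight 1 against a convolution \<open>\<omega> x y\<close>. The constant vanishes off the
  compact support only in the almost-everywhere sense, hence the form of the last condition.\<close>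

definition compact_weight :: "'a::t2_space measure \<Rightarrow> ('a \<Rightarrow> complex) \<Rightarrow> bool" where
  "compact_weight \<mu> g \<longleftrightarrow> sets \<mu> = sets borel \<and> continuous_on UNIV g \<and>
     (\<exists>C. compact C \<and> emeasure \<mu> C < \<infinity> \<and> (AE x in \<mu>. x \<notin> C \<longrightarrow> g x = 0))"

lemma borel_measurable_sets_eq:
  "sets \<mu> = sets borel \<Longrightarrow> continuous_on UNIV v \<Longrightarrow> v \<in> borel_measurable \<mu>"
  using borel_measurable_continuous_onI measurable_cong_sets[OF _ refl] by metis

lemma integrable_compact_AE:
  fixes v :: "'a::t2_space \<Rightarrow> 'b::{banach, second_countable_topology}"
  assumes "sets \<mu> = sets borel" "compact C" "emeasure \<mu> C < \<infinity>" "continuous_on UNIV v"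
    "AE x in \<mu>. x \<notin> C \<longrightarrow> v x = 0"
  shows "integrable \<mu> v"
proof -
  have "bounded (v ` C)"
    by (intro compact_imp_bounded compact_continuous_image continuous_on_subset[OF assms(4)] assms) simp
  then obtain B where B: "\<And>x. x \<in> C \<Longrightarrow> norm (v x) \<le> B"
    by (auto simp: bounded_iff)
  have C: "C \<in> sets \<mu>"
    using assms compact_imp_closed borel_closed by auto
  have "integrable \<mu> (\<lambda>x. indicator C x * B)"
    using C assms(3) by (intro integrable_mult_left) (simp add: integrable_indicator_iff)
  moreover have "AE x in \<mu>. norm (v x) \<le> norm (indicator C x * B)"
    using assms(5)
  proof eventually_elim
    case (elim x)
    then show ?case using B[of x] by (cases "x \<in> C") auto
  qed
  ultimately show ?thesis
    using borel_measurable_sets_eq[OF assms(1,4)] by (metis Bochner_Integration.integrable_bound)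
qed

lemma compact_weight_integrable:
  assumes "compact_weight \<mu> g" "continuous_on UNIV v"
  shows "integrable \<mu> (\<lambda>x. g x * v x)"
proof -
  obtain C where C: "compact C" "emeasure \<mu> C < \<infinity>" "AE x in \<mu>. x \<notin> C \<longrightarrow> g x = 0"
    using assms by (auto simp: compact_weight_def)
  show ?thesis
    by (rule integrable_compact_AE[OF _ C(1,2)])
      (use assms C(3) in \<open>auto simp: compact_weight_def intro!: continuous_intros\<close>)
qed

lemma compact_weight_integrable_self: "compact_weight \<mu> g \<Longrightarrow> integrable \<mu> g"
  using compact_weight_integrable[of \<mu> g "\<lambda>_. 1"] by simp

text \<open>The nodes \<open>I\<close> and the weights \<open>w\<close> serve all parameters
  \<open>b\<close> at once, because the neighbourhoods in \<open>equi\<close> do not depend on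
  \<open>b\<close>. This uniformity is what later stands in for Fubini's theorem and for moving a
  bounded functional under an integral.\<close>

lemma compact_weight_Riemann_sum:
  fixes V :: "'a::t2_space \<Rightarrow> 'b \<Rightarrow> complex"
  assumes g: "compact_weight \<mu> g" and V: "\<And>b. b \<in> S \<Longrightarrow> continuous_on UNIV (\<lambda>x. V x b)"
    and equi: "\<And>x \<epsilon>. \<epsilon> > 0 \<Longrightarrow> \<exists>N. open N \<and> x \<in> N \<and> (\<forall>y\<in>N. \<forall>b\<in>S. cmod (V y b - V x b) \<le> \<epsilon>)"
    and "\<epsilon> > 0"
  shows "\<exists>I w. finite I \<and> (\<forall>b\<in>S. cmod ((\<integral>x. g x * V x b \<partial>\<mu>) - (\<Sum>i\<in>I. w i * V i b)) \<le> \<epsilon>)"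
proof -
  obtain C where C: "compact C" "emeasure \<mu> C < \<infinity>" "AE x in \<mu>. x \<notin> C \<longrightarrow> g x = 0"
    and sets: "sets \<mu> = sets borel" and gc: "continuous_on UNIV g"
    using g by (auto simp: compact_weight_def)
  define G where "G = (\<integral>x. cmod (g x) \<partial>\<mu>)"
  have G: "G \<ge> 0" by (simp add: G_def)
  \<comment> \<open>The total error is at most \<open>G * \<delta>\<close>; the added 1 covers the
    case \<open>G = 0\<close>.\<close>
  define \<delta> where "\<delta> = \<epsilon> / (G + 1)"
  have \<delta>: "\<delta> > 0" using G \<open>\<epsilon> > 0\<close> by (simp add: \<delta>_def)
  obtain N where N: "\<And>x. open (N x) \<and> x \<in> N x \<and> (\<forall>y\<in>N x. \<forall>b\<in>S. cmod (V y b - V x b) \<le> \<delta>)"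
    using equi[OF \<delta>] by metis
  have "C \<subseteq> (\<Union>x\<in>C. N x)" using N by blast
  from compactE_image[OF C(1) _ this] N obtain I where I: "I \<subseteq> C" "finite I" "C \<subseteq> (\<Union>i\<in>I. N i)"
    by metis
  obtain B0 where B0: "\<forall>i\<in>I. B0 i \<in> sets borel \<and> B0 i \<subseteq> N i" "disjoint_family_on B0 I"
    "(\<Union>i\<in>I. B0 i) = (\<Union>i\<in>I. N i)"
    using disjoint_refinement[OF I(2), of N borel] N by auto
  \<comment> \<open>The pieces partition \<open>C\<close>. The centre \<open>i\<close> of
    \<open>N i\<close> is the node for \<open>B i\<close>, although it may lie outside that piece
    after the refinement.\<close>
  define B where "B i = B0 i \<inter> C" for i
  have B: "B i \<in> sets \<mu>" if "i \<in> I" for i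
    using B0(1) that C(1) by (auto simp: B_def sets intro: borel_closed compact_imp_closed)
  have ind: "(\<Sum>i\<in>I. indicator (B i) x) = (indicator C x :: real)" for x
  proof -
    have "disjoint_family_on B I" "(\<Union>i\<in>I. B i) = C"
      using B0 I by (auto simp: disjoint_family_on_def B_def disjoint_iff)
    then show ?thesis
      using indicator_UN_disjoint[OF I(2), of B x] by metis
  qed
  have int: "integrable \<mu> (\<lambda>x. indicator (B i) x *\<^sub>R (g x * v x))"
    if "i \<in> I" "continuous_on UNIV v" for i v
    by (intro integrable_mult_indicator B that compact_weight_integrable[OF g])
  have int1: "integrable \<mu> (\<lambda>x. indicator (B i) x *\<^sub>R g x)" if "i \<in> I" for i
    using int[OF that, of "\<lambda>_. 1"] by simp
  define w where "w i = (\<integral>x. indicator (B i) x *\<^sub>R g x \<partial>\<mu>)" for i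
  have "cmod ((\<integral>x. g x * V x b \<partial>\<mu>) - (\<Sum>i\<in>I. w i * V i b)) \<le> \<epsilon>" if b: "b \<in> S" for b
  proof -
    have "(\<integral>x. g x * V x b \<partial>\<mu>) = (\<integral>x. (\<Sum>i\<in>I. indicator (B i) x *\<^sub>R (g x * V x b)) \<partial>\<mu>)"
    proof (rule integral_cong_AE)
      show "(\<lambda>x. g x * V x b) \<in> borel_measurable \<mu>"
        using V[OF b] g gc by (intro borel_measurable_sets_eq[OF sets] continuous_intros) auto
      show "(\<lambda>x. \<Sum>i\<in>I. indicator (B i) x *\<^sub>R (g x * V x b)) \<in> borel_measurable \<mu>"
        using int[OF _ V[OF b]] by (intro borel_measurable_sum) auto
      have "g x * V x b = (\<Sum>i\<in>I. indicator (B i) x *\<^sub>R (g x * V x b))"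
        if "x \<notin> C \<longrightarrow> g x = 0" for x
      proof -
        have "g x * V x b = (indicator C x :: real) *\<^sub>R (g x * V x b)"
          using that by (auto simp: indicator_def)
        also have "\<dots> = (\<Sum>i\<in>I. indicator (B i) x *\<^sub>R (g x * V x b))"
          by (simp only: ind[symmetric] scaleR_sum_left)
        finally show ?thesis .
      qed
      then show "AE x in \<mu>. g x * V x b = (\<Sum>i\<in>I. indicator (B i) x *\<^sub>R (g x * V x b))"
        by (rule AE_mp[OF C(3) AE_I2[OF impI]])
    qed
    also have "\<dots> = (\<Sum>i\<in>I. \<integral>x. indicator (B i) x *\<^sub>R (g x * V x b) \<partial>\<mu>)"
      by (intro Bochner_Integration.integral_sum int V b)
    finally have 1: "(\<integral>x. g x * V x b \<partial>\<mu>) = \<dots>" .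
    have "w i * V i b = (\<integral>x. indicator (B i) x *\<^sub>R (g x * V i b) \<partial>\<mu>)" if "i \<in> I" for i
      unfolding w_def mult_scaleR_left[symmetric] mult.assoc[symmetric]
      by (rule integral_mult_left_zero[symmetric])
    then have "(\<integral>x. g x * V x b \<partial>\<mu>) - (\<Sum>i\<in>I. w i * V i b) =
       (\<Sum>i\<in>I. (\<integral>x. indicator (B i) x *\<^sub>R (g x * V x b) \<partial>\<mu>) - (\<integral>x. indicator (B i) x *\<^sub>R (g x * V i b) \<partial>\<mu>))"
      by (simp add: 1 sum_subtractf)
    also have "\<dots> = (\<Sum>i\<in>I. (\<integral>x. indicator (B i) x *\<^sub>R (g x * (V x b - V i b)) \<partial>\<mu>))"
    proof (intro sum.cong refl)
      fix i assume i: "i \<in> I"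
      show "(\<integral>x. indicator (B i) x *\<^sub>R (g x * V x b) \<partial>\<mu>) - (\<integral>x. indicator (B i) x *\<^sub>R (g x * V i b) \<partial>\<mu>) =
          (\<integral>x. indicator (B i) x *\<^sub>R (g x * (V x b - V i b)) \<partial>\<mu>)"
        unfolding right_diff_distrib scaleR_diff_right
        by (rule Bochner_Integration.integral_diff[symmetric]) (intro int i V b continuous_on_const)+
    qed
    also have "cmod \<dots> \<le> (\<Sum>i\<in>I. (\<integral>x. indicator (B i) x * cmod (g x) * \<delta> \<partial>\<mu>))"
    proof (rule sum_norm_le)
      fix i assume i: "i \<in> I"
      show "cmod (\<integral>x. indicator (B i) x *\<^sub>R (g x * (V x b - V i b)) \<partial>\<mu>) \<le>
          (\<integral>x. indicator (B i) x * cmod (g x) * \<delta> \<partial>\<mu>)"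
      proof (rule norm_integral_le_AE)
      have "integrable \<mu> (\<lambda>x. norm (indicator (B i) x *\<^sub>R g x))"
        by (intro integrable_norm int1 i)
      then show "integrable \<mu> (\<lambda>x. indicator (B i) x * cmod (g x) * \<delta>)"
        by (intro integrable_mult_left) simp
      show "AE x in \<mu>. cmod (indicator (B i) x *\<^sub>R (g x * (V x b - V i b))) \<le> indicator (B i) x * cmod (g x) * \<delta>"
        using N[of i] B0(1) i b by (auto simp: indicator_def norm_mult B_def intro!: mult_left_mono AE_I2)
      qed
    qed
    also have "\<dots> = (\<integral>x. (\<Sum>i\<in>I. indicator (B i) x * cmod (g x) * \<delta>) \<partial>\<mu>)"
      using int1[THEN integrable_norm]
      by (intro Bochner_Integration.integral_sum[symmetric] integrable_mult_left) simp
    also have "\<dots> = (\<integral>x. indicator C x * (cmod (g x) * \<delta>) \<partial>\<mu>)"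
      by (simp only: sum_distrib_right[symmetric] ind mult.assoc)
    also have "\<dots> \<le> (\<integral>x. cmod (g x) * \<delta> \<partial>\<mu>)"
    proof (rule integral_mono_AE')
      show "integrable \<mu> (\<lambda>x. cmod (g x) * \<delta>)"
        using compact_weight_integrable_self[OF g] by (intro integrable_mult_left integrable_norm)
      show "AE x in \<mu>. indicator C x * (cmod (g x) * \<delta>) \<le> cmod (g x) * \<delta>"
        using \<delta> by (intro AE_I2) (auto simp: indicator_def)
    qed (use \<delta> in auto)
    also have "\<dots> = G * \<delta>" by (simp add: G_def)
    also have "\<dots> \<le> \<epsilon>" using G \<open>\<epsilon> > 0\<close> by (simp add: \<delta>_def field_simps)
    finally show ?thesis .
  qed
  with I(2) show ?thesis by blast
qed

lemma compact_weight_integral_bound: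
  assumes g: "compact_weight \<mu> g" and "continuous_on UNIV v" "continuous_on UNIV v'"
    and C: "AE x in \<mu>. x \<notin> C \<longrightarrow> g x = 0" "\<And>x. x \<in> C \<Longrightarrow> cmod (v x - v' x) \<le> \<epsilon>"
  shows "cmod ((\<integral>x. g x * v x \<partial>\<mu>) - (\<integral>x. g x * v' x \<partial>\<mu>)) \<le> \<epsilon> * (\<integral>x. cmod (g x) \<partial>\<mu>)"
proof -
  have "(\<integral>x. g x * v x \<partial>\<mu>) - (\<integral>x. g x * v' x \<partial>\<mu>) = (\<integral>x. g x * (v x - v' x) \<partial>\<mu>)"
    by (subst Bochner_Integration.integral_diff[symmetric])
      (auto intro!: compact_weight_integrable assms simp: algebra_simps)
  also have "cmod \<dots> \<le> (\<integral>x. \<epsilon> * cmod (g x) \<partial>\<mu>)"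
  proof (rule order_trans[OF integral_norm_bound], rule integral_mono_AE)
    show "integrable \<mu> (\<lambda>x. cmod (g x * (v x - v' x)))"
      by (intro integrable_norm compact_weight_integrable assms continuous_intros)
    show "integrable \<mu> (\<lambda>x. \<epsilon> * cmod (g x))"
      using compact_weight_integrable_self[OF g] by (intro integrable_mult_right integrable_norm)
    show "AE x in \<mu>. cmod (g x * (v x - v' x)) \<le> \<epsilon> * cmod (g x)"
      using C(1)
    proof eventually_elim
      case (elim x)
      then show ?case
        using C(2)[of x]
        by (cases "x \<in> C") (auto simp: norm_mult mult.commute[of \<epsilon>] intro: mult_left_mono)
    qed
  qed
  finally show ?thesis by simp
qed

text \<open>On the compact set that carries \<open>g\<close>, joint continuity makes
  \<open>F x\<close> converge to \<open>F x0\<close> uniformly, so the difference of the integrals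
  is controlled by the integral of \<open>cmod (g x)\<close>.\<close>

lemma compact_weight_equicontinuous:
  fixes F :: "'b::topological_space \<Rightarrow> 'a::t2_space \<Rightarrow> complex"
  assumes g: "compact_weight \<mu> g" and F: "continuous_on UNIV (\<lambda>(x, y). F x y)" and "\<epsilon> > 0"
  shows "\<exists>N. open N \<and> x0 \<in> N \<and>
    (\<forall>x\<in>N. cmod ((\<integral>y. g y * F x y \<partial>\<mu>) - (\<integral>y. g y * F x0 y \<partial>\<mu>)) \<le> \<epsilon>)"
proof -
  obtain C where C: "compact C" "AE x in \<mu>. x \<notin> C \<longrightarrow> g x = 0"
    using g by (auto simp: compact_weight_def)
  define G where "G = (\<integral>x. cmod (g x) \<partial>\<mu>)"
  have G: "G \<ge> 0" by (simp add: G_def)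
  have e: "\<epsilon> / (G + 1) > 0" using \<open>\<epsilon> > 0\<close> G by simp
  have "continuous_on (UNIV \<times> C) (\<lambda>(x, y). F x y)"
    using F continuous_on_subset by blast
  from continuous_on_prod_compactE[OF this C(1) UNIV_I e, of x0]
  obtain N where N: "x0 \<in> N" "open N" "\<forall>x\<in>N. \<forall>t\<in>C. cmod (F x t - F x0 t) \<le> \<epsilon> / (G + 1)"
    by (auto simp: dist_norm)
  have Fc: "continuous_on UNIV (F x)" for x
    using continuous_on_compose2[OF F, of UNIV "\<lambda>y. (x, y)"] by (simp add: continuous_intros)
  have "cmod ((\<integral>y. g y * F x y \<partial>\<mu>) - (\<integral>y. g y * F x0 y \<partial>\<mu>)) \<le> \<epsilon>" if "x \<in> N" for x
  proof -
    have "cmod ((\<integral>y. g y * F x y \<partial>\<mu>) - (\<integral>y. g y * F x0 y \<partial>\<mu>)) \<le> \<epsilon> / (G + 1) * G"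
      unfolding G_def using N that
      by (intro compact_weight_integral_bound[OF g Fc Fc C(2)]) (auto simp: G_def)
    also have "\<dots> \<le> \<epsilon>" using G \<open>\<epsilon> > 0\<close> by (simp add: field_simps)
    finally show ?thesis .
  qed
  with N show ?thesis by blast
qed

lemma compact_weight_continuous:
  fixes F :: "'b::topological_space \<Rightarrow> 'a::t2_space \<Rightarrow> complex"
  assumes g: "compact_weight \<mu> g" and F: "continuous_on UNIV (\<lambda>(x, y). F x y)"
  shows "continuous_on UNIV (\<lambda>x. \<integral>y. g y * F x y \<partial>\<mu>)"
  unfolding continuous_on_def
proof (intro ballI tendstoI)
  fix x and \<epsilon> :: real assume "\<epsilon> > 0"
  then obtain N where "open N" "x \<in> N"
    "\<forall>y\<in>N. cmod ((\<integral>z. g z * F y z \<partial>\<mu>) - (\<integral>z. g z * F x z \<partial>\<mu>)) \<le> \<epsilon> / 2"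
    using compact_weight_equicontinuous[OF g F, of "\<epsilon> / 2" x] by auto
  then show "\<forall>\<^sub>F y in at x within UNIV. dist (\<integral>z. g z * F y z \<partial>\<mu>) (\<integral>z. g z * F x z \<partial>\<mu>) < \<epsilon>"
    unfolding eventually_at_topological using \<open>\<epsilon> > 0\<close>
    by (intro exI[of _ N]) (force simp: dist_norm)
qed

text \<open>Riemann sums in \<open>x\<close> reduce the exchange to interchanging an integral with a
  finite sum. One sum, with common nodes and weights, has to approximate both the integrals over
  \<open>x\<close> for each fixed \<open>y\<close> and the iterated integral.\<close>

lemma compact_weight_Fubini:
  fixes F :: "'a::t2_space \<Rightarrow> 'b::t2_space \<Rightarrow> complex"
  assumes g: "compact_weight \<mu> g" and h: "compact_weight \<nu> h"
    and F: "continuous_on UNIV (\<lambda>(x, y). F x y)"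
  shows "(\<integral>x. g x * (\<integral>y. h y * F x y \<partial>\<nu>) \<partial>\<mu>) = (\<integral>y. h y * (\<integral>x. g x * F x y \<partial>\<mu>) \<partial>\<nu>)"
    (is "?l = ?r")
proof -
  obtain D where D: "compact D" "AE y in \<nu>. y \<notin> D \<longrightarrow> h y = 0"
    using h by (auto simp: compact_weight_def)
  define H where "H = (\<integral>y. cmod (h y) \<partial>\<nu>)"
  have H: "H \<ge> 0" by (simp add: H_def)
  have F': "continuous_on UNIV (\<lambda>(y, x). F x y)"
    using continuous_on_compose2[OF F, of UNIV "\<lambda>(y, x). (x, y)"]
    by (simp add: case_prod_unfold continuous_intros)
  have Fc: "continuous_on UNIV (F x)" for x
    using continuous_on_compose2[OF F, of UNIV "\<lambda>y. (x, y)"] by (simp add: continuous_intros)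
  have Fc': "continuous_on UNIV (\<lambda>x. F x y)" for y
    using continuous_on_compose2[OF F, of UNIV "\<lambda>x. (x, y)"] by (simp add: continuous_intros)
  \<comment> \<open>The option type adds one parameter to the points \<open>y\<close>:
    \<open>None\<close> carries the function already integrated over \<open>y\<close>.\<close>
  define V where "V x b = (case b of None \<Rightarrow> (\<integral>y. h y * F x y \<partial>\<nu>) | Some y \<Rightarrow> F x y)" for x b
  have *: "cmod (?l - ?r) \<le> \<epsilon> * (H + 1)" if \<epsilon>: "\<epsilon> > 0" for \<epsilon>
  proof -
    have "\<exists>I w. finite I \<and> (\<forall>b\<in>insert None (Some ` D).
        cmod ((\<integral>x. g x * V x b \<partial>\<mu>) - (\<Sum>i\<in>I. w i * V i b)) \<le> \<epsilon>)"
    proof (rule compact_weight_Riemann_sum[OF g _ _ \<epsilon>])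
      fix b assume "b \<in> insert None (Some ` D)"
      then show "continuous_on UNIV (\<lambda>x. V x b)"
        using compact_weight_continuous[OF h F] Fc' by (auto simp: V_def)
    next
      fix x and \<delta> :: real assume \<delta>: "\<delta> > 0"
      obtain N1 where N1: "open N1" "x \<in> N1"
        "\<forall>z\<in>N1. cmod ((\<integral>y. h y * F z y \<partial>\<nu>) - (\<integral>y. h y * F x y \<partial>\<nu>)) \<le> \<delta>"
        using compact_weight_equicontinuous[OF h F \<delta>] by blast
      have "continuous_on (UNIV \<times> D) (\<lambda>(x, y). F x y)"
        using F continuous_on_subset by blast
      from continuous_on_prod_compactE[OF this D(1) UNIV_I \<delta>, of x]
      obtain N2 where "x \<in> N2" "open N2" "\<forall>z\<in>N2. \<forall>t\<in>D. cmod (F z t - F x t) \<le> \<delta>"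
        by (auto simp: dist_norm)
      with N1 show "\<exists>N. open N \<and> x \<in> N \<and>
          (\<forall>y\<in>N. \<forall>b\<in>insert None (Some ` D). cmod (V y b - V x b) \<le> \<delta>)"
        by (intro exI[of _ "N1 \<inter> N2"]) (auto simp: V_def)
    qed
    then obtain I w where I: "finite I" and *: "\<forall>b\<in>insert None (Some ` D).
        cmod ((\<integral>x. g x * V x b \<partial>\<mu>) - (\<Sum>i\<in>I. w i * V i b)) \<le> \<epsilon>"
      by blast
    have 1: "cmod (?l - (\<Sum>i\<in>I. w i * (\<integral>y. h y * F i y \<partial>\<nu>))) \<le> \<epsilon>"
      using *[rule_format, of None] by (simp add: V_def)
    have 2: "cmod ((\<integral>x. g x * F x y \<partial>\<mu>) - (\<Sum>i\<in>I. w i * F i y)) \<le> \<epsilon>" if "y \<in> D" for y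
      using *[rule_format, of "Some y"] that by (simp add: V_def)
    have "(\<integral>y. h y * (\<Sum>i\<in>I. w i * F i y) \<partial>\<nu>) = (\<Sum>i\<in>I. w i * (\<integral>y. h y * F i y \<partial>\<nu>))"
    proof -
      have "(\<integral>y. h y * (\<Sum>i\<in>I. w i * F i y) \<partial>\<nu>) = (\<integral>y. (\<Sum>i\<in>I. w i * (h y * F i y)) \<partial>\<nu>)"
        by (simp add: sum_distrib_left mult_ac)
      also have "\<dots> = (\<Sum>i\<in>I. w i * (\<integral>y. h y * F i y \<partial>\<nu>))"
        using compact_weight_integrable[OF h Fc] by (subst Bochner_Integration.integral_sum) auto
      finally show ?thesis .
    qed
    moreover have "cmod (?r - (\<integral>y. h y * (\<Sum>i\<in>I. w i * F i y) \<partial>\<nu>)) \<le> \<epsilon> * H"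
      unfolding H_def using 2
      by (intro compact_weight_integral_bound[OF h _ _ D(2)] compact_weight_continuous[OF g F']
          continuous_intros Fc) auto
    ultimately have "cmod (?l - ?r) \<le> \<epsilon> + \<epsilon> * H"
      using 1 norm_triangle_ineq4[of "?l - (\<integral>y. h y * (\<Sum>i\<in>I. w i * F i y) \<partial>\<nu>)"
          "?r - (\<integral>y. h y * (\<Sum>i\<in>I. w i * F i y) \<partial>\<nu>)"] by simp
    then show ?thesis by (simp add: algebra_simps)
  qed
  have "cmod (?l - ?r) \<le> e" if "e > 0" for e
  proof -
    have "cmod (?l - ?r) \<le> e / (H + 1) * (H + 1)"
      using H that by (intro *) simp
    then show ?thesis using H by simp
  qed
  then have "cmod (?l - ?r) \<le> 0" by (rule field_le_epsilon) simp
  then show ?thesis by simp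
qed

section \<open>Locally compact Hausdorff spaces\<close>

lemma compact_Urysohn:
  fixes C :: "'a::t2_space set"
  assumes lc: "locally_compact_space (euclidean :: 'a topology)" and "compact C" "open U" "C \<subseteq> U"
  obtains u :: "'a \<Rightarrow> real" and D where "continuous_on UNIV u" "\<And>x. 0 \<le> u x" "\<And>x. u x \<le> 1"
    "\<And>x. x \<in> C \<Longrightarrow> u x = 1" "compact D" "D \<subseteq> U" "\<And>x. x \<notin> D \<Longrightarrow> u x = 0"
proof -
  have haus: "Hausdorff_space (euclidean :: 'a topology)"
    by (simp add: Hausdorff_space_def disjnt_def) (metis hausdorff)
  have cr: "completely_regular_space (euclidean :: 'a topology)"
    using locally_compact_regular_imp_completely_regular_space lc haus by blast
  obtain V L where V: "open V" "compact L" "C \<subseteq> V" "V \<subseteq> L"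
    using lc haus locally_compact_space_compact_closed_compact[of "euclidean :: 'a topology"] assms(2)
    by auto
  define S where "S = - (U \<inter> V)"
  have S: "closed S" "disjnt C S"
    using V assms by (auto simp: disjnt_def S_def closed_Compl)
  obtain f :: "'a \<Rightarrow> real" where f: "continuous_map euclidean euclideanreal f"
    "f ` C \<subseteq> {2}" "f ` S \<subseteq> {-1}"
    using Urysohn_completely_regular_compact_closed_alt[OF cr, where S=C and T=S and a="-1" and b=2] S assms(2)
    by (metis closed_closedin compactin_euclidean_iff)
  define u where "u x = max 0 (min 1 (f x))" for x
  \<comment> \<open>Since \<open>f\<close> is -1 and not 0 on \<open>S\<close>, the closed set where
    \<open>f\<close> is nonnegative misses \<open>S\<close>. Off \<open>D\<close> a point lies in
    \<open>S\<close> or has \<open>f\<close> negative, so clipping gives 0 there.\<close>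
  define D where "D = f -` {0..} \<inter> L"
  show ?thesis
  proof
    have fc: "continuous_on UNIV f" using f(1) by simp
    then show "continuous_on UNIV u"
      unfolding u_def by (intro continuous_intros)
    show "0 \<le> u x" "u x \<le> 1" for x by (auto simp: u_def)
    show "u x = 1" if "x \<in> C" for x using f(2) that by (auto simp: u_def)
    have "closed (f -` {0..})" using fc by (intro closed_vimage) auto
    then show "compact D" unfolding D_def using V(2) by (rule closed_Int_compact)
    show "D \<subseteq> U" using f(3) by (force simp: D_def S_def)
    show "u x = 0" if "x \<notin> D" for x
    proof (cases "x \<in> S")
      case True
      then show ?thesis using f(3) by (force simp: u_def)
    next
      case False
      then have "x \<in> L" using V by (auto simp: S_def)
      with that show ?thesis by (auto simp: u_def D_def)
    qed
  qed
qed

section \<open>Supports of convolutions\<close>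

lemma measure_support_closed: "closed (measure_support euclidean (\<mu> :: 'a::topological_space measure))"
proof -
  have "- measure_support euclidean \<mu> = \<Union>{U. open U \<and> \<not> emeasure \<mu> U > 0}"
    by (auto simp: measure_support_def)
  also have "open \<dots>" by blast
  finally show ?thesis by (simp add: closed_def)
qed

text \<open>The complement of the support is a union of possibly uncountably many null open sets.
  Inner regularity reduces its measure to that of compact subsets, and each of these is covered by
  finitely many of the null sets.\<close>

lemma AE_measure_support:
  assumes "radon_measure euclidean (\<mu> :: 'a::t2_space measure)"
  shows "AE x in \<mu>. x \<in> measure_support euclidean \<mu>"
proof -
  let ?N = "- measure_support euclidean \<mu>"
  have sets: "sets \<mu> = sets borel"
    using assms by (simp add: radon_measure_def borel_of_euclidean)
  have "open ?N" using measure_support_closed by blast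
  then have "emeasure \<mu> ?N = (SUP C\<in>{C. compact C \<and> C \<subseteq> ?N}. emeasure \<mu> C)"
    using assms unfolding radon_measure_def by simp
  also have "\<dots> = 0"
  proof -
    have "emeasure \<mu> C = 0" if "compact C" "C \<subseteq> ?N" for C
    proof -
      have "\<exists>U. open U \<and> x \<in> U \<and> emeasure \<mu> U = 0" if "x \<in> C" for x
        using subsetD[OF \<open>C \<subseteq> ?N\<close> that] by (auto simp: measure_support_def)
      then obtain U where U: "\<And>x. x \<in> C \<Longrightarrow> open (U x) \<and> x \<in> U x \<and> emeasure \<mu> (U x) = 0"
        by metis
      have "C \<subseteq> (\<Union>x\<in>C. U x)" using U by blast
      from compactE_image[OF \<open>compact C\<close> _ this] U obtain I where
        I: "I \<subseteq> C" "finite I" "C \<subseteq> (\<Union>i\<in>I. U i)"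
        by metis
      have "(\<Union>i\<in>I. U i) \<in> null_sets \<mu>"
        using I U sets by (intro null_sets_UN' countable_finite) (auto intro!: null_setsI)
      then have "C \<in> null_sets \<mu>"
        using sets compact_imp_closed[OF \<open>compact C\<close>] I(3) by (rule_tac null_sets_subset) auto
      then show ?thesis by auto
    qed
    then show ?thesis by (intro antisym SUP_least) auto
  qed
  finally have "?N \<in> null_sets \<mu>"
    using sets \<open>open ?N\<close> by (intro null_setsI) auto
  then show ?thesis by (rule AE_I') auto
qed

context commutative_hypergroup
begin

abbreviation "S x y \<equiv> measure_support euclidean (\<omega> x y)"

abbreviation "T \<equiv> translate \<omega>"

lemma sets_convolution [simp]: "sets (\<omega> x y) = sets borel"
  using radon[of x y] by (simp add: radon_measure_def borel_of_euclidean)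

lemma space_convolution [simp]: "space (\<omega> x y) = UNIV"
  using sets_eq_imp_space_eq[OF sets_convolution] by simp

lemma emeasure_convolution_UNIV [simp]: "emeasure (\<omega> x y) UNIV = 1"
  using prob_space.emeasure_space_1[OF prob, of x y] by simp

lemma measure_convolution_UNIV [simp]: "measure (\<omega> x y) UNIV = 1"
  by (simp add: measure_def)

lemma AE_convolution: "AE z in \<omega> x y. z \<in> S x y"
  by (rule AE_measure_support[OF radon])

lemma compact_weight_convolution: "compact_weight (\<omega> x y) (\<lambda>_. 1)"
  unfolding compact_weight_def
proof (intro conjI exI)
  show "compact (S x y)" by (rule compact_support)
  have "emeasure (\<omega> x y) (S x y) \<le> emeasure (\<omega> x y) (space (\<omega> x y))"
    by (rule emeasure_space)
  then show "emeasure (\<omega> x y) (S x y) < \<infinity>"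
    by (simp add: order_le_less_trans[of _ 1])
  show "AE z in \<omega> x y. z \<notin> S x y \<longrightarrow> (1::complex) = 0"
    using AE_convolution[of x y] by eventually_elim simp
qed auto

lemma integrable_convolution: "continuous_on UNIV v \<Longrightarrow> integrable (\<omega> x y) (v :: 'a \<Rightarrow> complex)"
  using compact_weight_integrable[OF compact_weight_convolution] by simp

section \<open>Translation operators\<close>

lemma translate_cong:
  assumes "continuous_on UNIV f" "continuous_on UNIV g" "\<And>z. z \<in> S x y \<Longrightarrow> f z = g z"
  shows "T x f y = T x g y"
  unfolding translate_def
  by (rule integral_cong_AE)
    (use AE_convolution[of x y] assms in \<open>auto intro!: borel_measurable_sets_eq elim!: eventually_mono\<close>)

lemma translate_const [simp]: "T x (\<lambda>_. c) y = c"
  by (simp add: translate_def)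

lemma translate_bound:
  assumes "\<And>z. z \<in> S x y \<Longrightarrow> cmod (f z) \<le> B"
  shows "cmod (T x f y) \<le> B"
proof -
  have "cmod (T x f y) \<le> (\<integral>z. B \<partial>\<omega> x y)"
    unfolding translate_def
  proof (rule norm_integral_le_AE)
    show "AE z in \<omega> x y. cmod (f z) \<le> B"
      using AE_convolution[of x y] by eventually_elim (rule assms)
    interpret prob_space "\<omega> x y" by (rule prob)
    show "integrable (\<omega> x y) (\<lambda>z. B)" by simp
  qed
  then show ?thesis by simp
qed

lemma translate_add:
  "continuous_on UNIV f \<Longrightarrow> continuous_on UNIV g \<Longrightarrow> T x (\<lambda>z. f z + g z) y = T x f y + T x g y"
  unfolding translate_def by (intro Bochner_Integration.integral_add integrable_convolution)

lemma translate_diff: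
  "continuous_on UNIV f \<Longrightarrow> continuous_on UNIV g \<Longrightarrow> T x (\<lambda>z. f z - g z) y = T x f y - T x g y"
  unfolding translate_def by (intro Bochner_Integration.integral_diff integrable_convolution)

lemma translate_mult: "T x (\<lambda>z. c * f z) y = c * T x f y"
  unfolding translate_def by simp

lemma translate_of_real: "T x (\<lambda>z. complex_of_real (r z)) y = complex_of_real (\<integral>z. r z \<partial>\<omega> x y)"
  unfolding translate_def by (rule integral_complex_of_real)

lemma translate_commute: "T x f y = T y f x"
  by (simp add: translate_def commute[of x y])

lemma translate_continuous: "f \<in> bcontfun \<Longrightarrow> continuous_on UNIV (\<lambda>(x, y). T x f y)"
  unfolding translate_def by (rule weakly_continuous)

lemma bcontfun_bound:
  assumes "f \<in> bcontfun"
  obtains B where "B \<ge> 0" "\<And>x. cmod (f x) \<le> B"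
proof -
  obtain B where B: "\<And>x. cmod (f x) \<le> B"
    using assms by (auto simp: bcontfun_def bounded_iff)
  moreover have "B \<ge> 0" using order_trans[OF norm_ge_zero B[of undefined]] .
  ultimately show ?thesis using that by blast
qed

lemma bcontfunI_complex:
  "continuous_on UNIV f \<Longrightarrow> (\<And>x. cmod (f x) \<le> B) \<Longrightarrow> (f :: 'b::topological_space \<Rightarrow> complex) \<in> bcontfun"
  by (auto simp: bcontfun_def bounded_iff)

lemma bcontfun_continuous: "f \<in> bcontfun \<Longrightarrow> continuous_on UNIV f"
  by (simp add: bcontfun_def)

lemma translate_bcontfun:
  assumes f: "f \<in> bcontfun" shows "T x f \<in> bcontfun"
proof -
  obtain B where "\<And>x. cmod (f x) \<le> B" using bcontfun_bound[OF f] by blast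
  moreover have "continuous_on UNIV (T x f)"
    using continuous_on_compose2[OF translate_continuous[OF f], of UNIV "\<lambda>y. (x, y)"]
    by (simp add: continuous_intros)
  ultimately show ?thesis
    by (intro bcontfunI_complex translate_bound)
qed

lemma translate_translate:
  assumes "f \<in> bcontfun"
  shows "T x (T y f) z = (\<integral>t. T t f z \<partial>\<omega> x y)"
  using assoc[OF assms, where x=y and y=x and z=z] by (simp add: translate_def commute[of y x])

text \<open>Both sides integrate \<open>f\<close> against the convolution of the three point masses
  at \<open>x\<close>, \<open>y\<close> and \<open>z\<close>, which is symmetric in them.\<close>

lemma translate_translate_rotate:
  assumes "f \<in> bcontfun"
  shows "T x (T y f) z = T x (T z f) y"
proof -
  have "T x (T y f) z = (\<integral>t. T z f t \<partial>\<omega> x y)"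
    unfolding translate_translate[OF assms]
    by (rule Bochner_Integration.integral_cong[OF refl translate_commute])
  then show ?thesis by (simp add: translate_def[of _ x])
qed

lemma translate_translate_commute: "f \<in> bcontfun \<Longrightarrow> T x (T y f) = T y (T x f)"
  by (rule ext) (metis translate_commute translate_translate_rotate)

text \<open>The points of the Michael topology are nonempty sets, so being a value of a continuous
  map into it already excludes an empty support.\<close>

lemma S_nonempty: "S x y \<noteq> {}"
proof -
  have "S x y \<in> topspace michael_topology"
    using funcset_mem[OF continuous_map_funspace[OF support_continuous], of "(x, y)"] by simp
  then show ?thesis
    by (auto simp: michael_topology_def)
qed

lemma open_S_preimage:
  assumes "open U" "open V"
  shows "open {(x, y). S x y \<inter> U \<noteq> {} \<and> S x y \<subseteq> V}"
proof -
  have "openin michael_topology {C. compact C \<and> C \<noteq> {} \<and> C \<inter> U \<noteq> {} \<and> C \<subseteq> V}"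
    unfolding michael_topology_def by (rule topology_generated_by_Basis) (use assms in blast)
  from openin_continuous_map_preimage[OF support_continuous this]
  have "open {p. (case p of (x, y) \<Rightarrow> S x y) \<in> {C. compact C \<and> C \<noteq> {} \<and> C \<inter> U \<noteq> {} \<and> C \<subseteq> V}}"
    by simp
  also have "\<dots> = {(x, y). S x y \<inter> U \<noteq> {} \<and> S x y \<subseteq> V}"
    by (auto simp: compact_support)
  finally show ?thesis .
qed

lemma open_S_meets: "open U \<Longrightarrow> open {(x, y). S x y \<inter> U \<noteq> {}}"
  using open_S_preimage[of U UNIV] by simp

lemma open_S_subset: "open V \<Longrightarrow> open {(x, y). S x y \<subseteq> V}"
  using open_S_preimage[of UNIV V] by (simp add: S_nonempty)

lemma S_commute: "S x y = S y x"
  by (simp add: commute[of x y])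

section \<open>Products of sets in a hypergroup\<close>

definition set_conv (infixl \<open>\<odot>\<close> 70) where "A \<odot> B = (\<Union>a\<in>A. \<Union>b\<in>B. S a b)"

lemma set_convI: "a \<in> A \<Longrightarrow> b \<in> B \<Longrightarrow> z \<in> S a b \<Longrightarrow> z \<in> A \<odot> B"
  by (auto simp: set_conv_def)

lemma set_convE:
  assumes "z \<in> A \<odot> B" obtains a b where "a \<in> A" "b \<in> B" "z \<in> S a b"
  using assms by (auto simp: set_conv_def)

lemma set_conv_mono: "A \<subseteq> A' \<Longrightarrow> B \<subseteq> B' \<Longrightarrow> A \<odot> B \<subseteq> A' \<odot> B'"
  by (fastforce simp: set_conv_def)

lemma set_conv_commute: "A \<odot> B = B \<odot> A"
proof -
  have "A \<odot> B \<subseteq> B \<odot> A" for A B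
  proof
    fix z assume "z \<in> A \<odot> B"
    then obtain a b where "a \<in> A" "b \<in> B" "z \<in> S a b" by (rule set_convE)
    then show "z \<in> B \<odot> A" using S_commute[of a b] by (auto intro: set_convI)
  qed
  then show ?thesis by blast
qed

text \<open>A finite subcover for the compact set \<open>S a b\<close> also covers
  \<open>S x y\<close> for all pairs near \<open>(a, b)\<close>, by semicontinuity of the supports;
  finitely many such pairs suffice by compactness of \<open>A \<times> B\<close>.\<close>

lemma compact_set_conv:
  assumes "compact A" "compact B" shows "compact (A \<odot> B)"
proof (rule Topological_Spaces.compactI)
  fix \<C> assume \<C>: "\<forall>C\<in>\<C>. open C" "A \<odot> B \<subseteq> \<Union>\<C>"
  have "\<exists>\<D>. \<D> \<subseteq> \<C> \<and> finite \<D> \<and> S (fst p) (snd p) \<subseteq> \<Union>\<D>" if "p \<in> A \<times> B" for p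
  proof -
    have "S (fst p) (snd p) \<subseteq> \<Union>\<C>" using that \<C>(2) by (force simp: set_conv_def)
    then show ?thesis using compactE[OF compact_support[of "fst p" "snd p"]] \<C>(1) by metis
  qed
  then obtain \<D> where \<D>: "\<And>p. p \<in> A \<times> B \<Longrightarrow> \<D> p \<subseteq> \<C> \<and> finite (\<D> p) \<and> S (fst p) (snd p) \<subseteq> \<Union>(\<D> p)"
    by metis
  define W where "W p = {(x, y). S x y \<subseteq> \<Union>(\<D> p)}" for p
  have 1: "\<And>p. p \<in> A \<times> B \<Longrightarrow> open (W p)"
    unfolding W_def using \<D> \<C>(1) by (intro open_S_subset open_Union) blast
  have 2: "A \<times> B \<subseteq> (\<Union>p\<in>A \<times> B. W p)"
  proof
    fix p assume "p \<in> A \<times> B"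
    then have "p \<in> W p" using \<D>[of p] by (auto simp: W_def)
    with \<open>p \<in> A \<times> B\<close> show "p \<in> (\<Union>p\<in>A \<times> B. W p)" by blast
  qed
  obtain P where P: "P \<subseteq> A \<times> B" "finite P" "A \<times> B \<subseteq> (\<Union>p\<in>P. W p)"
    using compactE_image[OF compact_Times[OF assms] 1 2] by metis
  have "A \<odot> B \<subseteq> \<Union>(\<Union>p\<in>P. \<D> p)"
  proof
    fix z assume "z \<in> A \<odot> B"
    then obtain a b where ab: "a \<in> A" "b \<in> B" "z \<in> S a b" by (rule set_convE)
    then obtain p where "p \<in> P" "(a, b) \<in> W p" using P(3) by blast
    then have "z \<in> \<Union>(\<D> p)" using ab by (auto simp: W_def)
    with \<open>p \<in> P\<close> show "z \<in> \<Union>(\<Union>p\<in>P. \<D> p)" by blast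
  qed
  moreover have "finite (\<Union>p\<in>P. \<D> p)" "(\<Union>p\<in>P. \<D> p) \<subseteq> \<C>"
    using P(1,2) \<D> by (blast intro: finite_UN_I)+
  ultimately show "\<exists>\<C>'\<subseteq>\<C>. finite \<C>' \<and> A \<odot> B \<subseteq> \<Union>\<C>'" by blast
qed

text \<open>The set where \<open>r\<close> is positive is open, so it has positive mass as soon as
  it meets the support. This converts identities between integrals into inclusions between
  supports.\<close>

lemma integral_convolution_pos_iff:
  fixes r :: "'a \<Rightarrow> real"
  assumes r: "continuous_on UNIV r" "\<And>z. r z \<ge> 0"
  shows "(\<integral>z. r z \<partial>\<omega> x y) \<noteq> 0 \<longleftrightarrow> (\<exists>z\<in>S x y. r z \<noteq> 0)"
proof
  assume *: "(\<integral>z. r z \<partial>\<omega> x y) \<noteq> 0"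
  show "\<exists>z\<in>S x y. r z \<noteq> 0"
  proof (rule ccontr)
    assume "\<not> ?thesis"
    then have "AE z in \<omega> x y. r z = 0"
      using AE_convolution[of x y] by (auto elim: eventually_mono)
    with * integral_eq_zero_AE show False by blast
  qed
next
  assume "\<exists>z\<in>S x y. r z \<noteq> 0"
  then obtain z where z: "z \<in> S x y" "r z > 0" using r(2) by (metis less_eq_real_def)
  define U where "U = {w. r w > 0}"
  have U: "open U" unfolding U_def using r(1) by (intro open_Collect_less continuous_intros)
  have "emeasure (\<omega> x y) U > 0"
    using z U by (auto simp: measure_support_def U_def)
  have "integrable (\<omega> x y) (\<lambda>z. complex_of_real (r z))"
    using r by (intro integrable_convolution continuous_intros)
  then have int: "integrable (\<omega> x y) r" using complex_of_real_integrable_eq by blast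
  show "(\<integral>z. r z \<partial>\<omega> x y) \<noteq> 0"
  proof
    assume "(\<integral>z. r z \<partial>\<omega> x y) = 0"
    then have "AE w in \<omega> x y. r w = 0"
      using integral_nonneg_eq_0_iff_AE[OF int] r(2) by simp
    then have "AE w in \<omega> x y. w \<notin> U" by eventually_elim (simp add: U_def)
    then have "emeasure (\<omega> x y) U = 0"
      using U by (subst (asm) AE_iff_measurable[where N = U]) auto
    with \<open>emeasure (\<omega> x y) U > 0\<close> show False by simp
  qed
qed

text \<open>If \<open>p\<close> lay outside the compact set on the right, a bump function at
  \<open>p\<close> vanishing on that set would have two different integrals over the triple
  convolution: nonzero in one grouping, zero in the other.\<close>

lemma S_assoc_subset: "{x} \<odot> S y z \<subseteq> S x y \<odot> {z}"
proof
  fix p assume p: "p \<in> {x} \<odot> S y z"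
  show "p \<in> S x y \<odot> {z}"
  proof (rule ccontr)
    assume np: "p \<notin> S x y \<odot> {z}"
    have "compact (S x y \<odot> {z})" by (intro compact_set_conv compact_support) simp
    then have "open (- (S x y \<odot> {z}))" using compact_imp_closed by blast
    then obtain u D where u: "continuous_on UNIV u" "\<And>x. 0 \<le> u x" "\<And>x. u x \<le> 1"
      "\<And>x. x \<in> {p} \<Longrightarrow> u x = 1" "D \<subseteq> - (S x y \<odot> {z})" "\<And>x. x \<notin> D \<Longrightarrow> u x = (0::real)"
      using compact_Urysohn[OF locally_compact, of "{p}" "- (S x y \<odot> {z})"] np
      by (metis compact_sing empty_subsetI insert_subset ComplI)
    define f where "f z = complex_of_real (u z)" for z
    have f: "f \<in> bcontfun"
      unfolding f_def using u by (intro bcontfunI_complex[where B=1] continuous_intros) auto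
    define r where "r t = (\<integral>s. u s \<partial>\<omega> x t)" for t
    have Tf: "T x f t = complex_of_real (r t)" for t
      by (simp add: r_def f_def[abs_def] translate_of_real)
    have rc: "continuous_on UNIV r"
    proof -
      have "r = (\<lambda>t. Re (T x f t))" by (simp add: Tf)
      then show ?thesis
        using bcontfun_continuous[OF translate_bcontfun[OF f, of x]] by (auto intro!: continuous_intros)
    qed
    obtain t where t: "t \<in> S y z" "p \<in> S x t" using p by (auto elim: set_convE)
    have "r t \<noteq> 0"
      using integral_convolution_pos_iff[OF u(1,2), of x t] t(2) u(4) by (auto simp: r_def)
    moreover have "r t \<ge> 0" for t unfolding r_def using u(2) by (simp add: integral_nonneg)
    ultimately have "(\<integral>t. r t \<partial>\<omega> y z) \<noteq> 0"
      using integral_convolution_pos_iff[OF rc, of y z] t(1) by blast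
    then have "T y (T x f) z \<noteq> 0"
      using translate_of_real[of y r z] by (simp add: Tf[abs_def])
    \<comment> \<open>In the new grouping the outer variable runs over \<open>S x y\<close> and is
      then convolved with \<open>z\<close>, so \<open>f\<close> is evaluated only on
      \<open>S x y \<odot> {z}\<close>, where it vanishes.\<close>
    also have "T y (T x f) z = T x (T z f) y"
      using translate_translate_rotate[OF f] translate_translate_commute[OF f] by metis
    also have "T x (T z f) y = T x (\<lambda>_. 0) y"
    proof (rule translate_cong)
      show "continuous_on UNIV (T z f)" by (rule bcontfun_continuous[OF translate_bcontfun[OF f]])
      fix t assume t: "t \<in> S x y"
      have "T z f t = T z (\<lambda>_. 0) t"
      proof (rule translate_cong)
        show "continuous_on UNIV f" by (rule bcontfun_continuous[OF f])
        fix s assume "s \<in> S z t"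
        then have "s \<in> S x y \<odot> {z}" using t by (auto intro: set_convI simp: S_commute[of z])
        then show "f s = 0" using u(5,6) by (auto simp: f_def)
      qed simp
      then show "T z f t = 0" by simp
    qed simp
    finally show False by simp
  qed
qed

text \<open>Commutativity makes the reverse inclusion an instance of the first one with
  \<open>x\<close> and \<open>z\<close> exchanged.\<close>

lemma S_assoc: "{x} \<odot> S y z = S x y \<odot> {z}"
proof (rule antisym[OF S_assoc_subset])
  have "S x y \<odot> {z} = {z} \<odot> S y x" by (metis set_conv_commute S_commute)
  also have "\<dots> \<subseteq> S z y \<odot> {x}" by (rule S_assoc_subset)
  also have "\<dots> = {x} \<odot> S y z" by (metis set_conv_commute S_commute)
  finally show "S x y \<odot> {z} \<subseteq> {x} \<odot> S y z" .
qed

lemma set_conv_assoc: "A \<odot> (B \<odot> C) = (A \<odot> B) \<odot> C"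
proof -
  have "A \<odot> (B \<odot> C) = (\<Union>a\<in>A. \<Union>b\<in>B. \<Union>c\<in>C. {a} \<odot> S b c)"
    by (auto simp: set_conv_def)
  also have "\<dots> = (A \<odot> B) \<odot> C"
    unfolding S_assoc by (auto simp: set_conv_def)
  finally show ?thesis .
qed

section \<open>Unit and involution\<close>

definition e where "e = (SOME e. (\<forall>x. \<omega> e x = return borel x \<and> \<omega> x e = return borel x) \<and>
  (\<forall>x y. e \<in> measure_support euclidean (\<omega> x (bar y)) \<longleftrightarrow> x = y))"

lemma unit_convolution: "\<omega> e x = return borel x" "\<omega> x e = return borel x"
  and unit_in_S: "e \<in> S x (bar y) \<longleftrightarrow> x = y"
  using someI_ex[OF unit] unfolding e_def[symmetric] by auto

lemma measure_support_return: "measure_support euclidean (return borel x) = {x :: 'b::t2_space}"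
proof -
  have "\<exists>U. open U \<and> y \<in> U \<and> x \<notin> U" if "y \<noteq> x" for y
    using that by (metis hausdorff disjoint_iff)
  then show ?thesis
    by (auto simp: measure_support_def)
qed

lemma S_unit: "S e x = {x}" "S x e = {x}"
  by (simp_all add: unit_convolution measure_support_return)

lemma translate_unit:
  assumes "continuous_on UNIV f"
  shows "T x f e = f x" "T e f x = f x"
proof -
  have "T x f e = T x (\<lambda>_. f x) e"
    using assms by (intro translate_cong) (auto simp: S_unit)
  then show "T x f e = f x" by simp
  then show "T e f x = f x" by (simp only: translate_commute[of e])
qed

lemma bar_unit: "bar e = e"
  using unit_in_S[of e e] by (simp add: S_unit)

lemma S_bar: "S (bar x) (bar y) = bar ` S x y"
proof -
  have bar: "bar \<in> borel_measurable borel" by (rule borel_measurable_continuous_onI[OF bar_continuous])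
  have *: "emeasure (\<omega> (bar x) (bar y)) U = emeasure (\<omega> x y) (bar -` U)" if "open U" for U
  proof -
    have "\<omega> (bar x) (bar y) = distr (\<omega> x y) borel bar"
      by (simp only: bar_convolution commute[of "bar x"])
    moreover have "bar \<in> measurable (\<omega> x y) borel"
      using bar measurable_cong_sets[OF sets_convolution refl] by blast
    ultimately show ?thesis using that by (simp add: emeasure_distr)
  qed
  have op: "open (bar -` U)" if "open U" for U using open_vimage[OF that bar_continuous] .
  have sub: "bar ` S x y \<subseteq> S (bar x) (bar y)" if "\<And>U. open U \<Longrightarrow> emeasure (\<omega> (bar x) (bar y)) U = emeasure (\<omega> x y) (bar -` U)" for x y
    using that op by (auto simp: measure_support_def)
  have "z \<in> bar ` S x y" if "z \<in> S (bar x) (bar y)" for z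
  proof -
    have "bar z \<in> S x y"
      unfolding measure_support_def
    proof (safe, simp)
      fix U assume U: "openin euclidean U" "bar z \<in> U"
      have "emeasure (\<omega> (bar x) (bar y)) (bar -` U) > 0"
        using that U op[of U] by (auto simp: measure_support_def)
      then show "emeasure (\<omega> x y) U > 0"
        using *[OF op, of U] U by (simp add: vimage_comp o_def bar_bar)
    qed
    then show ?thesis using bar_bar by (metis image_eqI)
  qed
  with sub[OF *] show ?thesis by blast
qed

text \<open>This replaces solving \<open>z = x y\<close> for \<open>x\<close> in a group. The unit
  lies in \<open>S z (bar z)\<close>, hence in \<open>S x y \<odot> {bar z}\<close>; by
  associativity it lies in \<open>S x t\<close> with \<open>t \<in> S y (bar z)\<close>, which
  forces \<open>x = bar t\<close>.\<close>

lemma S_reverse: "z \<in> S x y \<Longrightarrow> x \<in> S z (bar y)"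
proof -
  assume z: "z \<in> S x y"
  have "e \<in> S z (bar z)" by (simp add: unit_in_S)
  then have "e \<in> S x y \<odot> {bar z}" using z by (auto intro: set_convI)
  then have "e \<in> {x} \<odot> S y (bar z)" by (simp add: S_assoc)
  then obtain t where t: "t \<in> S y (bar z)" "e \<in> S x t" by (auto elim: set_convE)
  then have "x = bar t" using unit_in_S[of x "bar t"] by (simp add: bar_bar)
  then have "x \<in> bar ` S y (bar z)" using t by blast
  then show ?thesis using S_bar[of y "bar z"] by (simp add: bar_bar S_commute)
qed

lemma S_reverse_iff: "z \<in> S x y \<longleftrightarrow> x \<in> S z (bar y)"
  using S_reverse[of z x y] S_reverse[of x z "bar y"] by (auto simp: bar_bar)

lemma translate_bar:
  assumes "continuous_on UNIV f"
  shows "(\<integral>z. f (bar z) \<partial>\<omega> x y) = T (bar x) f (bar y)"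
proof -
  have "T (bar x) f (bar y) = integral\<^sup>L (distr (\<omega> x y) borel bar) f"
    by (simp add: translate_def bar_convolution commute[of "bar y"])
  also have "\<dots> = (\<integral>z. f (bar z) \<partial>\<omega> x y)"
    using assms borel_measurable_continuous_onI[OF bar_continuous]
    by (intro integral_distr) (auto intro: borel_measurable_continuous_onI cong: measurable_cong_sets)
  finally show ?thesis by simp
qed

lemma compact_bar: "compact C \<Longrightarrow> compact (bar ` C)"
  using compact_continuous_image continuous_on_subset[OF bar_continuous] by blast

section \<open>Uniformly continuous functions\<close>

text \<open>The supremum norm of a difference is at most \<epsilon> exactly when all its values are,
  so with weak inequalities the type of bounded continuous functions disappears from the
  condition.\<close>

lemma UC_iff:
  "f \<in> UC \<omega> \<longleftrightarrow> f \<in> bcontfun \<and>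
     (\<forall>x. \<forall>\<epsilon>>0. \<exists>N. open N \<and> x \<in> N \<and> (\<forall>x'\<in>N. \<forall>y. cmod (T x' f y - T x f y) \<le> \<epsilon>))"
proof (cases "f \<in> bcontfun")
  case f: True
  have app: "apply_bcontfun (Bcontfun (T x f)) = T x f" for x
    using translate_bcontfun[OF f] Bcontfun_inverse by blast
  have *: "dist (Bcontfun (T x' f)) (Bcontfun (T x f)) \<le> \<epsilon> \<longleftrightarrow> (\<forall>y. cmod (T x' f y - T x f y) \<le> \<epsilon>)" for x' x \<epsilon>
    using dist_bounded[of "Bcontfun (T x' f)" _ "Bcontfun (T x f)"]
      dist_bound[of "Bcontfun (T x' f)" "Bcontfun (T x f)" \<epsilon>]
    unfolding app dist_norm by (meson order_trans)
  have at: "(\<exists>N. open N \<and> x \<in> N \<and> (\<forall>y\<in>N. y \<noteq> x \<longrightarrow> P y)) \<longleftrightarrow>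
      (\<exists>N. open N \<and> x \<in> N \<and> (\<forall>y\<in>N. P y))" if "P x" for x :: 'a and P
    by (metis that)
  have "f \<in> UC \<omega> \<longleftrightarrow> (\<forall>x. \<forall>\<epsilon>>0. \<exists>N. open N \<and> x \<in> N \<and> (\<forall>x'\<in>N. dist (Bcontfun (T x' f)) (Bcontfun (T x f)) < \<epsilon>))"
    using f unfolding UC_def continuous_on_def tendsto_iff eventually_at_topological
    by (simp, intro all_cong1 imp_cong refl, intro at) simp
  also have "\<dots> \<longleftrightarrow> (\<forall>x. \<forall>\<epsilon>>0. \<exists>N. open N \<and> x \<in> N \<and> (\<forall>x'\<in>N. dist (Bcontfun (T x' f)) (Bcontfun (T x f)) \<le> \<epsilon>))"
  proof (intro iffI allI impI)
    fix x and \<epsilon> :: real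
    assume "\<epsilon> > 0"
      "\<forall>x. \<forall>\<epsilon>>0. \<exists>N. open N \<and> x \<in> N \<and> (\<forall>x'\<in>N. dist (Bcontfun (T x' f)) (Bcontfun (T x f)) \<le> \<epsilon>)"
    then obtain N where N: "open N" "x \<in> N" "\<forall>x'\<in>N. dist (Bcontfun (T x' f)) (Bcontfun (T x f)) \<le> \<epsilon> / 2"
      by (meson half_gt_zero)
    have "\<forall>x'\<in>N. dist (Bcontfun (T x' f)) (Bcontfun (T x f)) < \<epsilon>"
      using N(3) \<open>\<epsilon> > 0\<close> by (auto intro: le_less_trans)
    with N(1,2) show "\<exists>N. open N \<and> x \<in> N \<and> (\<forall>x'\<in>N. dist (Bcontfun (T x' f)) (Bcontfun (T x f)) < \<epsilon>)"
      by blast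
  next
    fix x and \<epsilon> :: real
    assume "\<epsilon> > 0"
      "\<forall>x. \<forall>\<epsilon>>0. \<exists>N. open N \<and> x \<in> N \<and> (\<forall>x'\<in>N. dist (Bcontfun (T x' f)) (Bcontfun (T x f)) < \<epsilon>)"
    then show "\<exists>N. open N \<and> x \<in> N \<and> (\<forall>x'\<in>N. dist (Bcontfun (T x' f)) (Bcontfun (T x f)) \<le> \<epsilon>)"
      by (meson less_imp_le)
  qed
  finally show ?thesis using f unfolding * by simp
qed (simp add: UC_def)

lemma UC_bcontfun: "f \<in> UC \<omega> \<Longrightarrow> f \<in> bcontfun"
  by (simp add: UC_def)

lemma UC_equicontinuous:
  "f \<in> UC \<omega> \<Longrightarrow> \<epsilon> > 0 \<Longrightarrow> \<exists>N. open N \<and> x \<in> N \<and> (\<forall>x'\<in>N. \<forall>y. cmod (T x' f y - T x f y) \<le> \<epsilon>)"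
  by (simp add: UC_iff)

lemma UC_add:
  assumes "f \<in> UC \<omega>" "g \<in> UC \<omega>" shows "(\<lambda>x. f x + g x) \<in> UC \<omega>"
  unfolding UC_iff
proof (intro conjI allI impI)
  note fg = assms[THEN UC_bcontfun] assms[THEN UC_bcontfun, THEN bcontfun_continuous]
  obtain A B where "\<And>x. cmod (f x) \<le> A" "\<And>x. cmod (g x) \<le> B"
    using bcontfun_bound fg by metis
  then show "(\<lambda>x. f x + g x) \<in> bcontfun"
    using fg by (intro bcontfunI_complex[of _ "A + B"] continuous_intros norm_triangle_mono)
  fix x and \<epsilon> :: real assume "\<epsilon> > 0"
  then obtain N N' where "open N" "x \<in> N" "\<forall>x'\<in>N. \<forall>y. cmod (T x' f y - T x f y) \<le> \<epsilon> / 2"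
    "open N'" "x \<in> N'" "\<forall>x'\<in>N'. \<forall>y. cmod (T x' g y - T x g y) \<le> \<epsilon> / 2"
    using UC_equicontinuous[OF assms(1)] UC_equicontinuous[OF assms(2)] by (meson half_gt_zero)
  moreover have "cmod (T x' (\<lambda>x. f x + g x) y - T x (\<lambda>x. f x + g x) y) \<le> \<epsilon>"
    if "cmod (T x' f y - T x f y) \<le> \<epsilon> / 2" "cmod (T x' g y - T x g y) \<le> \<epsilon> / 2" for x' y
    using norm_triangle_ineq[of "T x' f y - T x f y" "T x' g y - T x g y"] that
    by (simp add: translate_add fg algebra_simps)
  ultimately show "\<exists>N. open N \<and> x \<in> N \<and>
      (\<forall>x'\<in>N. \<forall>y. cmod (T x' (\<lambda>x. f x + g x) y - T x (\<lambda>x. f x + g x) y) \<le> \<epsilon>)"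
    by (intro exI[of _ "N \<inter> N'"]) blast
qed

lemma UC_mult:
  assumes "f \<in> UC \<omega>" shows "(\<lambda>x. c * f x) \<in> UC \<omega>"
  unfolding UC_iff
proof (intro conjI allI impI)
  note f = assms[THEN UC_bcontfun] assms[THEN UC_bcontfun, THEN bcontfun_continuous]
  obtain A where "\<And>x. cmod (f x) \<le> A"
    using bcontfun_bound f by metis
  then show "(\<lambda>x. c * f x) \<in> bcontfun"
    using f by (intro bcontfunI_complex[of _ "cmod c * A"] continuous_intros)
      (auto simp: norm_mult mult_left_mono)
  fix x and \<epsilon> :: real assume "\<epsilon> > 0"
  have c: "cmod c + 1 > 0" using norm_ge_zero[of c] by linarith
  then obtain N where N: "open N" "x \<in> N" "\<forall>x'\<in>N. \<forall>y. cmod (T x' f y - T x f y) \<le> \<epsilon> / (cmod c + 1)"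
    using UC_equicontinuous[OF assms, of "\<epsilon> / (cmod c + 1)"] \<open>\<epsilon> > 0\<close> by auto
  have "cmod (T x' (\<lambda>x. c * f x) y - T x (\<lambda>x. c * f x) y) \<le> \<epsilon>" if "x' \<in> N" for x' y
  proof -
    have "cmod (T x' (\<lambda>x. c * f x) y - T x (\<lambda>x. c * f x) y) = cmod c * cmod (T x' f y - T x f y)"
      by (simp add: translate_mult right_diff_distrib[symmetric] norm_mult)
    also have "\<dots> \<le> (cmod c + 1) * (\<epsilon> / (cmod c + 1))"
      using N that by (intro mult_mono) auto
    finally show ?thesis using c by simp
  qed
  with N show "\<exists>N. open N \<and> x \<in> N \<and>
      (\<forall>x'\<in>N. \<forall>y. cmod (T x' (\<lambda>x. c * f x) y - T x (\<lambda>x. c * f x) y) \<le> \<epsilon>)"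
    by blast
qed

text \<open>Translations commute, and \<open>T z\<close> does not increase the supremum
  norm.\<close>

lemma UC_translate:
  assumes "f \<in> UC \<omega>" shows "T z f \<in> UC \<omega>"
  unfolding UC_iff
proof (intro conjI allI impI)
  note f = UC_bcontfun[OF assms]
  show "T z f \<in> bcontfun" by (rule translate_bcontfun[OF f])
  fix x and \<epsilon> :: real assume "\<epsilon> > 0"
  then obtain N where N: "open N" "x \<in> N" "\<forall>x'\<in>N. \<forall>y. cmod (T x' f y - T x f y) \<le> \<epsilon>"
    using UC_equicontinuous[OF assms, of \<epsilon>] by auto
  have "cmod (T x' (T z f) y - T x (T z f) y) \<le> \<epsilon>" if "x' \<in> N" for x' y
  proof -
    have "T x' (T z f) y - T x (T z f) y = T z (\<lambda>w. T x' f w - T x f w) y"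
      using f by (simp add: translate_translate_commute[of f _ z] translate_diff
          bcontfun_continuous[OF translate_bcontfun])
    then show ?thesis using N that by (auto intro!: translate_bound)
  qed
  with N show "\<exists>N. open N \<and> x \<in> N \<and> (\<forall>x'\<in>N. \<forall>y. cmod (T x' (T z f) y - T x (T z f) y) \<le> \<epsilon>)"
    by blast
qed

end

section \<open>Compactly supported functions\<close>

text \<open>Vanishing off some compact set is easier to propagate than compactness of a closure;
  \<open>haar_invariant\<close> passes to the closure that occurs in
  \<open>haar_measure\<close>.\<close>

definition CC :: "('a::t2_space \<Rightarrow> complex) set" where
  "CC = {f. continuous_on UNIV f \<and> (\<exists>D. compact D \<and> (\<forall>x. x \<notin> D \<longrightarrow> f x = 0))}"

lemma CC_continuous: "f \<in> CC \<Longrightarrow> continuous_on UNIV f"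
  by (simp add: CC_def)

lemma CC_support:
  assumes "f \<in> CC" obtains D where "compact D" "\<And>x. x \<notin> D \<Longrightarrow> f x = 0"
  using assms by (auto simp: CC_def)

lemma CC_I: "continuous_on UNIV f \<Longrightarrow> compact D \<Longrightarrow> (\<And>x. x \<notin> D \<Longrightarrow> f x = 0) \<Longrightarrow> f \<in> CC"
  by (auto simp: CC_def)

lemma CC_bcontfun:
  assumes f: "f \<in> CC" shows "f \<in> bcontfun"
proof -
  obtain D where D: "compact D" "\<And>x. x \<notin> D \<Longrightarrow> f x = 0" using CC_support[OF f] by blast
  have "compact (f ` D)"
    by (rule compact_continuous_image[OF continuous_on_subset[OF CC_continuous[OF f]] D(1)]) simp
  then obtain B where B: "\<And>x. x \<in> D \<Longrightarrow> cmod (f x) \<le> B"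
    using compact_imp_bounded bounded_iff by (metis image_eqI)
  have "cmod (f x) \<le> max B 0" for x
    using B[of x] D(2)[of x] by (cases "x \<in> D") auto
  then show ?thesis
    using CC_continuous[OF f] by (auto simp: bcontfun_def bounded_iff)
qed

lemma CC_mult:
  assumes f: "f \<in> CC" and g: "continuous_on UNIV g" shows "(\<lambda>x. f x * g x) \<in> CC"
proof -
  obtain D where D: "compact D" "\<And>x. x \<notin> D \<Longrightarrow> f x = 0" using CC_support[OF f] by blast
  then show ?thesis
    using CC_continuous[OF f] g by (intro CC_I[of _ D] continuous_intros) auto
qed

lemma compact_weight_CC:
  assumes "radon_measure euclidean \<mu>" and f: "f \<in> CC" shows "compact_weight \<mu> f"
proof -
  obtain D where D: "compact D" "\<And>x. x \<notin> D \<Longrightarrow> f x = 0" using CC_support[OF f] by blast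
  then have "emeasure \<mu> D < \<infinity>" "sets \<mu> = sets borel"
    using assms(1) by (auto simp: radon_measure_def borel_of_euclidean)
  with D CC_continuous[OF f] show ?thesis
    unfolding compact_weight_def by auto
qed

context commutative_hypergroup
begin

lemma compact_neighbourhood:
  fixes x :: 'a
  obtains U K where "open U" "compact K" "x \<in> U" "U \<subseteq> K"
  using locally_compact unfolding locally_compact_space_def
  by (metis UNIV_I compactin_euclidean_iff open_openin topspace_euclidean)

lemma translate_eq_0:
  assumes "continuous_on UNIV f" "\<And>z. z \<in> S x y \<Longrightarrow> f z = 0" shows "T x f y = 0"
  using translate_cong[of f "\<lambda>_. 0" x y] assms by simp

lemma translate_nonzeroE:
  assumes "continuous_on UNIV f" "T x f y \<noteq> 0"
  obtains z where "z \<in> S x y" "f z \<noteq> 0"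
  using translate_eq_0[OF assms(1)] assms(2) by blast

lemma translate_support:
  assumes "continuous_on UNIV f" "\<And>x. x \<notin> D \<Longrightarrow> f x = 0" "y \<notin> D \<odot> {bar x}"
  shows "T x f y = 0"
proof (rule translate_eq_0[OF assms(1)])
  fix z assume "z \<in> S x y"
  then have "y \<in> S z (bar x)" using S_reverse[of z y x] by (simp add: S_commute)
  then have "z \<notin> D" using assms(3) set_convI by blast
  then show "f z = 0" by (rule assms(2))
qed

lemma CC_translate:
  assumes f: "f \<in> CC" shows "T x f \<in> CC"
proof -
  obtain D where D: "compact D" "\<And>x. x \<notin> D \<Longrightarrow> f x = 0" using CC_support[OF f] by blast
  show ?thesis
  proof (rule CC_I)
    show "continuous_on UNIV (T x f)"
      by (rule bcontfun_continuous[OF translate_bcontfun[OF CC_bcontfun[OF f]]])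
    show "compact (D \<odot> {bar x})" using D by (intro compact_set_conv) auto
    show "T x f y = 0" if "y \<notin> D \<odot> {bar x}" for y
      by (rule translate_support[OF CC_continuous[OF f] D(2) that])
  qed
qed

lemma CC_UC:
  assumes f: "f \<in> CC" shows "f \<in> UC \<omega>"
  unfolding UC_iff
proof (intro conjI allI impI)
  show bf: "f \<in> bcontfun" by (rule CC_bcontfun[OF f])
  obtain D where D: "compact D" "\<And>x. x \<notin> D \<Longrightarrow> f x = 0" using CC_support[OF f] by blast
  fix x :: 'a and \<epsilon> :: real assume "\<epsilon> > 0"
  obtain U K where U: "open U" "compact K" "x \<in> U" "U \<subseteq> K" by (rule compact_neighbourhood)
  define E where "E = D \<odot> bar ` K"
  have E: "compact E" unfolding E_def using D U by (intro compact_set_conv compact_bar)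
  have "continuous_on (UNIV \<times> E) (\<lambda>(x, y). T x f y)"
    using translate_continuous[OF bf] continuous_on_subset by blast
  from continuous_on_prod_compactE[OF this E UNIV_I \<open>\<epsilon> > 0\<close>, of x]
  obtain N where N: "x \<in> N" "open N" "\<forall>x'\<in>N. \<forall>t\<in>E. cmod (T x' f t - T x f t) \<le> \<epsilon>"
    by (auto simp: dist_norm)
  have out: "T x' f y = 0" if "x' \<in> U" "y \<notin> E" for x' y
  proof (rule translate_support[OF CC_continuous[OF f] D(2)])
    show "y \<notin> D \<odot> {bar x'}"
      using that U set_conv_mono[of D D "{bar x'}" "bar ` K"] by (auto simp: E_def)
  qed
  have "cmod (T x' f y - T x f y) \<le> \<epsilon>" if "x' \<in> N \<inter> U" for x' y
    using N(3) that out[of x' y] out[OF U(3), of y] \<open>\<epsilon> > 0\<close> by (cases "y \<in> E") auto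
  with N U show "\<exists>N. open N \<and> x \<in> N \<and> (\<forall>x'\<in>N. \<forall>y. cmod (T x' f y - T x f y) \<le> \<epsilon>)"
    by (intro exI[of _ "N \<inter> U"]) auto
qed

text \<open>This is uniform continuity phrased with products: \<open>y \<in> S t u\<close> with
  \<open>u\<close> near the unit plays the role of \<open>y\<close> near \<open>t\<close>. The tube
  lemma handles \<open>t\<close> in a compact set; for other \<open>t\<close> both values are
  0.\<close>

lemma CC_uniformly_continuous:
  assumes f: "f \<in> CC" and "\<epsilon> > 0"
  shows "\<exists>U. open U \<and> e \<in> U \<and> (\<forall>t. \<forall>u\<in>U. \<forall>y\<in>S t u. cmod (f y - f t) \<le> \<epsilon>)"
proof -
  obtain D where D: "compact D" "\<And>x. x \<notin> D \<Longrightarrow> f x = 0" using CC_support[OF f] by blast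
  obtain U K where U: "open U" "compact K" "e \<in> U" "U \<subseteq> K" by (rule compact_neighbourhood)
  \<comment> \<open>If \<open>t\<close> is outside \<open>E\<close>, then \<open>t\<close> is
    outside \<open>D\<close>, and by \<open>S_reverse\<close> so is every
    \<open>y \<in> S t u\<close> with \<open>u \<in> U\<close>.\<close>
  define E where "E = D \<union> D \<odot> bar ` K"
  have E: "compact E" unfolding E_def using D U by (intro compact_Un compact_set_conv compact_bar)
  define V where "V t = {z. cmod (f z - f t) < \<epsilon> / 2}" for t
  have V: "open (V t)" "t \<in> V t" for t
    unfolding V_def using CC_continuous[OF f] \<open>\<epsilon> > 0\<close>
    by (auto intro!: open_Collect_less continuous_intros)
  \<comment> \<open>For a pair \<open>(b, a)\<close> in \<open>W\<close>, the point \<open>a\<close>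
    and all of \<open>S b a\<close> lie in one common \<open>V t\<close>, so the values of
    \<open>f\<close> there differ by less than \<epsilon>.\<close>
  define W where "W = (\<Union>t. {(b, a). S b a \<subseteq> V t} \<inter> UNIV \<times> V t)"
  have "open W"
    unfolding W_def by (intro open_UN ballI open_Int open_S_subset open_Times V) simp
  moreover have "{e} \<times> E \<subseteq> W"
    using V(2) by (fastforce simp: W_def S_unit)
  ultimately obtain X where X: "e \<in> X" "open X" "X \<times> E \<subseteq> W"
    using Elementary_Topology.tube_lemma[OF E] by blast
  have "cmod (f y - f t) \<le> \<epsilon>" if "u \<in> X \<inter> U" "y \<in> S t u" for t u y
  proof (cases "t \<in> E")
    case True
    then have "(u, t) \<in> W" using X that by blast
    then obtain t' where "S u t \<subseteq> V t'" "t \<in> V t'" by (auto simp: W_def)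
    then have "y \<in> V t'" "t \<in> V t'" using that by (auto simp: S_commute)
    then show ?thesis
      using norm_triangle_ineq4[of "f y - f t'" "f t - f t'"] by (simp add: V_def)
  next
    case False
    have "t \<in> S y (bar u)" using S_reverse[OF that(2)] .
    then have "y \<notin> D"
      using False that(1) U(4) by (auto simp: E_def set_conv_def)
    then show ?thesis using D(2) False \<open>\<epsilon> > 0\<close> by (simp add: E_def)
  qed
  with X U show ?thesis by (intro exI[of _ "X \<inter> U"]) auto
qed

end

section \<open>Haar measure\<close>

locale haar_hypergroup = commutative_hypergroup +
  fixes m :: "'a measure"
  assumes haar: "haar_measure \<omega> m"
begin

lemma radon_haar: "radon_measure euclidean m"
  using haar by (simp add: haar_measure_def)

lemma sets_haar [simp]: "sets m = sets borel"
  using radon_haar by (simp add: radon_measure_def borel_of_euclidean)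

lemma space_haar [simp]: "space m = UNIV"
  using sets_eq_imp_space_eq[OF sets_haar] by simp

lemma compact_weight_haar: "f \<in> CC \<Longrightarrow> compact_weight m f"
  by (rule compact_weight_CC[OF radon_haar])

lemma integrable_CC: "f \<in> CC \<Longrightarrow> integrable m f"
  by (rule compact_weight_integrable_self[OF compact_weight_haar])

lemma emeasure_compact_finite: "compact C \<Longrightarrow> emeasure m C < \<infinity>"
  using radon_haar by (simp add: radon_measure_def)

lemma haar_invariant:
  assumes f: "f \<in> CC" shows "(\<integral>y. T x f y \<partial>m) = (\<integral>y. f y \<partial>m)"
proof -
  obtain D where D: "compact D" "\<And>x. x \<notin> D \<Longrightarrow> f x = 0" using CC_support[OF f] by blast
  have "closure {y. f y \<noteq> 0} \<subseteq> D"
    using D by (intro closure_minimal compact_imp_closed) auto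
  then have "compact (closure {y. f y \<noteq> 0})"
    using D(1) closed_closure compact_Int_closed by (metis inf.absorb_iff2 inf_commute)
  then show ?thesis
    using haar CC_continuous[OF f] by (simp add: haar_measure_def)
qed

text \<open>Every point \<open>q\<close> has a translate of \<open>u\<close> that is positive at
  \<open>q\<close>: take \<open>x \<in> S p (bar q)\<close>. If the integral were 0, all these
  translates would have integral 0 by invariance, so no \<open>q\<close> could lie in the support of
  \<open>m\<close>, and \<open>m\<close> would vanish.\<close>

lemma haar_pos:
  fixes u :: "'a \<Rightarrow> real"
  assumes u: "continuous_on UNIV u" "\<And>x. u x \<ge> 0" "(\<lambda>x. complex_of_real (u x)) \<in> CC" "u p \<noteq> 0"
  shows "(\<integral>x. u x \<partial>m) > 0"
proof (rule ccontr)
  assume "\<not> ?thesis"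
  moreover have "(\<integral>x. u x \<partial>m) \<ge> 0" using u(2) by (simp add: integral_nonneg)
  ultimately have int0: "(\<integral>x. u x \<partial>m) = 0" by simp
  let ?f = "\<lambda>x. complex_of_real (u x)"
  have "q \<notin> measure_support euclidean m" for q
  proof -
    obtain x where "x \<in> S p (bar q)" using S_nonempty by blast
    then have p: "p \<in> S x q" using S_reverse_iff[of p x q] by simp
    define r where "r y = (\<integral>z. u z \<partial>\<omega> x y)" for y
    have Tf: "T x ?f = (\<lambda>y. complex_of_real (r y))"
      by (simp add: r_def translate_of_real fun_eq_iff)
    have TCC: "(\<lambda>y. complex_of_real (r y)) \<in> CC" using CC_translate[OF u(3)] Tf by metis
    have rc: "continuous_on UNIV r"
      using continuous_on_Re[OF CC_continuous[OF TCC]] by simp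
    have r0: "r y \<ge> 0" for y using u(2) by (simp add: r_def integral_nonneg)
    have "r q \<noteq> 0" using integral_convolution_pos_iff[OF u(1,2), of x q] p u(4) by (auto simp: r_def)
    then have q: "r q > 0" using r0[of q] by simp
    have rint: "integrable m r"
      using integrable_CC[OF TCC] complex_of_real_integrable_eq by blast
    have "complex_of_real (\<integral>y. r y \<partial>m) = complex_of_real (\<integral>y. u y \<partial>m)"
      using haar_invariant[OF u(3), of x] by (simp add: Tf)
    then have "(\<integral>y. r y \<partial>m) = 0" using int0 by simp
    then have "AE y in m. r y = 0"
      using integral_nonneg_eq_0_iff_AE[OF rint] r0 by simp
    then have AE: "AE y in m. y \<notin> {y. r y > 0}" by eventually_elim simp
    have op: "open {y. r y > 0}" using rc by (intro open_Collect_less continuous_intros)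
    then have "emeasure m {y. r y > 0} = 0"
      using AE by (subst (asm) AE_iff_measurable[where N = "{y. r y > 0}"]) auto
    with op q show ?thesis by (auto simp: measure_support_def)
  qed
  then have "AE x in m. False"
    using AE_measure_support[OF radon_haar] by simp
  then have "emeasure m UNIV = 0"
    using AE_iff_measurable[of UNIV m "\<lambda>_. False"] by simp
  then show False using haar by (simp add: haar_measure_def)
qed

section \<open>Approximate units and the adjoint of translation\<close>

lemma approximate_unit:
  assumes "open U" "e \<in> U"
  obtains k :: "'a \<Rightarrow> real" where "continuous_on UNIV k" "\<And>x. k x \<ge> 0" "\<And>x. k (bar x) = k x"
    "\<And>x. x \<notin> U \<Longrightarrow> k x = 0" "(\<lambda>x. complex_of_real (k x)) \<in> CC" "(\<integral>x. k x \<partial>m) = 1"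
proof -
  \<comment> \<open>Symmetry is obtained by adding the bump function and its reflection; the smaller
    neighbourhood keeps the reflection inside \<open>U\<close> as well.\<close>
  let ?U = "U \<inter> bar -` U"
  have "open ?U" "{e} \<subseteq> ?U"
    using assms open_vimage[OF assms(1) bar_continuous] by (auto simp: bar_unit)
  then obtain u D where u: "continuous_on UNIV u" "\<And>x. 0 \<le> u x" "\<And>x. u x \<le> 1"
      "\<And>x. x \<in> {e} \<Longrightarrow> u x = (1::real)" "compact D" "D \<subseteq> ?U" "\<And>x. x \<notin> D \<Longrightarrow> u x = 0"
    by (rule compact_Urysohn[OF locally_compact compact_sing]) blast
  define k0 where "k0 x = u x + u (bar x)" for x
  have k0c: "continuous_on UNIV k0"
    unfolding k0_def using u(1) bar_continuous
    by (intro continuous_intros continuous_on_compose2[OF u(1)]) auto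
  have k00: "k0 x \<ge> 0" for x using u(2)[of x] u(2)[of "bar x"] by (simp add: k0_def)
  have k0s: "k0 x = 0" if "x \<notin> D \<union> bar ` D" for x
  proof -
    have "bar x \<notin> D" using that bar_bar by (metis UnI2 image_eqI)
    then show ?thesis using that u(7) by (simp add: k0_def)
  qed
  have k0CC: "(\<lambda>x. complex_of_real (k0 x)) \<in> CC"
    using k0c k0s u(5) compact_bar by (intro CC_I[of _ "D \<union> bar ` D"] continuous_intros) auto
  define c where "c = (\<integral>x. k0 x \<partial>m)"
  have "k0 e \<noteq> 0" using u(4) by (simp add: k0_def bar_unit)
  then have c: "c > 0" unfolding c_def by (intro haar_pos[OF k0c k00 k0CC])
  define k where "k x = k0 x / c" for x
  show ?thesis
  proof
    show "continuous_on UNIV k" unfolding k_def using k0c c by (intro continuous_intros) auto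
    show "k x \<ge> 0" for x using k00[of x] c by (simp add: k_def)
    show "k (bar x) = k x" for x by (simp add: k_def k0_def bar_bar)
    show "k x = 0" if "x \<notin> U" for x
    proof -
      have "x \<notin> D \<union> bar ` D" using that u(6) by (auto simp: bar_bar)
      then show ?thesis using k0s by (simp add: k_def)
    qed
    show "(\<lambda>x. complex_of_real (k x)) \<in> CC"
      using CC_mult[OF k0CC, of "\<lambda>_. complex_of_real (1 / c)"] by (simp add: k_def)
    show "(\<integral>x. k x \<partial>m) = 1" using c by (simp add: k_def c_def)
  qed
qed

text \<open>The translate of \<open>k\<close> by \<open>t\<close> is a density: nonnegative and, by
  invariance, of total mass 1. Where it is nonzero, \<open>y\<close> lies in
  \<open>S (bar t) u\<close> for some \<open>u \<in> U\<close>, so \<open>f y\<close> is close to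
  \<open>f (bar t)\<close>; this is why the conjugate appears.\<close>

lemma approximate_unit_convolution:
  assumes f: "f \<in> CC"
    and U: "\<forall>t. \<forall>u\<in>U. \<forall>y\<in>S t u. cmod (f y - f t) \<le> \<epsilon>"
    and k: "\<And>x. k x \<ge> 0" "\<And>x. x \<notin> U \<Longrightarrow> k x = 0" "(\<lambda>x. complex_of_real (k x)) \<in> CC"
      "(\<integral>x. k x \<partial>m) = 1"
  shows "cmod ((\<integral>y. f y * T t (\<lambda>x. complex_of_real (k x)) y \<partial>m) - f (bar t)) \<le> \<epsilon>"
proof -
  define g where "g = T t (\<lambda>x. complex_of_real (k x))"
  have gCC: "g \<in> CC" unfolding g_def by (rule CC_translate[OF k(3)])
  have gr: "g y = complex_of_real (\<integral>z. k z \<partial>\<omega> t y)" for y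
    by (simp add: g_def translate_of_real)
  have "(\<integral>z. k z \<partial>\<omega> t y) \<ge> 0" for y using k(1) by (simp add: integral_nonneg)
  then have gn: "complex_of_real (cmod (g y)) = g y" for y by (simp add: gr)
  have "(\<integral>y. g y \<partial>m) = 1"
    unfolding g_def haar_invariant[OF k(3)] by (simp add: k(4))
  moreover have "complex_of_real (\<integral>y. cmod (g y) \<partial>m) = (\<integral>y. g y \<partial>m)"
    by (simp only: integral_complex_of_real[symmetric] gn)
  ultimately have norm1: "(\<integral>y. cmod (g y) \<partial>m) = 1" "(\<integral>y. g y \<partial>m) = 1"
    by (metis of_real_eq_1_iff)+
  have "cmod ((\<integral>y. g y * f y \<partial>m) - (\<integral>y. g y * f (bar t) \<partial>m)) \<le> \<epsilon> * (\<integral>y. cmod (g y) \<partial>m)"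
  proof (rule compact_weight_integral_bound[OF compact_weight_haar[OF gCC], where C = "{y. g y \<noteq> 0}"])
    fix y assume "y \<in> {y. g y \<noteq> 0}"
    then obtain u where u: "u \<in> S t y" "complex_of_real (k u) \<noteq> 0"
      unfolding g_def using translate_nonzeroE[OF CC_continuous[OF k(3)]] by blast
    then have "u \<in> U" "y \<in> S (bar t) u"
      using k(2) S_reverse[of u y t] by (auto simp: S_commute)
    then show "cmod (f y - f (bar t)) \<le> \<epsilon>" using U by blast
  qed (auto intro: CC_continuous[OF f])
  then show ?thesis
    by (simp add: norm1 g_def[symmetric] mult.commute)
qed

text \<open>With a symmetric approximate unit \<open>k\<close>, both sides of the identity are close to
  \<open>\<integral>\<integral> f(s) g(y) k(s~ * x * y) dm(s) dm(y)\<close>, by invariance of \<open>m\<close> in one of the two variables.\<close>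

lemma translate_adjoint_CC:
  assumes f: "f \<in> CC" and g: "g \<in> CC"
  shows "(\<integral>y. g y * T x f y \<partial>m) = (\<integral>y. f y * T (bar x) g y \<partial>m)" (is "?A = ?B")
proof -
  note wf = compact_weight_haar[OF f] and wg = compact_weight_haar[OF g]
  define Nf where "Nf = (\<integral>y. cmod (f y) \<partial>m)"
  define Ng where "Ng = (\<integral>y. cmod (g y) \<partial>m)"
  have N: "Nf \<ge> 0" "Ng \<ge> 0" by (simp_all add: Nf_def Ng_def)
  have bound: "cmod (?A - ?B) \<le> \<epsilon> * (Nf + Ng)" if \<epsilon>: "\<epsilon> > 0" for \<epsilon>
  proof -
    obtain Uf Ug where U: "open Uf" "e \<in> Uf" "\<forall>t. \<forall>u\<in>Uf. \<forall>y\<in>S t u. cmod (f y - f t) \<le> \<epsilon>"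
      "open Ug" "e \<in> Ug" "\<forall>t. \<forall>u\<in>Ug. \<forall>y\<in>S t u. cmod (g y - g t) \<le> \<epsilon>"
      using CC_uniformly_continuous[OF f \<epsilon>] CC_uniformly_continuous[OF g \<epsilon>] by metis
    have "open (Uf \<inter> Ug)" "e \<in> Uf \<inter> Ug" using U by auto
    then obtain kr :: "'a \<Rightarrow> real" where kr: "continuous_on UNIV kr" "\<And>x. kr x \<ge> 0" "\<And>x. kr (bar x) = kr x"
      "\<And>x. x \<notin> Uf \<inter> Ug \<Longrightarrow> kr x = 0" "(\<lambda>x. complex_of_real (kr x)) \<in> CC" "(\<integral>x. kr x \<partial>m) = 1"
      using approximate_unit by metis
    define k where "k x = complex_of_real (kr x)" for x
    have kCC: "k \<in> CC" unfolding k_def by (rule kr(5))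
    note kb = CC_bcontfun[OF kCC] and kc = CC_continuous[OF kCC]
    have app: "cmod ((\<integral>y. f y * T t k y \<partial>m) - f (bar t)) \<le> \<epsilon>"
      "cmod ((\<integral>y. g y * T t k y \<partial>m) - g (bar t)) \<le> \<epsilon>" for t
      unfolding k_def using kr(4)
      by (auto intro!: approximate_unit_convolution[OF f U(3) kr(2) _ kr(5,6)]
          approximate_unit_convolution[OF g U(6) kr(2) _ kr(5,6)])
    have Tk: "continuous_on UNIV (\<lambda>(y, t). T t k y)"
      using continuous_on_compose2[OF translate_continuous[OF kb], of UNIV "\<lambda>(y, t). (t, y)"]
      by (simp add: case_prod_unfold continuous_intros)
    have Tk': "continuous_on UNIV (\<lambda>(y, t). T (bar t) k y)"
    proof -
      have "continuous_on UNIV (\<lambda>p :: 'a \<times> 'a. (bar (snd p), fst p))"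
        by (intro continuous_on_Pair continuous_on_compose2[OF bar_continuous] continuous_intros) auto
      from continuous_on_compose2[OF translate_continuous[OF kb] this] show ?thesis
        by (simp add: case_prod_unfold)
    qed
    define K where "K s y = T (bar s) (T x k) y" for s y
    have Kc: "continuous_on UNIV (\<lambda>(s, y). K s y)"
    proof -
      have "continuous_on UNIV (\<lambda>p :: 'a \<times> 'a. (bar (fst p), snd p))"
        by (intro continuous_on_Pair continuous_on_compose2[OF bar_continuous] continuous_intros) auto
      from continuous_on_compose2[OF translate_continuous[OF translate_bcontfun[OF kb, of x]] this]
      show ?thesis
        by (simp add: case_prod_unfold K_def)
    qed
    have Kc': "continuous_on UNIV (\<lambda>(y, s). K s y)"
      using continuous_on_compose2[OF Kc, of UNIV "\<lambda>(s, y). (y, s)"]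
      by (simp add: case_prod_unfold continuous_intros)
    have int1: "(\<integral>z. cmod 1 \<partial>\<omega> a b) = 1" for a b by simp
    \<comment> \<open>Integrating out \<open>y\<close> first, the approximate unit replaces the
      inner integral by \<open>g (bar t)\<close>; its average over \<open>\<omega> (bar s) x\<close>
      is \<open>T (bar x) g s\<close>.\<close>
    have 1: "cmod ((\<integral>y. g y * K s y \<partial>m) - T (bar x) g s) \<le> \<epsilon>" for s
    proof -
      have "(\<integral>y. g y * K s y \<partial>m) = (\<integral>y. g y * (\<integral>t. 1 * T t k y \<partial>\<omega> (bar s) x) \<partial>m)"
        by (simp add: K_def translate_translate[OF kb])
      also have "\<dots> = (\<integral>t. 1 * (\<integral>y. g y * T t k y \<partial>m) \<partial>\<omega> (bar s) x)"
        by (rule compact_weight_Fubini[OF wg compact_weight_convolution Tk])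
      finally have "(\<integral>y. g y * K s y \<partial>m) = \<dots>" .
      moreover have "(\<integral>t. 1 * g (bar t) \<partial>\<omega> (bar s) x) = T (bar x) g s"
        using translate_bar[OF CC_continuous[OF g], of "bar s" x] translate_commute[of s g "bar x"]
        by (simp add: bar_bar)
      moreover have "cmod ((\<integral>t. 1 * (\<integral>y. g y * T t k y \<partial>m) \<partial>\<omega> (bar s) x) -
          (\<integral>t. 1 * g (bar t) \<partial>\<omega> (bar s) x)) \<le> \<epsilon> * (\<integral>z. cmod 1 \<partial>\<omega> (bar s) x)"
      proof (rule compact_weight_integral_bound[OF compact_weight_convolution, where C = UNIV])
        show "continuous_on UNIV (\<lambda>t. \<integral>y. g y * T t k y \<partial>m)"
          by (rule compact_weight_continuous[OF wg translate_continuous[OF kb]])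
        show "continuous_on UNIV (\<lambda>t. g (bar t))"
          by (rule continuous_on_compose2[OF CC_continuous[OF g] bar_continuous]) simp
      qed (use app in auto)
      ultimately show ?thesis unfolding int1 by simp
    qed
    \<comment> \<open>Here the symmetry of \<open>k\<close> enters: it gives
      \<open>T (bar s) k r = T (bar r) k s\<close>, so that \<open>s\<close> can be integrated out
      first.\<close>
    have 2: "cmod ((\<integral>s. f s * K s y \<partial>m) - T x f y) \<le> \<epsilon>" for y
    proof -
      have kbar: "k (bar z) = k z" for z by (simp add: k_def kr(3))
      have "T (bar s) k r = T (bar r) k s" for s r
      proof -
        have "T (bar s) k r = (\<integral>z. k (bar z) \<partial>\<omega> (bar s) r)" by (simp add: translate_def kbar)
        also have "\<dots> = T s k (bar r)" by (simp only: translate_bar[OF kc] bar_bar)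
        finally show ?thesis by (simp only: translate_commute[of s])
      qed
      then have "K s y = (\<integral>r. 1 * T (bar r) k s \<partial>\<omega> x y)" for s
        unfolding K_def translate_translate_commute[OF kb, of "bar s"] by (simp add: translate_def[of _ x])
      then have "(\<integral>s. f s * K s y \<partial>m) = (\<integral>s. f s * (\<integral>r. 1 * T (bar r) k s \<partial>\<omega> x y) \<partial>m)"
        by simp
      also have "\<dots> = (\<integral>r. 1 * (\<integral>s. f s * T (bar r) k s \<partial>m) \<partial>\<omega> x y)"
        by (rule compact_weight_Fubini[OF wf compact_weight_convolution Tk'])
      finally have "(\<integral>s. f s * K s y \<partial>m) = \<dots>" .
      moreover have "(\<integral>r. 1 * f r \<partial>\<omega> x y) = T x f y" by (simp add: translate_def)
      moreover have "cmod ((\<integral>r. 1 * (\<integral>s. f s * T (bar r) k s \<partial>m) \<partial>\<omega> x y) -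
          (\<integral>r. 1 * f r \<partial>\<omega> x y)) \<le> \<epsilon> * (\<integral>z. cmod 1 \<partial>\<omega> x y)"
      proof (rule compact_weight_integral_bound[OF compact_weight_convolution, where C = UNIV])
        have "continuous_on UNIV (\<lambda>(r, s). T (bar r) k s)"
          using continuous_on_compose2[OF Tk', of UNIV "\<lambda>(r, s). (s, r)"]
          by (simp add: case_prod_unfold continuous_intros)
        then show "continuous_on UNIV (\<lambda>r. \<integral>s. f s * T (bar r) k s \<partial>m)"
          by (rule compact_weight_continuous[OF wf])
        show "continuous_on UNIV f" by (rule CC_continuous[OF f])
        show "cmod ((\<integral>s. f s * T (bar r) k s \<partial>m) - f r) \<le> \<epsilon>" for r
          using app(1)[of "bar r"] by (simp add: bar_bar)
      qed auto
      ultimately show ?thesis unfolding int1 by simp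
    qed
    define I where "I = (\<integral>s. f s * (\<integral>y. g y * K s y \<partial>m) \<partial>m)"
    have I2: "I = (\<integral>y. g y * (\<integral>s. f s * K s y \<partial>m) \<partial>m)"
      unfolding I_def by (rule compact_weight_Fubini[OF wf wg Kc])
    have "cmod (I - ?B) \<le> \<epsilon> * Nf"
      unfolding I_def Nf_def
      by (rule compact_weight_integral_bound[OF wf, where C = UNIV])
        (use 1 in \<open>auto intro: compact_weight_continuous[OF wg Kc] CC_continuous[OF CC_translate[OF g]]\<close>)
    moreover have "cmod (I - ?A) \<le> \<epsilon> * Ng"
      unfolding I2 Ng_def
      by (rule compact_weight_integral_bound[OF wg, where C = UNIV])
        (use 2 in \<open>auto intro: compact_weight_continuous[OF wf Kc'] CC_continuous[OF CC_translate[OF f]]\<close>)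
    ultimately show ?thesis
      using norm_triangle_ineq4[of "I - ?B" "I - ?A"] by (simp add: algebra_simps)
  qed
  have "cmod (?A - ?B) \<le> d" if "d > 0" for d
  proof -
    have "cmod (?A - ?B) \<le> d / (Nf + Ng + 1) * (Nf + Ng)"
      using N that by (intro bound) simp
    also have "\<dots> \<le> d" using N that by (simp add: field_simps)
    finally show ?thesis .
  qed
  then have "cmod (?A - ?B) \<le> 0" by (rule field_le_epsilon) simp
  then show ?thesis by simp
qed

text \<open>Both integrals see \<psi> only on the compact set \<open>D \<odot> {x}\<close>, so
  \<psi> may be multiplied by a compactly supported function that is 1 there.\<close>

lemma translate_adjoint:
  assumes h: "h \<in> CC" and \<psi>: "\<psi> \<in> bcontfun"
  shows "(\<integral>y. h y * T x \<psi> y \<partial>m) = (\<integral>y. T (bar x) h y * \<psi> y \<partial>m)"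
proof -
  obtain D where D: "compact D" "\<And>x. x \<notin> D \<Longrightarrow> h x = 0" using CC_support[OF h] by blast
  have "compact (D \<odot> {x})" using D by (intro compact_set_conv) auto
  then obtain u E where u: "continuous_on UNIV u" "\<And>y. y \<in> D \<odot> {x} \<Longrightarrow> u y = (1::real)"
      "compact E" "\<And>y. y \<notin> E \<Longrightarrow> u y = 0"
    by (rule compact_Urysohn[OF locally_compact _ open_UNIV subset_UNIV]) blast
  define f where "f y = complex_of_real (u y) * \<psi> y" for y
  have "(\<lambda>y. complex_of_real (u y)) \<in> CC"
    using u by (intro CC_I[of _ E] continuous_intros) auto
  then have f: "f \<in> CC"
    unfolding f_def by (intro CC_mult bcontfun_continuous[OF \<psi>])
  have "h y * T x \<psi> y = h y * T x f y" for y
  proof (cases "y \<in> D")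
    case True
    have "T x \<psi> y = T x f y"
    proof (rule translate_cong[OF bcontfun_continuous[OF \<psi>] CC_continuous[OF f]])
      fix z assume "z \<in> S x y"
      then have "z \<in> D \<odot> {x}" using True by (auto intro: set_convI simp: S_commute[of x])
      then show "\<psi> z = f z" using u(2) by (simp add: f_def)
    qed
    then show ?thesis by simp
  qed (simp add: D(2))
  moreover have "T (bar x) h y * \<psi> y = f y * T (bar x) h y" for y
  proof (cases "y \<in> D \<odot> {x}")
    case True
    then show ?thesis using u(2) by (simp add: f_def)
  next
    case False
    then have "T (bar x) h y = 0"
      using D(2) by (intro translate_support[OF CC_continuous[OF h]]) (auto simp: bar_bar)
    then show ?thesis by simp
  qed
  ultimately show ?thesis
    using translate_adjoint_CC[OF f h, of x] by (simp only:)
qed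

section \<open>Convolution with compactly supported functions\<close>

lemma conv_translate:
  assumes h: "h \<in> CC" and \<phi>: "\<phi> \<in> bcontfun"
  shows "T x (\<lambda>y. \<integral>t. h t * T y \<phi> t \<partial>m) y = (\<integral>t. h t * T x (T y \<phi>) t \<partial>m)"
proof -
  have c: "continuous_on UNIV (\<lambda>(s, t). T s \<phi> t)" by (rule translate_continuous[OF \<phi>])
  have "T x (\<lambda>y. \<integral>t. h t * T y \<phi> t \<partial>m) y = (\<integral>s. 1 * (\<integral>t. h t * T s \<phi> t \<partial>m) \<partial>\<omega> x y)"
    by (simp add: translate_def)
  also have "\<dots> = (\<integral>t. h t * (\<integral>s. 1 * T s \<phi> t \<partial>\<omega> x y) \<partial>m)"
    by (rule compact_weight_Fubini[OF compact_weight_convolution compact_weight_haar[OF h] c])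
  finally show ?thesis by (simp add: translate_translate[OF \<phi>])
qed

text \<open>Adjointness moves a translation of the convolution from \<phi> onto \<open>h\<close>.
  The translates of \<open>h\<close> vary uniformly and, for nearby points, live on one compact set
  \<open>E\<close> of finite measure, while \<phi> contributes only its bound. Thus a merely bounded
  continuous \<phi> yields an element of \<open>UC \<omega>\<close>.\<close>

lemma conv_UC:
  assumes h: "h \<in> CC" and \<phi>: "\<phi> \<in> bcontfun"
  shows "(\<lambda>y. \<integral>t. h t * T y \<phi> t \<partial>m) \<in> UC \<omega>" (is "?F \<in> _")
  unfolding UC_iff
proof (intro conjI allI impI)
  obtain B where B: "B \<ge> 0" "\<And>x. cmod (\<phi> x) \<le> B" using bcontfun_bound[OF \<phi>] by blast
  have TB: "cmod (T y \<phi> t) \<le> B" for y t by (rule translate_bound[OF B(2)])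
  have hint: "integrable m (\<lambda>t. cmod (h t) * B)"
    using integrable_CC[OF h] by (intro integrable_mult_left integrable_norm)
  show "?F \<in> bcontfun"
  proof (rule bcontfunI_complex)
    show "continuous_on UNIV ?F"
      by (rule compact_weight_continuous[OF compact_weight_haar[OF h] translate_continuous[OF \<phi>]])
    show "cmod (?F y) \<le> (\<integral>t. cmod (h t) * B \<partial>m)" for y
      using TB by (intro norm_integral_le_AE hint AE_I2) (auto simp: norm_mult mult_left_mono)
  qed
  obtain D where D: "compact D" "\<And>x. x \<notin> D \<Longrightarrow> h x = 0" using CC_support[OF h] by blast
  fix x :: 'a and \<epsilon> :: real assume "\<epsilon> > 0"
  obtain U K where U: "open U" "compact K" "x \<in> U" "U \<subseteq> K" by (rule compact_neighbourhood)
  define E where "E = D \<odot> K"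
  have E: "compact E" unfolding E_def using D U by (intro compact_set_conv)
  have Efin: "emeasure m E < \<infinity>" by (rule emeasure_compact_finite[OF E])
  have Em: "E \<in> sets m" using compact_imp_closed[OF E] by (simp add: borel_closed)
  define \<delta> where "\<delta> = \<epsilon> / (B * measure m E + 1)"
  have BE: "B * measure m E \<ge> 0" using B by simp
  then have \<delta>: "\<delta> > 0" using \<open>\<epsilon> > 0\<close> by (simp add: \<delta>_def)
  obtain N where N: "open N" "bar x \<in> N" "\<forall>x'\<in>N. \<forall>y. cmod (T x' h y - T (bar x) h y) \<le> \<delta>"
    using UC_equicontinuous[OF CC_UC[OF h] \<delta>, of "bar x"] by blast
  have out: "T (bar x') h t = 0" if "x' \<in> U" "t \<notin> E" for x' t
  proof (rule translate_support[OF CC_continuous[OF h] D(2)])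
    show "t \<notin> D \<odot> {bar (bar x')}"
      using that U set_conv_mono[of D D "{x'}" K] by (auto simp: E_def bar_bar)
  qed
  have "cmod (T x' ?F y - T x ?F y) \<le> \<epsilon>" if x': "x' \<in> U \<inter> bar -` N" for x' y
  proof -
    have TF: "T z ?F y = (\<integral>t. T (bar z) h t * T y \<phi> t \<partial>m)" for z
      by (simp add: conv_translate[OF h \<phi>] translate_adjoint[OF h translate_bcontfun[OF \<phi>]])
    have int: "integrable m (\<lambda>t. T (bar z) h t * T y \<phi> t)" for z
      by (rule compact_weight_integrable[OF compact_weight_haar[OF CC_translate[OF h]]
            bcontfun_continuous[OF translate_bcontfun[OF \<phi>]]])
    have "T x' ?F y - T x ?F y = (\<integral>t. (T (bar x') h t - T (bar x) h t) * T y \<phi> t \<partial>m)"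
      unfolding TF by (simp add: Bochner_Integration.integral_diff[OF int int, symmetric] left_diff_distrib)
    also have "cmod \<dots> \<le> (\<integral>t. indicator E t * (\<delta> * B) \<partial>m)"
    proof (rule norm_integral_le_AE)
      show "integrable m (\<lambda>t. indicator E t * (\<delta> * B))"
        using Efin Em by (intro integrable_mult_left) (simp add: integrable_indicator_iff)
      have "cmod ((T (bar x') h t - T (bar x) h t) * T y \<phi> t) \<le> indicator E t * (\<delta> * B)" for t
      proof (cases "t \<in> E")
        case True
        then show ?thesis using N(3) x' TB \<delta> B(1) by (auto simp: norm_mult intro!: mult_mono)
      next
        case False
        then show ?thesis using out[of x' t] out[OF U(3), of t] x' by simp
      qed
      then show "AE t in m. cmod ((T (bar x') h t - T (bar x) h t) * T y \<phi> t) \<le> indicator E t * (\<delta> * B)"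
        by simp
    qed
    also have "\<dots> = \<delta> * (B * measure m E)" using Em by simp
    also have "\<dots> \<le> \<epsilon>" using BE \<open>\<epsilon> > 0\<close> by (simp add: \<delta>_def field_simps)
    finally show ?thesis .
  qed
  with N U show "\<exists>N. open N \<and> x \<in> N \<and> (\<forall>x'\<in>N. \<forall>y. cmod (T x' ?F y - T x ?F y) \<le> \<epsilon>)"
    by (intro exI[of _ "U \<inter> bar -` N"]) (auto intro!: open_Int open_vimage[OF _ bar_continuous])
qed

end

section \<open>Bounded functionals on uniformly continuous functions\<close>

lemma norm_Bcontfun_le:
  fixes f :: "'a::topological_space \<Rightarrow> complex"
  assumes "f \<in> bcontfun" "\<And>x. cmod (f x) \<le> A"
  shows "norm (Bcontfun f) \<le> A"
  using assms by (intro norm_bound) (simp add: Bcontfun_inverse)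

lemma norm_le_norm_Bcontfun:
  fixes f :: "'a::topological_space \<Rightarrow> complex"
  assumes "f \<in> bcontfun"
  shows "cmod (f x) \<le> norm (Bcontfun f)"
  using norm_bounded[of "Bcontfun f" x] assms by (simp add: Bcontfun_inverse)

context commutative_hypergroup
begin

lemma bounded_functional_UC_bound:
  assumes "bounded_functional_UC \<omega> n"
  shows "\<exists>B\<ge>0. \<forall>f\<in>UC \<omega>. \<forall>A. (\<forall>x. cmod (f x) \<le> A) \<longrightarrow> cmod (n f) \<le> B * A"
proof -
  obtain B where B: "\<forall>f\<in>UC \<omega>. cmod (n f) \<le> B * norm (Bcontfun f)"
    using assms unfolding bounded_functional_UC_def by blast
  have "cmod (n f) \<le> max B 0 * A" if "f \<in> UC \<omega>" "\<forall>x. cmod (f x) \<le> A" for f A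
  proof -
    have le: "norm (Bcontfun f) \<le> A"
      using that by (intro norm_Bcontfun_le UC_bcontfun) auto
    have "cmod (n f) \<le> B * norm (Bcontfun f)" using B that(1) by blast
    also have "\<dots> \<le> max B 0 * norm (Bcontfun f)" by (intro mult_right_mono) auto
    also have "\<dots> \<le> max B 0 * A" by (intro mult_left_mono le) auto
    finally show ?thesis .
  qed
  then show ?thesis by (intro exI[of _ "max B 0"]) auto
qed

lemma functional_add:
  "bounded_functional_UC \<omega> n \<Longrightarrow> f \<in> UC \<omega> \<Longrightarrow> g \<in> UC \<omega> \<Longrightarrow> n (\<lambda>x. f x + g x) = n f + n g"
  by (simp add: bounded_functional_UC_def)

lemma functional_mult:
  "bounded_functional_UC \<omega> n \<Longrightarrow> f \<in> UC \<omega> \<Longrightarrow> n (\<lambda>x. c * f x) = c * n f"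
  by (simp add: bounded_functional_UC_def)

lemma UC_diff: "f \<in> UC \<omega> \<Longrightarrow> g \<in> UC \<omega> \<Longrightarrow> (\<lambda>x. f x - g x) \<in> UC \<omega>"
  using UC_add[OF _ UC_mult[of g "-1"]] by simp

lemma functional_diff:
  assumes n: "bounded_functional_UC \<omega> n" and f: "f \<in> UC \<omega>" and g: "g \<in> UC \<omega>"
  shows "n (\<lambda>x. f x - g x) = n f - n g"
  using functional_add[OF n f UC_mult[OF g, of "-1"]] functional_mult[OF n g, of "-1"] by simp

lemma UC_sum:
  assumes "finite I" "\<And>i. i \<in> I \<Longrightarrow> f i \<in> UC \<omega>"
  shows "(\<lambda>x. \<Sum>i\<in>I. c i * f i x) \<in> UC \<omega>"
  using assms
proof (induction I)
  case empty
  have "(\<lambda>_. 0) \<in> UC \<omega>" by (simp add: UC_iff const_bcontfun) (meson open_UNIV UNIV_I)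
  then show ?case by simp
next
  case (insert i I)
  then show ?case by (simp add: UC_add UC_mult)
qed

lemma functional_sum:
  assumes n: "bounded_functional_UC \<omega> n" and "finite I" "\<And>i. i \<in> I \<Longrightarrow> f i \<in> UC \<omega>"
  shows "n (\<lambda>x. \<Sum>i\<in>I. c i * f i x) = (\<Sum>i\<in>I. c i * n (f i))"
  using assms(2,3)
proof (induction I)
  case empty
  have "(\<lambda>_. 0) \<in> UC \<omega>" using UC_sum[of "{}"] by simp
  then show ?case using functional_mult[OF n, of "\<lambda>_. 0" 0] by simp
next
  case (insert i I)
  then show ?case
    using functional_add[OF n UC_mult UC_sum, of "f i" I f "c i" c] by (simp add: functional_mult[OF n])
qed

lemma functional_translate_equicontinuous:
  assumes n: "bounded_functional_UC \<omega> n" and f: "f \<in> UC \<omega>" and "\<epsilon> > 0"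
  shows "\<exists>N. open N \<and> x \<in> N \<and>
    (\<forall>x'\<in>N. cmod (n (T x' f) - n (T x f)) \<le> \<epsilon> \<and> (\<forall>y. cmod (T x' f y - T x f y) \<le> \<epsilon>))"
proof -
  obtain B where B: "B \<ge> 0" "\<And>f A. f \<in> UC \<omega> \<Longrightarrow> (\<And>x. cmod (f x) \<le> A) \<Longrightarrow> cmod (n f) \<le> B * A"
    using bounded_functional_UC_bound[OF n] by blast
  have e: "\<epsilon> / (B + 1) > 0" using B(1) \<open>\<epsilon> > 0\<close> by simp
  obtain N where N: "open N" "x \<in> N" "\<forall>x'\<in>N. \<forall>y. cmod (T x' f y - T x f y) \<le> \<epsilon> / (B + 1)"
    using UC_equicontinuous[OF f e] by blast
  have le: "\<epsilon> / (B + 1) \<le> \<epsilon>" "B * (\<epsilon> / (B + 1)) \<le> \<epsilon>" using B(1) \<open>\<epsilon> > 0\<close> by (auto simp: field_simps)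
  have "cmod (n (T x' f) - n (T x f)) \<le> \<epsilon>" if "x' \<in> N" for x'
  proof -
    have "n (T x' f) - n (T x f) = n (\<lambda>y. T x' f y - T x f y)"
      by (rule functional_diff[OF n UC_translate[OF f] UC_translate[OF f], symmetric])
    also have "cmod \<dots> \<le> B * (\<epsilon> / (B + 1))"
      using N(3) that by (intro B(2) UC_diff UC_translate f) auto
    finally show ?thesis using le by simp
  qed
  with N le show ?thesis by (meson order_trans)
qed

text \<open>Riemann sums with nodes independent of \<open>y\<close> approximate \<open>F\<close> in
  the supremum norm by finite combinations of translates of \<open>f\<close>. Boundedness of
  \<open>n\<close> then suffices, and \<open>n\<close> acts on the finite sums by linearity.\<close>

lemma functional_integral:
  assumes n: "bounded_functional_UC \<omega> n" and f: "f \<in> UC \<omega>" and g: "compact_weight \<mu> g"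
    and F: "F \<in> UC \<omega>" "\<And>y. F y = (\<integral>t. g t * T t f y \<partial>\<mu>)"
  shows "n F = (\<integral>t. g t * n (T t f) \<partial>\<mu>)" (is "_ = ?r")
proof -
  obtain B where B: "B \<ge> 0" "\<And>f A. f \<in> UC \<omega> \<Longrightarrow> (\<And>x. cmod (f x) \<le> A) \<Longrightarrow> cmod (n f) \<le> B * A"
    using bounded_functional_UC_bound[OF n] by blast
  \<comment> \<open>The extra parameter \<open>None\<close> makes the same sums approximate the
    right-hand integral too.\<close>
  define V where "V t b = (case b of None \<Rightarrow> n (T t f) | Some y \<Rightarrow> T t f y)" for t b
  have equi: "\<exists>N. open N \<and> x \<in> N \<and> (\<forall>y\<in>N. \<forall>b\<in>UNIV. cmod (V y b - V x b) \<le> \<delta>)" if \<delta>: "\<delta> > 0" for x \<delta>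
  proof -
    obtain N where "open N" "x \<in> N"
      "\<forall>x'\<in>N. cmod (n (T x' f) - n (T x f)) \<le> \<delta> \<and> (\<forall>y. cmod (T x' f y - T x f y) \<le> \<delta>)"
      using functional_translate_equicontinuous[OF n f \<delta>] by blast
    then show ?thesis
      by (intro exI[of _ N]) (auto simp: V_def split: option.split)
  qed
  have V: "continuous_on UNIV (\<lambda>x. V x b)" for b
    unfolding continuous_on_def
  proof (intro ballI tendstoI)
    fix x and \<delta> :: real assume "\<delta> > 0"
    then obtain N where N: "open N" "x \<in> N" "\<forall>y\<in>N. \<forall>b\<in>UNIV. cmod (V y b - V x b) \<le> \<delta> / 2"
      using equi[of "\<delta> / 2" x] by auto
    have "dist (V y b) (V x b) < \<delta>" if "y \<in> N" for y
    proof -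
      have "dist (V y b) (V x b) \<le> \<delta> / 2" using N(3) that by (simp add: dist_norm)
      then show ?thesis using \<open>\<delta> > 0\<close> by simp
    qed
    with N(1,2) show "\<forall>\<^sub>F y in at x within UNIV. dist (V y b) (V x b) < \<delta>"
      unfolding eventually_at_topological by blast
  qed
  have bound: "cmod (n F - ?r) \<le> (B + 1) * \<epsilon>" if \<epsilon>: "\<epsilon> > 0" for \<epsilon>
  proof -
    obtain I w where I: "finite I"
      "\<forall>b\<in>UNIV. cmod ((\<integral>x. g x * V x b \<partial>\<mu>) - (\<Sum>i\<in>I. w i * V i b)) \<le> \<epsilon>"
      using compact_weight_Riemann_sum[OF g V equi \<epsilon>] by blast
    have 1: "cmod (?r - (\<Sum>i\<in>I. w i * n (T i f))) \<le> \<epsilon>"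
      using I(2)[rule_format, of None] by (simp add: V_def)
    have 2: "cmod (F y - (\<Sum>i\<in>I. w i * T i f y)) \<le> \<epsilon>" for y
      using I(2)[rule_format, of "Some y"] by (simp add: V_def F(2))
    have "n F - (\<Sum>i\<in>I. w i * n (T i f)) = n (\<lambda>y. F y - (\<Sum>i\<in>I. w i * T i f y))"
      by (simp add: functional_diff[OF n F(1)] functional_sum[OF n] UC_sum I(1) UC_translate f)
    also have "cmod \<dots> \<le> B * \<epsilon>"
      using 2 by (intro B(2) UC_diff F(1) UC_sum I(1) UC_translate f)
    finally show ?thesis
      using 1 norm_triangle_ineq4[of "n F - (\<Sum>i\<in>I. w i * n (T i f))" "?r - (\<Sum>i\<in>I. w i * n (T i f))"]
      by (simp add: algebra_simps)
  qed
  have "cmod (n F - ?r) \<le> d" if "d > 0" for d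
  proof -
    have "cmod (n F - ?r) \<le> (B + 1) * (d / (B + 1))" using B(1) that by (intro bound) simp
    then show ?thesis using B(1) by simp
  qed
  then have "cmod (n F - ?r) \<le> 0" by (rule field_le_epsilon) simp
  then show ?thesis by simp
qed

text \<open>\<open>T z (T y f)\<close> is the average of the functions \<open>T t f\<close> over
  \<open>\<omega> z y\<close>, and \<open>functional_integral\<close> takes \<open>n\<close> inside
  this average.\<close>

lemma translate_functional:
  assumes n: "bounded_functional_UC \<omega> n" and f: "f \<in> UC \<omega>"
  shows "T y (\<lambda>x. n (T x f)) z = n (T z (T y f))"
proof -
  note fb = UC_bcontfun[OF f]
  have "n (T z (T y f)) = (\<integral>t. 1 * n (T t f) \<partial>\<omega> z y)"
  proof (rule functional_integral[OF n f compact_weight_convolution])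
    show "T z (T y f) \<in> UC \<omega>" by (intro UC_translate f)
    show "T z (T y f) w = (\<integral>t. 1 * T t f w \<partial>\<omega> z y)" for w
      by (simp add: translate_translate[OF fb])
  qed
  then show ?thesis by (simp add: translate_def[of _ y] commute[of y z])
qed

text \<open>This property is the introversion of \<open>UC \<omega>\<close>. It keeps the argument
  of the outer functional in the composition \<open>M (\<lambda>x. n (T x f))\<close> inside the
  domain of \<open>M\<close>.\<close>

lemma functional_translate_UC:
  assumes n: "bounded_functional_UC \<omega> n" and f: "f \<in> UC \<omega>"
  shows "(\<lambda>x. n (T x f)) \<in> UC \<omega>" (is "?G \<in> _")
proof -
  note fb = UC_bcontfun[OF f]
  obtain B where B: "B \<ge> 0" "\<And>f A. f \<in> UC \<omega> \<Longrightarrow> (\<And>x. cmod (f x) \<le> A) \<Longrightarrow> cmod (n f) \<le> B * A"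
    using bounded_functional_UC_bound[OF n] by blast
  obtain A where A: "\<And>x. cmod (f x) \<le> A" using bcontfun_bound[OF fb] by blast
  have G: "?G \<in> bcontfun"
  proof (rule bcontfunI_complex)
    show "cmod (?G x) \<le> B * A" for x
      by (intro B(2) UC_translate f translate_bound A)
    show "continuous_on UNIV ?G"
      unfolding continuous_on_def
    proof (intro ballI tendstoI)
      fix x and \<delta> :: real assume "\<delta> > 0"
      then obtain N where N: "open N" "x \<in> N"
        "\<forall>x'\<in>N. cmod (n (T x' f) - n (T x f)) \<le> \<delta> / 2 \<and> (\<forall>y. cmod (T x' f y - T x f y) \<le> \<delta> / 2)"
        using functional_translate_equicontinuous[OF n f, of "\<delta> / 2" x] by auto
      have "dist (n (T y f)) (n (T x f)) < \<delta>" if "y \<in> N" for y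
      proof -
        have "dist (n (T y f)) (n (T x f)) \<le> \<delta> / 2" using N(3) that by (simp add: dist_norm)
        then show ?thesis using \<open>\<delta> > 0\<close> by simp
      qed
      with N(1,2) show "\<forall>\<^sub>F y in at x within UNIV. dist (n (T y f)) (n (T x f)) < \<delta>"
        unfolding eventually_at_topological by blast
    qed
  qed
  show ?thesis
    unfolding UC_iff
  proof (intro conjI allI impI G)
    fix x and \<epsilon> :: real assume "\<epsilon> > 0"
    then have "\<epsilon> / (B + 1) > 0" using B(1) by simp
    then obtain N where N: "open N" "x \<in> N" "\<forall>x'\<in>N. \<forall>y. cmod (T x' f y - T x f y) \<le> \<epsilon> / (B + 1)"
      using UC_equicontinuous[OF f] by blast
    have le: "B * (\<epsilon> / (B + 1)) \<le> \<epsilon>" using B(1) \<open>\<epsilon> > 0\<close> by (auto simp: field_simps)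
    have "cmod (T x' ?G z - T x ?G z) \<le> \<epsilon>" if "x' \<in> N" for x' z
    proof -
      have "T x' ?G z - T x ?G z = n (\<lambda>y. T z (T x' f) y - T z (T x f) y)"
        unfolding translate_functional[OF n f]
        by (intro functional_diff[OF n, symmetric] UC_translate f)
      also have "(\<lambda>y. T z (T x' f) y - T z (T x f) y) = T z (\<lambda>y. T x' f y - T x f y)"
        by (simp add: translate_diff bcontfun_continuous[OF translate_bcontfun[OF fb]] fun_eq_iff)
      also have "cmod (n \<dots>) \<le> B * (\<epsilon> / (B + 1))"
        using N(3) that by (intro B(2) UC_translate UC_diff f translate_bound) auto
      finally show ?thesis using le by simp
    qed
    with N(1,2) show "\<exists>N. open N \<and> x \<in> N \<and> (\<forall>x'\<in>N. \<forall>y. cmod (T x' ?G y - T x ?G y) \<le> \<epsilon>)"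
      by blast
  qed
qed

section \<open>Characters\<close>

lemma dual_translate: "\<alpha> \<in> dual_space \<omega> bar \<Longrightarrow> T x \<alpha> = (\<lambda>y. \<alpha> x * \<alpha> y)"
  by (simp add: dual_space_def translate_def fun_eq_iff)

lemma dual_bcontfun: "\<alpha> \<in> dual_space \<omega> bar \<Longrightarrow> \<alpha> \<in> bcontfun"
  by (simp add: dual_space_def)

lemma dual_bar: "\<alpha> \<in> dual_space \<omega> bar \<Longrightarrow> \<alpha> (bar x) = cnj (\<alpha> x)"
  by (simp add: dual_space_def)

lemma dual_unit:
  assumes "\<alpha> \<in> dual_space \<omega> bar" shows "\<alpha> e = 1"
proof -
  have "\<alpha> \<noteq> (\<lambda>_. 0)" using assms by (simp add: dual_space_def)
  then obtain y where "\<alpha> y \<noteq> 0" by (auto simp: fun_eq_iff)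
  moreover have "\<alpha> y = \<alpha> e * \<alpha> y"
    using translate_unit(2)[OF bcontfun_continuous[OF dual_bcontfun[OF assms]], of y]
    by (simp add: dual_translate[OF assms])
  ultimately show ?thesis by simp
qed

text \<open>Translating by \<open>x\<close> repeatedly multiplies the character by powers of
  \<open>\<alpha> x\<close> without increasing a bound on it; at the unit this bounds all the
  powers.\<close>

lemma dual_bound:
  assumes \<alpha>: "\<alpha> \<in> dual_space \<omega> bar" shows "cmod (\<alpha> x) \<le> 1"
proof (rule ccontr)
  assume gt: "\<not> ?thesis"
  obtain B where B: "\<And>x. cmod (\<alpha> x) \<le> B" using bcontfun_bound[OF dual_bcontfun[OF \<alpha>]] by blast
  have "cmod (\<alpha> x) ^ k * cmod (\<alpha> y) \<le> B" for k y
  proof (induction k arbitrary: y)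
    case (Suc k)
    have "cmod (\<alpha> x) ^ Suc k * cmod (\<alpha> y) = cmod (T x (\<lambda>z. \<alpha> x ^ k * \<alpha> z) y)"
      by (simp add: translate_mult dual_translate[OF \<alpha>] norm_mult norm_power)
    also have "\<dots> \<le> B"
      using Suc by (intro translate_bound) (simp add: norm_mult norm_power)
    finally show ?case .
  qed (use B in simp)
  from this[of _ e] have "cmod (\<alpha> x) ^ k \<le> B" for k by (simp add: dual_unit[OF \<alpha>])
  moreover obtain k where "B < cmod (\<alpha> x) ^ k"
    using real_arch_pow[of "cmod (\<alpha> x)" B] gt by auto
  ultimately show False by (meson not_le)
qed

lemma dual_UC:
  assumes \<alpha>: "\<alpha> \<in> dual_space \<omega> bar" shows "\<alpha> \<in> UC \<omega>"
  unfolding UC_iff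
proof (intro conjI allI impI)
  show "\<alpha> \<in> bcontfun" by (rule dual_bcontfun[OF \<alpha>])
  fix x and \<epsilon> :: real assume "\<epsilon> > 0"
  have c: "continuous_on UNIV \<alpha>" by (rule bcontfun_continuous[OF dual_bcontfun[OF \<alpha>]])
  define N where "N = {x'. cmod (\<alpha> x' - \<alpha> x) < \<epsilon>}"
  have "open N" "x \<in> N"
    unfolding N_def using c \<open>\<epsilon> > 0\<close> by (auto intro!: open_Collect_less continuous_intros)
  moreover have "cmod (T x' \<alpha> y - T x \<alpha> y) \<le> \<epsilon>" if "x' \<in> N" for x' y
  proof -
    have "cmod (T x' \<alpha> y - T x \<alpha> y) = cmod (\<alpha> x' - \<alpha> x) * cmod (\<alpha> y)"
      by (simp add: dual_translate[OF \<alpha>] left_diff_distrib[symmetric] norm_mult)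
    also have "\<dots> \<le> \<epsilon> * 1"
      using that \<open>\<epsilon> > 0\<close> by (intro mult_mono dual_bound[OF \<alpha>]) (auto simp: N_def)
    finally show ?thesis by simp
  qed
  ultimately show "\<exists>N. open N \<and> x \<in> N \<and> (\<forall>x'\<in>N. \<forall>y. cmod (T x' \<alpha> y - T x \<alpha> y) \<le> \<epsilon>)"
    by blast
qed

text \<open>This is the Arens product of the \<open>\<alpha>\<close>-mean \<open>M\<close> with \<open>n\<close>.\<close>

lemma alpha_mean_compose:
  assumes \<alpha>: "\<alpha> \<in> dual_space \<omega> bar" and M: "alpha_mean \<omega> \<alpha> M"
    and n: "bounded_functional_UC \<omega> n" "n \<alpha> = 1"
  shows "alpha_mean \<omega> \<alpha> (\<lambda>f. M (\<lambda>x. n (T x f)))"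
proof -
  have M': "bounded_functional_UC \<omega> M" "M \<alpha> = 1" "\<And>f x. f \<in> UC \<omega> \<Longrightarrow> M (T x f) = \<alpha> x * M f"
    using M by (auto simp: alpha_mean_def)
  obtain B where B: "B \<ge> 0" "\<And>f A. f \<in> UC \<omega> \<Longrightarrow> (\<And>x. cmod (f x) \<le> A) \<Longrightarrow> cmod (n f) \<le> B * A"
    using bounded_functional_UC_bound[OF n(1)] by blast
  obtain C where C: "C \<ge> 0" "\<And>f A. f \<in> UC \<omega> \<Longrightarrow> (\<And>x. cmod (f x) \<le> A) \<Longrightarrow> cmod (M f) \<le> C * A"
    using bounded_functional_UC_bound[OF M'(1)] by blast
  note G = functional_translate_UC[OF n(1)]
  show ?thesis
    unfolding alpha_mean_def bounded_functional_UC_def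
  proof (intro conjI ballI allI)
    fix f g assume f: "f \<in> UC \<omega>" and g: "g \<in> UC \<omega>"
    have "T x (\<lambda>z. f z + g z) = (\<lambda>y. T x f y + T x g y)" for x
      by (simp add: translate_add bcontfun_continuous UC_bcontfun f g fun_eq_iff)
    then have "n (T x (\<lambda>z. f z + g z)) = n (T x f) + n (T x g)" for x
      by (simp add: functional_add[OF n(1)] UC_translate f g)
    then show "M (\<lambda>x. n (T x (\<lambda>x. f x + g x))) = M (\<lambda>x. n (T x f)) + M (\<lambda>x. n (T x g))"
      by (simp add: functional_add[OF M'(1) G[OF f] G[OF g]])
  next
    fix c f assume f: "f \<in> UC \<omega>"
    have "T x (\<lambda>z. c * f z) = (\<lambda>y. c * T x f y)" for x
      by (simp add: translate_mult fun_eq_iff)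
    then have "n (T x (\<lambda>z. c * f z)) = c * n (T x f)" for x
      by (simp add: functional_mult[OF n(1)] UC_translate f)
    then show "M (\<lambda>x. n (T x (\<lambda>x. c * f x))) = c * M (\<lambda>x. n (T x f))"
      by (simp add: functional_mult[OF M'(1) G[OF f]])
  next
    have "cmod (M (\<lambda>x. n (T x f))) \<le> C * B * norm (Bcontfun f)" if f: "f \<in> UC \<omega>" for f
    proof -
      have "cmod (n (T x f)) \<le> B * norm (Bcontfun f)" for x
        by (intro B(2) UC_translate f translate_bound norm_le_norm_Bcontfun UC_bcontfun)
      then show ?thesis using C(2)[OF G[OF f]] by (simp add: mult.assoc)
    qed
    then show "\<exists>B. \<forall>f\<in>UC \<omega>. cmod (M (\<lambda>x. n (T x f))) \<le> B * norm (Bcontfun f)" by blast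
  next
    show "M (\<lambda>x. n (T x \<alpha>)) = 1"
    proof -
      have "n (T x \<alpha>) = \<alpha> x" for x
        by (simp add: dual_translate[OF \<alpha>] functional_mult[OF n(1) dual_UC[OF \<alpha>]] n(2))
      then show ?thesis using M'(2) by simp
    qed
  next
    fix f x assume f: "f \<in> UC \<omega>"
    have "(\<lambda>z. n (T z (T x f))) = T x (\<lambda>z. n (T z f))"
      by (rule ext) (rule translate_functional[OF n(1) f, symmetric])
    then show "M (\<lambda>z. n (T z (T x f))) = \<alpha> x * M (\<lambda>z. n (T z f))"
      by (simp add: M'(3)[OF G[OF f]])
  qed
qed

text \<open>The weighted evaluations lie in a product of closed discs, compact by Tychonoff's
  theorem, as in the proof of the Banach-Alaoglu theorem. A cluster point replaces a convergent
  subsequence, which need not exist.\<close>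

lemma cluster_functional:
  fixes y :: "nat \<Rightarrow> 'a" and c :: "nat \<Rightarrow> complex"
  assumes c: "\<And>i. cmod (c i) \<le> C"
  obtains n where "bounded_functional_UC \<omega> n"
    "\<And>f l. f \<in> UC \<omega> \<Longrightarrow> \<forall>\<^sub>F i in sequentially. c i * f (y i) = l \<Longrightarrow> n f = l"
proof -
  have C: "C \<ge> 0" using order_trans[OF norm_ge_zero c[of 0]] .
  \<comment> \<open>Off \<open>bcontfun\<close> the value is set to 0, so that all
    \<open>p i\<close> have bounded coordinates on the whole function type.\<close>
  define p where "p i f = (if f \<in> bcontfun then c i * f (y i) else 0)" for i and f :: "'a \<Rightarrow> complex"
  define R where "R f = (if f \<in> bcontfun then C * norm (Bcontfun f) else 0)" for f :: "'a \<Rightarrow> complex"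
  define Q where "Q = PiE UNIV (\<lambda>f. cball (0::complex) (R f))"
  have "compactin (product_topology (\<lambda>_. euclidean) UNIV) Q"
    unfolding Q_def by (subst compactin_PiE) auto
  then have Q: "compact Q" by (simp add: euclidean_product_topology)
  have "p i \<in> Q" for i
  proof -
    have "cmod (p i f) \<le> R f" for f
    proof (cases "f \<in> bcontfun")
      case True
      have "cmod (c i) * cmod (f (y i)) \<le> C * norm (Bcontfun f)"
        by (intro mult_mono c norm_le_norm_Bcontfun True C) auto
      then show ?thesis using True by (simp add: p_def R_def norm_mult)
    qed (simp add: p_def R_def)
    then show ?thesis by (auto simp: Q_def)
  qed
  then have "eventually (\<lambda>q. q \<in> Q) (filtermap p sequentially)"
    by (simp add: eventually_filtermap)
  moreover have "filtermap p sequentially \<noteq> bot" by (simp add: filtermap_bot_iff)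
  ultimately obtain q where q: "q \<in> Q" "inf (nhds q) (filtermap p sequentially) \<noteq> bot"
    using Q unfolding compact_filter by blast
  \<comment> \<open>Additivity, homogeneity and a prescribed value are all closed conditions on
    finitely many coordinates, so each passes to the cluster point by this fact.\<close>
  have cl: "q \<in> P" if "closed P" "\<forall>\<^sub>F i in sequentially. p i \<in> P" for P
  proof (rule ccontr)
    assume "q \<notin> P"
    then have "eventually (\<lambda>r. r \<in> - P) (nhds q)"
      using that(1) by (intro eventually_nhds_in_open) auto
    moreover have "eventually (\<lambda>r. r \<in> P) (filtermap p sequentially)"
      using that(2) by (simp add: eventually_filtermap)
    ultimately have "eventually (\<lambda>_. False) (inf (nhds q) (filtermap p sequentially))"
      unfolding eventually_inf by (intro exI conjI) auto
    then show False using q(2) by (simp add: trivial_limit_def)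
  qed
  have ev: "continuous_on UNIV (\<lambda>r :: ('a \<Rightarrow> complex) \<Rightarrow> complex. r f)" for f
    by (rule continuous_on_product_coordinates)
  show ?thesis
  proof
    show "bounded_functional_UC \<omega> q"
      unfolding bounded_functional_UC_def
    proof (intro conjI ballI allI)
      fix f g assume fg: "f \<in> UC \<omega>" "g \<in> UC \<omega>"
      have "q \<in> {r. r (\<lambda>x. f x + g x) = r f + r g}"
      proof (rule cl)
        show "closed {r. r (\<lambda>x. f x + g x) = r f + (r g :: complex)}"
          by (intro closed_Collect_eq continuous_intros ev)
        show "\<forall>\<^sub>F i in sequentially. p i \<in> {r. r (\<lambda>x. f x + g x) = r f + r g}"
          using fg UC_add[OF fg] by (simp add: p_def UC_bcontfun algebra_simps)
      qed
      then show "q (\<lambda>x. f x + g x) = q f + q g" by simp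
    next
      fix a f assume f: "f \<in> UC \<omega>"
      have "q \<in> {r. r (\<lambda>x. a * f x) = a * r f}"
      proof (rule cl)
        show "closed {r. r (\<lambda>x. a * f x) = a * (r f :: complex)}"
          by (intro closed_Collect_eq continuous_intros ev)
        show "\<forall>\<^sub>F i in sequentially. p i \<in> {r. r (\<lambda>x. a * f x) = a * r f}"
          using f UC_mult[OF f] by (simp add: p_def UC_bcontfun algebra_simps)
      qed
      then show "q (\<lambda>x. a * f x) = a * q f" by simp
    next
      have "cmod (q f) \<le> C * norm (Bcontfun f)" if f: "f \<in> UC \<omega>" for f
      proof -
        have "cmod (q f) \<le> R f" using q(1) by (auto simp: Q_def PiE_iff)
        then show ?thesis using UC_bcontfun[OF f] by (simp add: R_def)
      qed
      then show "\<exists>B. \<forall>f\<in>UC \<omega>. cmod (q f) \<le> B * norm (Bcontfun f)" by blast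
    qed
    fix f l assume f: "f \<in> UC \<omega>" and l: "\<forall>\<^sub>F i in sequentially. c i * f (y i) = l"
    have "q \<in> {r. r f = l}"
    proof (rule cl)
      show "closed {r :: ('a \<Rightarrow> complex) \<Rightarrow> complex. r f = l}"
        by (intro closed_Collect_eq continuous_intros ev)
      show "\<forall>\<^sub>F i in sequentially. p i \<in> {r. r f = l}"
        using l UC_bcontfun[OF f] by (simp add: p_def)
    qed
    then show "q f = l" by simp
  qed
qed

end

section \<open>A slowly growing function\<close>

text \<open>Within 2 of a multiple of 8 the argument of the cosine is within \<open>pi / 4\<close>,
  hence within \<open>pi / 3\<close>, of a multiple of \<open>pi\<close>. So the cosine has absolute
  value at least 1/2, and clipping gives exactly 0 or 1. The radius 2 is the error allowed in
  \<open>slowly_growing_function\<close>.\<close>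

lemma two_valued_on_bands:
  defines "\<psi> \<equiv> (\<lambda>t::real. max 0 (min 1 (1 / 2 + cos (pi * t / 8))))"
  assumes "\<bar>t - real (8 * j)\<bar> \<le> 2"
  shows "\<psi> t = (if even j then 1 else 0)"
proof -
  let ?a = "pi * (t - real (8 * j)) / 8"
  have "pi * t / 8 = ?a + real j * pi" by (simp add: field_simps)
  then have "cos (pi * t / 8) = cos (?a + real j * pi)" by (rule arg_cong)
  then have *: "cos (pi * t / 8) = (-1) ^ j * cos ?a" by (simp only: cos_add cos_npi sin_npi) simp
  have "\<bar>?a\<bar> = pi * \<bar>t - real (8 * j)\<bar> / 8" by (simp add: abs_mult)
  also have "\<dots> \<le> pi * 2 / 8" using assms(2) by (intro divide_right_mono mult_left_mono) auto
  finally have a: "\<bar>?a\<bar> \<le> pi / 3" using pi_gt_zero by linarith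
  have "cos (pi / 3) \<le> cos \<bar>?a\<bar>"
    using pi_gt_zero by (intro cos_monotone_0_pi_le a) (simp, linarith)
  then have "1 / 2 \<le> cos ?a" by (simp only: cos_60 cos_abs_real)
  then show ?thesis using * by (simp add: \<psi>_def)
qed

context commutative_hypergroup
begin

lemma set_conv_singletons: "{x} \<odot> {y} = S x y"
  by (simp add: set_conv_def)

lemma set_conv_left_commute: "A \<odot> (B \<odot> C) = B \<odot> (A \<odot> C)"
  by (metis set_conv_assoc set_conv_commute)

lemma bar_set_conv: "z \<in> A \<odot> B \<Longrightarrow> bar z \<in> (bar ` A) \<odot> (bar ` B)"
  by (erule set_convE) (auto intro!: set_convI simp: S_bar)

text \<open>The condition that \<open>S z' (bar z)\<close> meets \<open>U\<close> is open in
  \<open>z'\<close> and holds at \<open>z\<close>, since the unit lies in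
  \<open>S z (bar z)\<close>. Reversing the product turns it into
  \<open>z' \<in> {z} \<odot> U\<close>.\<close>

lemma open_convolution_neighbourhood:
  assumes "open U" "e \<in> U"
  shows "\<exists>N. open N \<and> z \<in> N \<and> N \<subseteq> {z} \<odot> U"
proof (intro exI conjI)
  let ?N = "(\<lambda>z'. (z', bar z)) -` {(x, y). S x y \<inter> U \<noteq> {}}"
  show "open ?N"
    by (intro open_vimage open_S_meets assms continuous_intros)
  show "z \<in> ?N" using assms(2) unit_in_S[of z z] by auto
  show "?N \<subseteq> {z} \<odot> U"
  proof
    fix z' assume "z' \<in> ?N"
    then obtain u where u: "u \<in> S z' (bar z)" "u \<in> U" by auto
    then have "z' \<in> S z u" using S_reverse[of u z' "bar z"] by (simp add: bar_bar S_commute)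
    then show "z' \<in> {z} \<odot> U" using u(2) by (auto intro: set_convI)
  qed
qed

text \<open>The sets \<open>C n\<close> exhaust an open subhypergroup \<open>H\<close> that is not covered by any of them, with
  \<open>y n \<in> C (n + 1) - C n\<close>. The function \<open>L\<close> measures, on each coset of \<open>H\<close> with chosen
  representative \<open>r\<close>, the first \<open>n\<close> with \<open>z \<in> r * C n\<close>, up to an error of at most 1.\<close>

lemma slowly_growing_function:
  assumes A: "\<And>D. compact D \<Longrightarrow> \<exists>y\<in>A. y \<notin> D"
  shows "\<exists>U y (L :: 'a \<Rightarrow> real). open U \<and> e \<in> U \<and> (\<forall>n. y n \<in> A) \<and> continuous_on UNIV L \<and>
    (\<forall>x. \<forall>\<^sub>F n in sequentially. \<forall>t\<in>U. \<forall>s\<in>S x t. \<forall>w\<in>S (y n) s. \<bar>L w - real n\<bar> \<le> 2)"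
proof -
  obtain U K where U: "open U" "compact K" "e \<in> U" "U \<subseteq> K" by (rule compact_neighbourhood)
  define C0 where "C0 = K \<union> bar ` K"
  define pick where "pick D = (SOME y. y \<in> A \<and> y \<notin> D)" for D
  have pick: "pick D \<in> A" "pick D \<notin> D" if "compact D" for D
    using someI_ex[of "\<lambda>y. y \<in> A \<and> y \<notin> D"] A[OF that] by (auto simp: pick_def)
  \<comment> \<open>Adding the conjugate of the new point keeps every stage closed under
    \<open>bar\<close>.\<close>
  define C where "C = rec_nat C0 (\<lambda>_ D. D \<odot> (D \<odot> D) \<union> {pick D, bar (pick D)})"
  have C_0: "C 0 = C0" and C_Suc: "C (Suc n) = C n \<odot> (C n \<odot> C n) \<union> {pick (C n), bar (pick (C n))}" for n
    by (simp_all add: C_def)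
  define y where "y n = pick (C n)" for n
  have compact_C: "compact (C n)" for n
  proof (induction n)
    case 0
    then show ?case using U(2) by (auto simp: C_0 C0_def intro!: compact_Un compact_bar)
  next
    case (Suc n)
    then show ?case unfolding C_Suc by (intro compact_Un compact_set_conv) auto
  qed
  have y: "y n \<in> A" "y n \<notin> C n" "y n \<in> C (Suc n)" for n
    using pick[OF compact_C] by (auto simp: y_def C_Suc)
  have bar_C: "bar x \<in> C n" if "x \<in> C n" for x n
    using that
  proof (induction n arbitrary: x)
    case 0
    then show ?case by (auto simp: C_0 C0_def bar_bar)
  next
    case (Suc n)
    have "bar ` C n \<subseteq> C n" using Suc.IH by blast
    then have sub: "(bar ` C n) \<odot> ((bar ` C n) \<odot> (bar ` C n)) \<subseteq> C (Suc n)"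
      unfolding C_Suc by (intro le_supI1 set_conv_mono)
    have "bar ` (C n \<odot> C n) \<subseteq> (bar ` C n) \<odot> (bar ` C n)" using bar_set_conv by blast
    then have "bar z \<in> C (Suc n)" if "z \<in> C n \<odot> (C n \<odot> C n)" for z
      using bar_set_conv[OF that] sub set_conv_mono[of "bar ` C n" "bar ` C n" "bar ` (C n \<odot> C n)"] by blast
    then show ?case using Suc.prems by (auto simp: C_Suc bar_bar)
  qed
  have e_C: "e \<in> C n" for n
  proof (induction n)
    case (Suc n)
    then show ?case using set_convI[OF Suc set_convI[OF Suc Suc, of e], of e] by (simp add: S_unit C_Suc)
  qed (use U in \<open>auto simp: C_0 C0_def\<close>)
  have C2: "C n \<odot> C n \<subseteq> C (Suc n)" for n
  proof
    fix z assume z: "z \<in> C n \<odot> C n"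
    have "z \<in> C n \<odot> (C n \<odot> C n)" by (rule set_convI[OF e_C z]) (simp add: S_unit)
    then show "z \<in> C (Suc n)" by (simp add: C_Suc)
  qed
  have C_step: "C n \<subseteq> C (Suc n)" for n
  proof
    fix z assume z: "z \<in> C n"
    have "z \<in> C n \<odot> C n" by (rule set_convI[OF e_C z]) (simp add: S_unit)
    then show "z \<in> C (Suc n)" using C2 by blast
  qed
  have C_mono: "C i \<subseteq> C j" if "i \<le> j" for i j
    by (rule lift_Suc_mono_le[of C, OF C_step that])
  have C_conv: "C i \<odot> C j \<subseteq> C (Suc l)" if "i \<le> l" "j \<le> l" for i j l
    using set_conv_mono[OF C_mono[OF that(1)] C_mono[OF that(2)]] C2 by blast
  define H where "H = (\<Union>n. C n)"
  have H_conv: "S a b \<subseteq> H" if ab: "a \<in> H" "b \<in> H" for a b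
  proof
    fix z assume z: "z \<in> S a b"
    obtain i j where "a \<in> C i" "b \<in> C j" using ab by (auto simp: H_def)
    then have "z \<in> C (Suc (max i j))" using C_conv[of i "max i j" j] z by (auto intro: set_convI)
    then show "z \<in> H" by (auto simp: H_def)
  qed
  have HH: "H \<odot> H \<subseteq> H" using H_conv by (auto elim!: set_convE)
  have H_bar: "bar a \<in> H" if "a \<in> H" for a using that bar_C by (auto simp: H_def)
  \<comment> \<open>\<open>R r\<close> is the coset of \<open>H\<close> through \<open>r\<close>.
    The facts below show that the cosets partition the space.\<close>
  define R where "R r = {r} \<odot> H" for r
  have R_iff: "z \<in> R r \<longleftrightarrow> (\<exists>n. z \<in> {r} \<odot> C n)" for z r
    by (auto simp: R_def H_def set_conv_def)
  have R_trans: "w \<in> R r" if "z \<in> R r" "w \<in> R z" for w z r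
  proof -
    have "w \<in> ({r} \<odot> H) \<odot> H" using that set_conv_mono[of "{z}" "{r} \<odot> H" H H] by (auto simp: R_def)
    also have "\<dots> = {r} \<odot> (H \<odot> H)" by (simp add: set_conv_assoc)
    also have "\<dots> \<subseteq> R r" unfolding R_def by (intro set_conv_mono HH) simp
    finally show ?thesis .
  qed
  have R_sym: "r \<in> R z" if z: "z \<in> R r" for r z
  proof -
    obtain h where h: "h \<in> H" "z \<in> S r h" using z by (auto simp: R_def elim: set_convE)
    then have "r \<in> S z (bar h)" using S_reverse by blast
    then show ?thesis using H_bar[OF h(1)] by (auto simp: R_def intro: set_convI)
  qed
  have R_refl: "z \<in> R z" for z
    using e_C[of 0] by (auto simp: R_def H_def S_unit intro!: set_convI[of _ _ e])
  have R_eq: "R z = R r" if "z \<in> R r" for z r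
    using that R_trans R_sym by blast
  \<comment> \<open>The choice depends on the set \<open>R z\<close> only, so all points of a coset
    receive the same representative.\<close>
  define rep where "rep z = (SOME r. r \<in> R z)" for z
  have rep_R: "rep z \<in> R z" for z unfolding rep_def using R_refl by (rule someI)
  have rep_cong: "rep z = rep r" if "z \<in> R r" for z r
    by (simp add: rep_def R_eq[OF that])
  have z_rep: "\<exists>n. z \<in> {rep z} \<odot> C n" for z
    using R_sym[OF rep_R] by (simp add: R_iff)
  have U_C: "U \<subseteq> C 0" using U(4) by (auto simp: C_0 C0_def)
  have nbhd: "\<exists>N. open N \<and> z \<in> N \<and> N \<subseteq> {r} \<odot> C (Suc n)" if z: "z \<in> {r} \<odot> C n" for z r n
  proof -
    obtain N where N: "open N" "z \<in> N" "N \<subseteq> {z} \<odot> U"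
      using open_convolution_neighbourhood[OF U(1,3)] by blast
    have "{z} \<odot> U \<subseteq> ({r} \<odot> C n) \<odot> C 0" using z U_C by (intro set_conv_mono) auto
    also have "\<dots> = {r} \<odot> (C n \<odot> C 0)" by (simp add: set_conv_assoc)
    also have "\<dots> \<subseteq> {r} \<odot> C (Suc n)" by (intro set_conv_mono C_conv) auto
    finally show ?thesis using N by blast
  qed
  \<comment> \<open>Each stage of a coset lies in the interior of the next one, which leaves room
    for a continuous transition from 1 to 0 between them.\<close>
  have "\<exists>u :: 'a \<Rightarrow> real. continuous_on UNIV u \<and> (\<forall>z. 0 \<le> u z \<and> u z \<le> 1) \<and> (\<forall>z\<in>{r} \<odot> C n. u z = 1) \<and>
      (\<forall>z. z \<notin> {r} \<odot> C (Suc n) \<longrightarrow> u z = 0)" for r n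
  proof -
    have "compact ({r} \<odot> C n)" by (intro compact_set_conv compact_C) simp
    moreover have "{r} \<odot> C n \<subseteq> interior ({r} \<odot> C (Suc n))"
      using nbhd[of _ r n] by (meson interiorI subsetI)
    ultimately obtain u :: "'a \<Rightarrow> real" and D where u: "continuous_on UNIV u" "\<And>z. 0 \<le> u z" "\<And>z. u z \<le> 1"
      "\<And>z. z \<in> {r} \<odot> C n \<Longrightarrow> u z = 1" "D \<subseteq> interior ({r} \<odot> C (Suc n))" "\<And>z. z \<notin> D \<Longrightarrow> u z = 0"
      by (rule compact_Urysohn[OF locally_compact _ open_interior]) blast
    then have "u z = 0" if "z \<notin> {r} \<odot> C (Suc n)" for z
      using interior_subset that by blast
    with u show ?thesis by blast
  qed
  then obtain u :: "'a \<Rightarrow> nat \<Rightarrow> 'a \<Rightarrow> real" where u: "\<And>r n. continuous_on UNIV (u r n)"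
    "\<And>r n z. 0 \<le> u r n z" "\<And>r n z. u r n z \<le> 1" "\<And>r n z. z \<in> {r} \<odot> C n \<Longrightarrow> u r n z = 1"
    "\<And>r n z. z \<notin> {r} \<odot> C (Suc n) \<Longrightarrow> u r n z = 0"
    by metis
  define l where "l z = (LEAST n. z \<in> {rep z} \<odot> C n)" for z
  have l: "z \<in> {rep z} \<odot> C (l z)" for z unfolding l_def using z_rep by (rule LeastI_ex)
  have l_le: "l z \<le> n" if "z \<in> {rep z} \<odot> C n" for z n
    unfolding l_def using that by (rule Least_le)
  \<comment> \<open>The summand is 1 while \<open>z\<close> is outside stage \<open>n + 1\<close>
    and 0 once \<open>z\<close> is in stage \<open>n\<close>. So only the last summand can be
    strictly between 0 and 1, and extending the sum beyond \<open>l z\<close> changes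
    nothing.\<close>
  define L where "L z = (\<Sum>n<l z. 1 - u (rep z) n z)" for z
  have L_eq: "L z = (\<Sum>n<k. 1 - u (rep z) n z)" if k: "l z \<le> k" for z k
    unfolding L_def
  proof (rule sum.mono_neutral_left)
    show "\<forall>i\<in>{..<k} - {..<l z}. 1 - u (rep z) i z = 0"
    proof
      fix i assume "i \<in> {..<k} - {..<l z}"
      then have "z \<in> {rep z} \<odot> C i"
        using l[of z] set_conv_mono[OF order_refl C_mono[of "l z" i], of "{rep z}"] by auto
      then show "1 - u (rep z) i z = 0" using u(4) by simp
    qed
  qed (use k in auto)
  have L_upper: "L z \<le> real n" if "z \<in> {rep z} \<odot> C n" for z n
  proof -
    have "L z \<le> (\<Sum>i<n. 1)"
      unfolding L_eq[OF l_le[OF that]] using u(2) by (intro sum_mono) simp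
    then show ?thesis by simp
  qed
  have L_lower: "real n \<le> L z" if nz: "z \<notin> {rep z} \<odot> C n" for z n
  proof -
    have "1 - u (rep z) i z = 1" if "i < n" for i
    proof -
      have "z \<notin> {rep z} \<odot> C (Suc i)"
        using nz set_conv_mono[OF order_refl C_mono[of "Suc i" n], of "{rep z}"] that by auto
      then show ?thesis using u(5) by simp
    qed
    then have "real n = (\<Sum>i<n. 1 - u (rep z) i z)" by simp
    also have "\<dots> \<le> (\<Sum>i<max n (l z). 1 - u (rep z) i z)"
      using u(3) by (intro sum_mono2) auto
    also have "\<dots> = L z" by (rule L_eq[symmetric]) simp
    finally show ?thesis .
  qed
  have L_cont: "continuous_on UNIV L"
  proof (rule continuous_at_imp_continuous_on, rule ballI)
    fix z0
    define r where "r = rep z0"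
    obtain N where N: "open N" "z0 \<in> N" "N \<subseteq> {r} \<odot> C (Suc (l z0))"
      using nbhd[OF l[of z0]] unfolding r_def by blast
    \<comment> \<open>Near \<open>z0\<close> the representative stays the same and the level exceeds
      \<open>l z0\<close> by at most 1, so \<open>L\<close> is locally one fixed finite sum of
      continuous functions, although \<open>l\<close> may jump.\<close>
    have "L z = (\<Sum>n<Suc (l z0). 1 - u r n z)" if "z \<in> N" for z
    proof -
      have zr: "z \<in> {r} \<odot> C (Suc (l z0))" using N(3) that by blast
      then have "z \<in> R r" by (auto simp: R_iff)
      moreover have "r \<in> R z0" unfolding r_def by (rule rep_R)
      ultimately have "rep z = r" using rep_cong R_trans unfolding r_def by metis
      then show ?thesis using L_eq[OF l_le[of z "Suc (l z0)"]] zr by simp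
    qed
    then have "\<forall>\<^sub>F z in nhds z0. L z = (\<Sum>n<Suc (l z0). 1 - u r n z)"
      using eventually_nhds_in_open[OF N(1,2)] by (rule eventually_mono[rotated])
    moreover have "isCont (\<lambda>z. \<Sum>n<Suc (l z0). 1 - u r n z) z0"
    proof -
      have "continuous_on UNIV (\<lambda>z. \<Sum>n<Suc (l z0). 1 - u r n z)" by (intro continuous_intros u)
      then show ?thesis using continuous_on_eq_continuous_at[OF open_UNIV] by blast
    qed
    ultimately show "isCont L z0" by (subst isCont_cong)
  qed
  have "\<forall>\<^sub>F n in sequentially. \<forall>t\<in>U. \<forall>s\<in>S x t. \<forall>w\<in>S (y n) s. \<bar>L w - real n\<bar> \<le> 2" for x
  proof -
    define r where "r = rep x"
    define k where "k = l x"
    have xr: "x \<in> {r} \<odot> C k" unfolding r_def k_def by (rule l)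
    \<comment> \<open>The product of \<open>r\<close> with its conjugate may leave \<open>H\<close>.
      Its part inside \<open>H\<close> lies in a single stage \<open>C p\<close>: finitely many sets
      \<open>N q\<close> cover the compact set \<open>S r (bar r)\<close>, and a \<open>q\<close>
      whose \<open>N q\<close> contains a point of \<open>H\<close> is itself in
      \<open>H\<close>.\<close>
    have "\<exists>N. open N \<and> q \<in> N \<and> N \<subseteq> {q} \<odot> U" for q
      by (rule open_convolution_neighbourhood[OF U(1,3)])
    then obtain N where N: "\<And>q. open (N q) \<and> q \<in> N q \<and> N q \<subseteq> {q} \<odot> U" by metis
    have "S r (bar r) \<subseteq> (\<Union>q\<in>S r (bar r). N q)" using N by blast
    from compactE_image[OF compact_support _ this] N obtain I where
      I: "finite I" "S r (bar r) \<subseteq> (\<Union>q\<in>I. N q)"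
      by metis
    define lev where "lev q = (LEAST n. q \<in> C n)" for q
    have lev: "q \<in> C (lev q)" if "q \<in> H" for q
      unfolding lev_def by (rule LeastI_ex) (use that in \<open>auto simp: H_def\<close>)
    define p where "p = Suc (\<Sum>q\<in>I. lev q)"
    have Hp: "v \<in> C p" if v: "v \<in> S r (bar r)" "v \<in> H" for v
    proof -
      obtain q where q: "q \<in> I" "v \<in> N q" using I(2) v(1) by blast
      then obtain c where c: "c \<in> U" "v \<in> S q c" using N[of q] by (auto elim: set_convE)
      then have "c \<in> C 0" using U_C by blast
      then have "bar c \<in> H" using bar_C by (auto simp: H_def)
      then have "q \<in> H" using S_reverse[OF c(2)] H_conv[OF v(2)] by blast
      then have "v \<in> C (lev q) \<odot> C 0" using lev c \<open>c \<in> C 0\<close> by (auto intro: set_convI)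
      moreover have "lev q \<le> (\<Sum>q\<in>I. lev q)" using q(1) I(1) by (intro member_le_sum) auto
      ultimately show ?thesis using C_conv[of "lev q" "\<Sum>q\<in>I. lev q" 0] by (auto simp: p_def)
    qed
    \<comment> \<open>Beyond this threshold \<open>C (Suc k) \<subseteq> C (n - 2)\<close> and
      \<open>C p \<subseteq> C (n - 1)\<close>, so a product with either of them costs one
      stage.\<close>
    have "\<bar>L w - real n\<bar> \<le> 2" if n: "n \<ge> p + k + 4" and t: "t \<in> U" and s: "s \<in> S x t" and w: "w \<in> S (y n) s"
      for n t s w
    proof -
      have tC: "t \<in> C 0" using t U_C by blast
      have "s \<in> ({r} \<odot> C k) \<odot> C 0" using s xr tC by (rule_tac set_convI)
      also have "\<dots> = {r} \<odot> (C k \<odot> C 0)" by (simp add: set_conv_assoc)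
      also have "\<dots> \<subseteq> {r} \<odot> C (Suc k)" by (intro set_conv_mono C_conv) auto
      finally have sr: "s \<in> {r} \<odot> C (Suc k)" .
      have "w \<in> S s (y n)" using w by (simp add: S_commute)
      then have "w \<in> ({r} \<odot> C (Suc k)) \<odot> C (Suc n)" using sr y(3) by (rule_tac set_convI)
      also have "\<dots> = {r} \<odot> (C (Suc k) \<odot> C (Suc n))" by (simp add: set_conv_assoc)
      also have "\<dots> \<subseteq> {r} \<odot> C (Suc (Suc n))" using n by (intro set_conv_mono C_conv) auto
      finally have wr: "w \<in> {r} \<odot> C (n + 2)" by simp
      then have "w \<in> R r" by (auto simp: R_iff)
      then have "w \<in> R x" using R_trans rep_R unfolding r_def by blast
      then have rep_w: "rep w = r" using rep_cong by (simp add: r_def)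
      have upper: "L w \<le> real (n + 2)" using L_upper[of w "n + 2"] wr by (simp add: rep_w)
      \<comment> \<open>Otherwise reversing \<open>w \<in> S (y n) s\<close> and regrouping the four
        factors puts \<open>y n\<close> into \<open>S v q\<close> with
        \<open>v \<in> S r (bar r)\<close> and \<open>q \<in> C (n - 1)\<close>. As
        \<open>y n\<close> and \<open>q\<close> lie in \<open>H\<close>, so does \<open>v\<close>;
        hence \<open>v \<in> C p\<close>, and \<open>y n\<close> would already lie in
        \<open>C n\<close>.\<close>
      have "w \<notin> {r} \<odot> C (n - 2)"
      proof
        assume "w \<in> {r} \<odot> C (n - 2)"
        then obtain a where a: "a \<in> C (n - 2)" "w \<in> S r a" by (auto elim: set_convE)
        obtain b where b: "b \<in> C (Suc k)" "s \<in> S r b" using sr by (auto elim: set_convE)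
        have "y n \<in> S w (bar s)" by (rule S_reverse[OF w])
        moreover have "bar s \<in> S (bar r) (bar b)" using b(2) by (simp add: S_bar)
        ultimately have "y n \<in> S r a \<odot> S (bar r) (bar b)" using a(2) by (rule_tac set_convI)
        also have "S r a \<odot> S (bar r) (bar b) = S r (bar r) \<odot> S a (bar b)"
          unfolding set_conv_singletons[symmetric]
          by (metis set_conv_assoc set_conv_left_commute)
        finally obtain v q where vq: "v \<in> S r (bar r)" "q \<in> S a (bar b)" "y n \<in> S v q"
          by (rule set_convE)
        have "bar b \<in> C (Suc k)" by (rule bar_C[OF b(1)])
        then have "q \<in> C (n - 2) \<odot> C (Suc k)" using a(1) vq(2) by (rule_tac set_convI)
        also have "\<dots> \<subseteq> C (Suc (n - 2))" using n by (intro C_conv) auto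
        finally have q: "q \<in> C (n - 1)" using n by (simp add: Suc_diff_Suc numeral_2_eq_2)
        have "v \<in> S (y n) (bar q)" by (rule S_reverse[OF vq(3)])
        moreover have "y n \<in> H" "bar q \<in> H" using y(3) bar_C[OF q] by (auto simp: H_def)
        ultimately have "v \<in> H" using H_conv by blast
        then have "v \<in> C p" using Hp vq(1) by blast
        moreover have "p \<le> n - 1" using n by linarith
        ultimately have "v \<in> C (n - 1)" using C_mono by blast
        then have "y n \<in> C (n - 1) \<odot> C (n - 1)" using q vq(3) by (rule_tac set_convI)
        then have "y n \<in> C (Suc (n - 1))" using C2 by blast
        then show False using y(2)[of n] n by simp
      qed
      then have "real (n - 2) \<le> L w" using L_lower[of w "n - 2"] by (simp add: rep_w)
      then show ?thesis using upper n by (simp add: of_nat_diff abs_le_iff)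
    qed
    then show ?thesis unfolding eventually_sequentially by blast
  qed
  with U(1,3) y(1) L_cont show ?thesis by blast
qed

end

section \<open>Uniqueness forces vanishing at infinity\<close>

context haar_hypergroup
begin

lemma unique_mean_vanishing:
  assumes \<alpha>: "\<alpha> \<in> dual_space \<omega> bar" and M: "alpha_mean \<omega> \<alpha> M"
    and unique: "\<And>M'. alpha_mean \<omega> \<alpha> M' \<Longrightarrow> \<forall>f\<in>UC \<omega>. M' f = M f"
    and \<epsilon>: "\<epsilon> > 0"
  shows "compact {x. \<epsilon> \<le> cmod (\<alpha> x)}"
proof (rule ccontr)
  let ?A = "{x. \<epsilon> \<le> cmod (\<alpha> x)}"
  assume nc: "\<not> compact ?A"
  note ac = bcontfun_continuous[OF dual_bcontfun[OF \<alpha>]]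
  have "closed ?A" using ac by (intro closed_Collect_le continuous_intros)
  then have "\<exists>y\<in>?A. y \<notin> D" if "compact D" for D
    using nc that compact_Int_closed[of D ?A] by (metis inf.absorb_iff2 subsetI)
  from slowly_growing_function[OF this] obtain U y and L :: "'a \<Rightarrow> real" where
    U: "open U" "e \<in> U" and y: "\<And>n. \<epsilon> \<le> cmod (\<alpha> (y n))" and L: "continuous_on UNIV L"
    and Ly: "\<And>x. \<forall>\<^sub>F n in sequentially. \<forall>t\<in>U. \<forall>s\<in>S x t. \<forall>w\<in>S (y n) s. \<bar>L w - real n\<bar> \<le> 2"
    by blast
  define \<psi> where "\<psi> t = max 0 (min 1 (1 / 2 + cos (pi * t / 8)))" for t :: real
  define \<phi> where "\<phi> x = complex_of_real (\<psi> (L x)) * \<alpha> x" for x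
  have \<phi>c: "continuous_on UNIV \<phi>"
    unfolding \<phi>_def \<psi>_def using L ac by (intro continuous_intros) auto
  have \<phi>: "\<phi> \<in> bcontfun"
  proof (rule bcontfunI_complex[OF \<phi>c])
    fix x
    have "\<bar>\<psi> (L x)\<bar> * cmod (\<alpha> x) \<le> 1 * 1"
      by (intro mult_mono dual_bound[OF \<alpha>]) (auto simp: \<psi>_def)
    then show "cmod (\<phi> x) \<le> 1" by (simp add: \<phi>_def norm_mult)
  qed
  \<comment> \<open>On \<open>V\<close> the character is within 1/2 of 1, so its average
    \<open>c\<close> against the density \<open>k\<close> is within 1/2 of 1 and cannot be
    0.\<close>
  define V where "V = U \<inter> {x. cmod (\<alpha> x - 1) < 1 / 2}"
  have V: "open V" "e \<in> V"
    unfolding V_def using U ac dual_unit[OF \<alpha>]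
    by (auto intro!: open_Int open_Collect_less continuous_intros)
  obtain k :: "'a \<Rightarrow> real" where k: "\<And>x. k x \<ge> 0" "\<And>x. x \<notin> V \<Longrightarrow> k x = 0"
    "(\<lambda>x. complex_of_real (k x)) \<in> CC" "(\<integral>x. k x \<partial>m) = 1"
    using approximate_unit[OF V] by metis
  define h where "h x = complex_of_real (k x)" for x
  have h: "h \<in> CC" unfolding h_def by (rule k(3))
  define c where "c = (\<integral>x. h x * \<alpha> x \<partial>m)"
  have "cmod ((\<integral>x. h x * \<alpha> x \<partial>m) - (\<integral>x. h x * 1 \<partial>m)) \<le> 1 / 2 * (\<integral>x. cmod (h x) \<partial>m)"
    by (rule compact_weight_integral_bound[OF compact_weight_haar[OF h] ac, where C = V])
      (use k(2) in \<open>auto simp: h_def V_def\<close>)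
  also have "(\<integral>x. cmod (h x) \<partial>m) = 1" using k by (simp add: h_def)
  finally have "cmod (c - 1) \<le> 1 / 2" using k(4) by (simp add: c_def h_def)
  then have c: "c \<noteq> 0" by auto
  define f where "f z = (\<integral>t. h t * T z \<phi> t \<partial>m)" for z
  have f: "f \<in> UC \<omega>" unfolding f_def by (rule conv_UC[OF h \<phi>])
  \<comment> \<open>Wherever the weight \<open>h\<close> is nonzero, the triple product of
    \<open>y n\<close>, \<open>x\<close> and \<open>t\<close> stays in a region on which the
    oscillating factor has the constant value \<open>b\<close>. There \<phi> is \<open>b\<close>
    times the character, and multiplicativity evaluates everything.\<close>
  have Tf: "T x f (y n) = complex_of_real b * (\<alpha> (y n) * \<alpha> x * c)"
    if b: "\<forall>t\<in>U. \<forall>s\<in>S x t. \<forall>w\<in>S (y n) s. \<psi> (L w) = b" for x n b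
  proof -
    have "T x f (y n) = (\<integral>t. h t * T x (T (y n) \<phi>) t \<partial>m)"
      unfolding f_def by (rule conv_translate[OF h \<phi>])
    also have "\<dots> = (\<integral>t. complex_of_real b * (\<alpha> (y n) * \<alpha> x) * (h t * \<alpha> t) \<partial>m)"
    proof (rule Bochner_Integration.integral_cong[OF refl])
      fix t
      show "h t * T x (T (y n) \<phi>) t = complex_of_real b * (\<alpha> (y n) * \<alpha> x) * (h t * \<alpha> t)"
      proof (cases "t \<in> U")
        case True
        have "T x (T (y n) \<phi>) t = T x (\<lambda>s. complex_of_real b * (\<alpha> (y n) * \<alpha> s)) t"
        proof (rule translate_cong)
          show "continuous_on UNIV (T (y n) \<phi>)" by (rule bcontfun_continuous[OF translate_bcontfun[OF \<phi>]])
          show "continuous_on UNIV (\<lambda>s. complex_of_real b * (\<alpha> (y n) * \<alpha> s))"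
            using ac by (intro continuous_intros)
          fix s assume s: "s \<in> S x t"
          have "T (y n) \<phi> s = T (y n) (\<lambda>w. complex_of_real b * \<alpha> w) s"
          proof (rule translate_cong[OF \<phi>c])
            show "continuous_on UNIV (\<lambda>w. complex_of_real b * \<alpha> w)" using ac by (intro continuous_intros)
            show "\<phi> w = complex_of_real b * \<alpha> w" if "w \<in> S (y n) s" for w
              using b True s that by (simp add: \<phi>_def)
          qed
          then show "T (y n) \<phi> s = complex_of_real b * (\<alpha> (y n) * \<alpha> s)"
            by (simp add: translate_mult dual_translate[OF \<alpha>])
        qed
        also have "\<dots> = complex_of_real b * (\<alpha> (y n) * (\<alpha> x * \<alpha> t))"
          by (simp add: translate_mult dual_translate[OF \<alpha>])
        finally show ?thesis by (simp add: mult_ac)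
      next
        case False
        then have "h t = 0" using k(2) by (simp add: h_def V_def)
        then show ?thesis by simp
      qed
    qed
    also have "\<dots> = complex_of_real b * (\<alpha> (y n) * \<alpha> x) * c" by (simp add: c_def)
    finally show ?thesis by (simp add: mult_ac)
  qed
  \<comment> \<open>The right side does not depend on \<sigma> or \<open>b\<close>, so two
    subsequences with different plateau values contradict each other.\<close>
  have lim: "complex_of_real b * c = M f"
    if \<sigma>: "filterlim \<sigma> sequentially sequentially"
      and b: "\<And>i t. \<bar>t - real (\<sigma> i)\<bar> \<le> 2 \<Longrightarrow> \<psi> t = b" for b and \<sigma> :: "nat \<Rightarrow> nat"
  proof -
    have ne: "\<alpha> (y n) \<noteq> 0" for n using y[of n] \<epsilon> by auto
    have bound: "cmod (inverse (\<alpha> (y (\<sigma> i)))) \<le> inverse \<epsilon>" for i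
      using y[of "\<sigma> i"] \<epsilon> by (simp add: norm_inverse le_imp_inverse_le)
    obtain n where n: "bounded_functional_UC \<omega> n"
      "\<And>f l. f \<in> UC \<omega> \<Longrightarrow> \<forall>\<^sub>F i in sequentially. inverse (\<alpha> (y (\<sigma> i))) * f (y (\<sigma> i)) = l \<Longrightarrow> n f = l"
      by (rule cluster_functional[where c = "\<lambda>i. inverse (\<alpha> (y (\<sigma> i)))" and y = "\<lambda>i. y (\<sigma> i)", OF bound]) blast
    have "n \<alpha> = 1" by (rule n(2)[OF dual_UC[OF \<alpha>]]) (simp add: ne)
    then have "alpha_mean \<omega> \<alpha> (\<lambda>f. M (\<lambda>x. n (T x f)))" by (rule alpha_mean_compose[OF \<alpha> M n(1)])
    then have "M (\<lambda>x. n (T x f)) = M f" using unique f by blast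
    moreover have "n (T x f) = complex_of_real b * c * \<alpha> x" for x
    proof (rule n(2)[OF UC_translate[OF f]])
      have "\<forall>\<^sub>F i in sequentially. \<forall>t\<in>U. \<forall>s\<in>S x t. \<forall>w\<in>S (y (\<sigma> i)) s. \<bar>L w - real (\<sigma> i)\<bar> \<le> 2"
        using eventually_compose_filterlim[OF Ly \<sigma>] .
      then show "\<forall>\<^sub>F i in sequentially. inverse (\<alpha> (y (\<sigma> i))) * T x f (y (\<sigma> i)) = complex_of_real b * c * \<alpha> x"
      proof eventually_elim
        case (elim i)
        then have "\<forall>t\<in>U. \<forall>s\<in>S x t. \<forall>w\<in>S (y (\<sigma> i)) s. \<psi> (L w) = b" using b by blast
        from Tf[OF this] show ?case by (simp add: ne)
      qed
    qed
    moreover have "M (\<lambda>x. complex_of_real b * c * \<alpha> x) = complex_of_real b * c"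
      using M functional_mult[OF _ dual_UC[OF \<alpha>], of M "complex_of_real b * c"] by (simp add: alpha_mean_def)
    ultimately show ?thesis by simp
  qed
  \<comment> \<open>With \<open>j = 0\<close> the indices are even multiples of 8, where the plateau
    value is 1; with \<open>j = 1\<close> they are odd multiples, where it is 0.\<close>
  have tends: "filterlim (\<lambda>i. 8 * (2 * i + j)) sequentially sequentially" for j :: nat
    by (rule filterlim_subseq) (simp add: strict_mono_def)
  have \<psi>: "\<psi> t = (if even (2 * i + j) then 1 else 0)" if "\<bar>t - real (8 * (2 * i + j))\<bar> \<le> 2" for t i j
    unfolding \<psi>_def by (rule two_valued_on_bands[OF that])
  have "complex_of_real 1 * c = M f"
    by (rule lim[OF tends[of 0]]) (drule \<psi>, simp)
  moreover have "complex_of_real 0 * c = M f"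
    by (rule lim[OF tends[of 1]]) (drule \<psi>, simp)
  ultimately show False using c by simp
qed

end

section \<open>Characters vanishing at infinity\<close>

text \<open>Multiplying a function vanishing at infinity by the cutoff of its modulus gives compact
  support, since the cutoff is 0 up to \<delta>, at the cost of a uniform error of at most
  \<open>2 * \<delta>\<close>. For fixed \<open>a > 0\<close> it tends to 1 as \<delta> tends to
  0.\<close>

definition cutoff :: "real \<Rightarrow> real \<Rightarrow> real" where
  "cutoff \<delta> a = max 0 (a - \<delta>) / (a + \<delta>)"

lemma cutoff_bounds: "\<delta> > 0 \<Longrightarrow> a \<ge> 0 \<Longrightarrow> 0 \<le> cutoff \<delta> a" "\<delta> > 0 \<Longrightarrow> a \<ge> 0 \<Longrightarrow> cutoff \<delta> a \<le> 1"
  by (auto simp: cutoff_def divide_simps)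

lemma cutoff_eq_0: "a \<le> \<delta> \<Longrightarrow> cutoff \<delta> a = 0"
  by (simp add: cutoff_def)

lemma cutoff_close:
  assumes "\<delta> > 0" "a \<ge> 0" shows "a * (1 - cutoff \<delta> a) \<le> 2 * \<delta>"
proof (cases "a \<le> \<delta>")
  case True
  then show ?thesis using assms by (simp add: cutoff_eq_0)
next
  case False
  then have "1 - cutoff \<delta> a = 2 * \<delta> / (a + \<delta>)"
    using assms by (simp add: cutoff_def field_simps)
  then have "a * (1 - cutoff \<delta> a) = 2 * \<delta> * (a / (a + \<delta>))" by simp
  also have "\<dots> \<le> 2 * \<delta> * 1"
    using assms by (intro mult_left_mono) auto
  finally show ?thesis by simp
qed

lemma continuous_on_cutoff [continuous_intros]:
  assumes "\<delta> > 0" "continuous_on A f" "\<And>x. x \<in> A \<Longrightarrow> f x \<ge> 0"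
  shows "continuous_on A (\<lambda>x. cutoff \<delta> (f x))"
proof -
  have "f x + \<delta> \<noteq> 0" if "x \<in> A" for x
    using assms(1) assms(3)[OF that] by linarith
  then show ?thesis
    unfolding cutoff_def by (intro continuous_intros assms(2)) blast
qed

lemma cutoff_tendsto:
  assumes "a \<ge> 0"
  shows "(\<lambda>n. a * cutoff (inverse (real (Suc n))) a) \<longlonglongrightarrow> a"
    "(\<lambda>n. a * a * cutoff (inverse (real (Suc n))) a / (a + inverse (real (Suc n)))) \<longlonglongrightarrow> a"
proof -
  consider "a = 0" | "a > 0" using assms by fastforce
  then have "(\<lambda>n. a * cutoff (inverse (real (Suc n))) a) \<longlonglongrightarrow> a \<and>
    (\<lambda>n. a * a * cutoff (inverse (real (Suc n))) a / (a + inverse (real (Suc n)))) \<longlonglongrightarrow> a"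
  proof cases
    case 2
    have "(\<lambda>n. a * cutoff (inverse (real (Suc n))) a) \<longlonglongrightarrow> a * (max 0 (a - 0) / (a + 0))"
      "(\<lambda>n. a * a * cutoff (inverse (real (Suc n))) a / (a + inverse (real (Suc n))))
        \<longlonglongrightarrow> a * a * (max 0 (a - 0) / (a + 0)) / (a + 0)"
      unfolding cutoff_def using 2
      by (intro tendsto_intros LIMSEQ_inverse_real_of_nat; simp)+
    then show ?thesis using 2 by simp
  qed simp
  then show "(\<lambda>n. a * cutoff (inverse (real (Suc n))) a) \<longlonglongrightarrow> a"
    "(\<lambda>n. a * a * cutoff (inverse (real (Suc n))) a / (a + inverse (real (Suc n)))) \<longlonglongrightarrow> a"
    by auto
qed

text \<open>This is Fatou's lemma for a pointwise convergent sequence with a common bound on the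
  integrals.\<close>

lemma nn_integral_limit_le:
  assumes "\<And>n. u n \<in> borel_measurable M" "\<And>x. (\<lambda>n. u n x) \<longlonglongrightarrow> v x"
    and "\<And>n. (\<integral>\<^sup>+x. ennreal (u n x) \<partial>M) \<le> C"
  shows "(\<integral>\<^sup>+x. ennreal (v x) \<partial>M) \<le> C"
proof -
  have "(\<integral>\<^sup>+x. ennreal (v x) \<partial>M) = (\<integral>\<^sup>+x. liminf (\<lambda>n. ennreal (u n x)) \<partial>M)"
    using assms(2) by (intro nn_integral_cong lim_imp_Liminf[symmetric]) (auto intro: tendsto_ennrealI)
  also have "\<dots> \<le> liminf (\<lambda>n. \<integral>\<^sup>+x. ennreal (u n x) \<partial>M)"
    using assms(1) by (intro nn_integral_liminf) auto
  also have "\<dots> \<le> liminf (\<lambda>n. C)"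
    by (intro Liminf_mono always_eventually allI assms(3))
  also have "\<dots> = C" by (rule Liminf_const) simp
  finally show ?thesis .
qed

context haar_hypergroup
begin

context
  fixes \<alpha> :: "'a \<Rightarrow> complex"
  assumes dual: "\<alpha> \<in> dual_space \<omega> bar"
    and vanishing: "\<And>\<epsilon>. \<epsilon> > 0 \<Longrightarrow> compact {x. \<epsilon> \<le> cmod (\<alpha> x)}"
begin

lemma dual_continuous: "continuous_on UNIV \<alpha>"
  by (rule bcontfun_continuous[OF dual_bcontfun[OF dual]])

lemma cutoff_CC:
  assumes "\<delta> > 0" "continuous_on UNIV v"
  shows "(\<lambda>x. complex_of_real (cutoff \<delta> (cmod (\<alpha> x))) * v x) \<in> CC"
proof (rule CC_I)
  show "continuous_on UNIV (\<lambda>x. complex_of_real (cutoff \<delta> (cmod (\<alpha> x))) * v x)"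
    using assms dual_continuous by (intro continuous_intros) auto
  show "compact {x. \<delta> \<le> cmod (\<alpha> x)}" by (rule vanishing[OF assms(1)])
qed (simp add: cutoff_eq_0)

lemma mean_integrable:
  assumes M: "alpha_mean \<omega> \<alpha> M"
  shows "integrable m \<alpha>"
proof -
  have M': "bounded_functional_UC \<omega> M" "M \<alpha> = 1" "\<And>f x. f \<in> UC \<omega> \<Longrightarrow> M (T x f) = \<alpha> x * M f"
    using M by (auto simp: alpha_mean_def)
  obtain B where B: "B \<ge> 0" "\<And>f A. f \<in> UC \<omega> \<Longrightarrow> (\<And>x. cmod (f x) \<le> A) \<Longrightarrow> cmod (M f) \<le> B * A"
    using bounded_functional_UC_bound[OF M'(1)] by blast
  \<comment> \<open>The uniform error \<open>2 * \<delta>\<close> changes the value of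
    \<open>M\<close> by at most \<open>B / (B + 1)\<close>, which is less than
    \<open>M \<alpha> = 1\<close>.\<close>
  define \<delta> where "\<delta> = 1 / (2 * (B + 1))"
  have \<delta>: "\<delta> > 0" using B(1) by (simp add: \<delta>_def)
  define \<phi> where "\<phi> x = complex_of_real (cutoff \<delta> (cmod (\<alpha> x))) * \<alpha> x" for x
  have \<phi>: "\<phi> \<in> CC" unfolding \<phi>_def by (rule cutoff_CC[OF \<delta> dual_continuous])
  have "cmod (M (\<lambda>x. \<alpha> x - \<phi> x)) \<le> B * (2 * \<delta>)"
  proof (intro B(2) UC_diff dual_UC[OF dual] CC_UC[OF \<phi>])
    fix x
    have "\<alpha> x - \<phi> x = complex_of_real (1 - cutoff \<delta> (cmod (\<alpha> x))) * \<alpha> x"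
      by (simp add: \<phi>_def algebra_simps)
    also have "cmod \<dots> = cmod (\<alpha> x) * (1 - cutoff \<delta> (cmod (\<alpha> x)))"
      using cutoff_bounds(2)[OF \<delta>, of "cmod (\<alpha> x)"] by (simp add: norm_mult del: of_real_diff)
    also have "\<dots> \<le> 2 * \<delta>" by (rule cutoff_close[OF \<delta>]) simp
    finally show "cmod (\<alpha> x - \<phi> x) \<le> 2 * \<delta>" .
  qed
  also have "B * (2 * \<delta>) < 1" using B(1) by (simp add: \<delta>_def field_simps)
  also have "M (\<lambda>x. \<alpha> x - \<phi> x) = 1 - M \<phi>"
    by (simp add: functional_diff[OF M'(1) dual_UC[OF dual] CC_UC[OF \<phi>]] M'(2))
  finally have M\<phi>: "M \<phi> \<noteq> 0" by auto
  define P where "P = (\<integral>x. cmod (\<phi> x) \<partial>m)"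
  have P: "P \<ge> 0" by (simp add: P_def)
  \<comment> \<open>This is the product of \<alpha> with the function \<open>g\<close> below, a
    compactly supported version of the conjugate phase of \<alpha>. Adding
    \<open>inverse (real (Suc n))\<close> to the denominator avoids dividing by 0 and keeps
    \<open>cmod (g x) \<le> 1\<close>.\<close>
  define u where "u n x = cmod (\<alpha> x) * cmod (\<alpha> x) * cutoff (inverse (real (Suc n))) (cmod (\<alpha> x)) /
     (cmod (\<alpha> x) + inverse (real (Suc n)))" for n x
  have u0: "u n x \<ge> 0" for n x unfolding u_def by (intro divide_nonneg_nonneg mult_nonneg_nonneg cutoff_bounds) auto
  have bound: "(\<integral>\<^sup>+x. ennreal (u n x) \<partial>m) \<le> ennreal (B * P / cmod (M \<phi>))" for n
  proof -
    define d where "d = inverse (real (Suc n))"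
    have d: "d > 0" by (simp add: d_def)
    have ne: "complex_of_real (cmod (\<alpha> x) + d) \<noteq> 0" for x
      using d norm_ge_zero[of "\<alpha> x"] by (metis add_nonneg_pos less_irrefl of_real_eq_0_iff)
    define g where "g x = complex_of_real (cutoff d (cmod (\<alpha> x))) * (cnj (\<alpha> x) / complex_of_real (cmod (\<alpha> x) + d))" for x
    have g: "g \<in> CC"
      unfolding g_def using ne dual_continuous by (intro cutoff_CC[OF d] continuous_intros) auto
    have g1: "cmod (g x) \<le> 1" for x
    proof -
      have "cmod (g x) = cutoff d (cmod (\<alpha> x)) * (cmod (\<alpha> x) / (cmod (\<alpha> x) + d))"
        using cutoff_bounds(1)[OF d, of "cmod (\<alpha> x)"] d
        by (simp add: g_def norm_mult norm_divide del: of_real_add)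
      also have "\<dots> \<le> 1 * 1"
        using d by (intro mult_mono cutoff_bounds) (auto simp: divide_simps add_nonneg_pos)
      finally show ?thesis by simp
    qed
    have g\<alpha>: "g x * \<alpha> x = complex_of_real (u n x)" for x
    proof -
      have sq: "\<alpha> x * cnj (\<alpha> x) = complex_of_real (cmod (\<alpha> x)) * complex_of_real (cmod (\<alpha> x))"
        by (simp only: complex_norm_square[symmetric] power2_eq_square of_real_mult)
      have "g x * \<alpha> x = complex_of_real (cutoff d (cmod (\<alpha> x))) * (\<alpha> x * cnj (\<alpha> x)) /
          complex_of_real (cmod (\<alpha> x) + d)"
        by (simp add: g_def mult_ac)
      also have "\<dots> = complex_of_real (cutoff d (cmod (\<alpha> x)) * (cmod (\<alpha> x) * cmod (\<alpha> x)) / (cmod (\<alpha> x) + d))"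
        unfolding sq by (simp only: of_real_mult of_real_divide)
      also have "cutoff d (cmod (\<alpha> x)) * (cmod (\<alpha> x) * cmod (\<alpha> x)) / (cmod (\<alpha> x) + d) = u n x"
        by (simp add: u_def d_def mult_ac)
      finally show ?thesis .
    qed
    have gint: "integrable m (\<lambda>x. g x * \<alpha> x)"
      by (rule compact_weight_integrable[OF compact_weight_haar[OF g] dual_continuous])
    then have uint: "integrable m (u n)"
      unfolding g\<alpha> using complex_of_real_integrable_eq by blast
    define F where "F y = (\<integral>t. g t * T y \<phi> t \<partial>m)" for y
    have F: "F \<in> UC \<omega>" unfolding F_def by (rule conv_UC[OF g CC_bcontfun[OF \<phi>]])
    have "M F = (\<integral>t. g t * M (T t \<phi>) \<partial>m)"
      by (rule functional_integral[OF M'(1) CC_UC[OF \<phi>] compact_weight_haar[OF g] F])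
        (simp add: F_def translate_commute)
    also have "\<dots> = (\<integral>t. g t * \<alpha> t * M \<phi> \<partial>m)"
      by (simp add: M'(3)[OF CC_UC[OF \<phi>]] mult.assoc)
    also have "\<dots> = complex_of_real (\<integral>x. u n x \<partial>m) * M \<phi>"
      by (simp add: g\<alpha>)
    finally have "cmod (M F) = (\<integral>x. u n x \<partial>m) * cmod (M \<phi>)"
      using u0 by (simp add: norm_mult integral_nonneg)
    \<comment> \<open>As \<open>cmod (g x) \<le> 1\<close>, invariance bounds \<open>F\<close> by
      the integral of \<open>cmod (\<phi> x)\<close>, however large the support of \<open>g\<close>
      is. Hence the bound on the integral of \<open>u n\<close> is independent of
      \<open>n\<close>.\<close>
    moreover have "cmod (M F) \<le> B * P"
    proof (intro B(2) F)
      fix y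
      have cc: "(\<lambda>x. complex_of_real (cmod (\<phi> x))) \<in> CC"
        using \<phi> by (auto simp: CC_def intro!: continuous_intros)
      have int: "integrable m (\<lambda>t. (\<integral>z. cmod (\<phi> z) \<partial>\<omega> y t))"
        using integrable_CC[OF CC_translate[OF cc, of y]]
        unfolding translate_of_real[abs_def] complex_of_real_integrable_eq by simp
      have "cmod (F y) \<le> (\<integral>t. (\<integral>z. cmod (\<phi> z) \<partial>\<omega> y t) \<partial>m)"
        unfolding F_def
      proof (rule norm_integral_le_AE[OF int AE_I2])
        fix t
        have "cmod (g t * T y \<phi> t) \<le> 1 * cmod (T y \<phi> t)"
          unfolding norm_mult by (intro mult_right_mono g1) simp
        also have "\<dots> \<le> (\<integral>z. cmod (\<phi> z) \<partial>\<omega> y t)"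
          using integral_norm_bound[of "\<omega> y t" \<phi>] by (simp add: translate_def)
        finally show "cmod (g t * T y \<phi> t) \<le> (\<integral>z. cmod (\<phi> z) \<partial>\<omega> y t)" .
      qed
      also have "\<dots> = P"
      proof -
        have "complex_of_real (\<integral>t. (\<integral>z. cmod (\<phi> z) \<partial>\<omega> y t) \<partial>m) = complex_of_real P"
          using haar_invariant[OF cc, of y] unfolding translate_of_real P_def integral_complex_of_real .
        then show ?thesis by (simp only: of_real_eq_iff)
      qed
      finally show "cmod (F y) \<le> P" .
    qed
    ultimately have "(\<integral>x. u n x \<partial>m) \<le> B * P / cmod (M \<phi>)"
      using M\<phi> by (simp add: field_simps)
    then show ?thesis
      using nn_integral_eq_integral[OF uint] u0 by (simp add: ennreal_leI)
  qed
  have "(\<integral>\<^sup>+x. ennreal (cmod (\<alpha> x)) \<partial>m) \<le> ennreal (B * P / cmod (M \<phi>))"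
  proof (rule nn_integral_limit_le[OF _ _ bound])
    fix n
    have "continuous_on UNIV (u n)"
      unfolding u_def using dual_continuous
      by (intro continuous_intros) (auto simp: add_nonneg_eq_0_iff)
    then show "u n \<in> borel_measurable m" by (rule borel_measurable_sets_eq[OF sets_haar])
    show "(\<lambda>n. u n x) \<longlonglongrightarrow> cmod (\<alpha> x)" for x
      unfolding u_def by (rule cutoff_tendsto) simp
  qed
  then show ?thesis
    using borel_measurable_sets_eq[OF sets_haar dual_continuous]
    by (intro integrableI_bounded) (auto intro: le_less_trans)
qed

lemma dual_sq_integrable:
  assumes "integrable m \<alpha>"
  shows "integrable m (\<lambda>x. (cmod (\<alpha> x))\<^sup>2)"
proof (rule Bochner_Integration.integrable_bound[OF assms])
  show "(\<lambda>x. (cmod (\<alpha> x))\<^sup>2) \<in> borel_measurable m"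
    using dual_continuous by (intro borel_measurable_sets_eq continuous_intros) auto
  have "cmod (\<alpha> x) * cmod (\<alpha> x) \<le> 1 * cmod (\<alpha> x)" for x
    by (intro mult_right_mono dual_bound[OF dual]) simp
  then show "AE x in m. norm ((cmod (\<alpha> x))\<^sup>2) \<le> norm (\<alpha> x)"
    by (simp add: power2_eq_square)
qed

text \<open>\<open>haar_pos\<close> applies to compactly supported functions, so the square is first
  decreased by a cutoff at 1/2. The result is still nonzero at the unit, where the character is
  1.\<close>

lemma dual_sq_pos:
  assumes "integrable m \<alpha>"
  shows "(\<integral>x. (cmod (\<alpha> x))\<^sup>2 \<partial>m) > 0"
proof -
  define u where "u x = cutoff (1/2) (cmod (\<alpha> x)) * (cmod (\<alpha> x))\<^sup>2" for x
  have cc: "(\<lambda>x. complex_of_real (u x)) \<in> CC"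
    unfolding u_def of_real_mult using dual_continuous by (intro cutoff_CC continuous_intros) auto
  have "(\<integral>x. u x \<partial>m) > 0"
  proof (rule haar_pos[OF _ _ cc])
    show "continuous_on UNIV u"
      unfolding u_def using dual_continuous by (intro continuous_intros) auto
    show "u x \<ge> 0" for x unfolding u_def by (intro mult_nonneg_nonneg cutoff_bounds) auto
    show "u e \<noteq> 0" by (simp add: u_def dual_unit[OF dual] cutoff_def)
  qed
  also have "(\<integral>x. u x \<partial>m) \<le> (\<integral>x. (cmod (\<alpha> x))\<^sup>2 \<partial>m)"
  proof (rule integral_mono)
    show "integrable m u" using integrable_CC[OF cc] complex_of_real_integrable_eq by blast
    show "integrable m (\<lambda>x. (cmod (\<alpha> x))\<^sup>2)" by (rule dual_sq_integrable[OF assms])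
    show "u x \<le> (cmod (\<alpha> x))\<^sup>2" for x
      unfolding u_def by (intro mult_left_le_one_le cutoff_bounds) auto
  qed
  finally show ?thesis .
qed

lemma integrable_mult_dual:
  assumes "integrable m \<alpha>" and f: "f \<in> bcontfun"
  shows "integrable m (\<lambda>x. f x * cnj (\<alpha> x))"
proof -
  obtain B where B: "B \<ge> 0" "\<And>x. cmod (f x) \<le> B" using bcontfun_bound[OF f] by blast
  show ?thesis
  proof (rule Bochner_Integration.integrable_bound)
    show "integrable m (\<lambda>x. complex_of_real B * \<alpha> x)" using assms by simp
    show "(\<lambda>x. f x * cnj (\<alpha> x)) \<in> borel_measurable m"
      using dual_continuous bcontfun_continuous[OF f]
      by (intro borel_measurable_sets_eq continuous_intros) auto
    show "AE x in m. cmod (f x * cnj (\<alpha> x)) \<le> cmod (complex_of_real B * \<alpha> x)"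
      using B by (auto simp: norm_mult intro!: mult_right_mono AE_I2)
  qed
qed

text \<open>The adjointness relation extends to the integrable character \<open>\<alpha>\<close> by dominated convergence; the
  dominating function \<open>T\<^sub>x~ |\<alpha>|\<close> is integrable by Fatou's lemma.\<close>

lemma integral_translate_dual:
  assumes int: "integrable m \<alpha>" and f: "f \<in> bcontfun"
  shows "(\<integral>y. T x f y * cnj (\<alpha> y) \<partial>m) = \<alpha> x * (\<integral>y. f y * cnj (\<alpha> y) \<partial>m)"
proof -
  obtain B where B: "B \<ge> 0" "\<And>x. cmod (f x) \<le> B" using bcontfun_bound[OF f] by blast
  define d where "d n = inverse (real (Suc n))" for n
  have d: "d n > 0" for n by (simp add: d_def)
  \<comment> \<open>The \<open>g n\<close> converge to the conjugate character uniformly, and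
    uniform convergence is inherited by all translates.\<close>
  define g where "g n y = complex_of_real (cutoff (d n) (cmod (\<alpha> y))) * cnj (\<alpha> y)" for n y
  have g: "g n \<in> CC" for n
    unfolding g_def using dual_continuous by (intro cutoff_CC d continuous_intros)
  have gnorm: "cmod (g n y) = cmod (\<alpha> y) * cutoff (d n) (cmod (\<alpha> y))" for n y
    using cutoff_bounds(1)[OF d, of "cmod (\<alpha> y)" n] by (simp add: g_def norm_mult)
  have g_le: "cmod (g n y) \<le> cmod (\<alpha> y)" for n y
    unfolding gnorm by (intro mult_right_le_one_le cutoff_bounds d) auto
  have gclose: "cmod (cnj (\<alpha> y) - g n y) \<le> 2 * d n" for n y
  proof -
    have "cnj (\<alpha> y) - g n y = complex_of_real (1 - cutoff (d n) (cmod (\<alpha> y))) * cnj (\<alpha> y)"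
      by (simp add: g_def algebra_simps)
    also have "cmod \<dots> = cmod (\<alpha> y) * (1 - cutoff (d n) (cmod (\<alpha> y)))"
      using cutoff_bounds(2)[OF d, of "cmod (\<alpha> y)" n] by (simp add: norm_mult del: of_real_diff)
    also have "\<dots> \<le> 2 * d n" by (rule cutoff_close[OF d]) simp
    finally show ?thesis .
  qed
  have d0: "(\<lambda>n. 2 * d n) \<longlonglongrightarrow> 0"
    using tendsto_mult[OF tendsto_const[of 2] LIMSEQ_inverse_real_of_nat] by (simp add: d_def)
  have lim: "v \<longlonglongrightarrow> l" if "\<And>n. cmod (l - v n) \<le> 2 * d n" for v l
  proof -
    have "(\<lambda>n. v n - l) \<longlonglongrightarrow> 0"
      by (rule Lim_null_comparison[OF _ d0]) (use that in \<open>simp add: norm_minus_commute\<close>)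
    then show ?thesis by (simp add: LIM_zero_iff)
  qed
  define a where "a y = complex_of_real (cmod (\<alpha> y))" for y
  have ac: "continuous_on UNIV a" unfolding a_def using dual_continuous by (intro continuous_intros)
  have ab: "a \<in> bcontfun"
    by (rule bcontfunI_complex[OF ac, of 1]) (simp add: a_def dual_bound[OF dual])
  have cb: "(\<lambda>y. cnj (\<alpha> y)) \<in> bcontfun"
    using dual_continuous by (intro bcontfunI_complex[of _ 1] continuous_intros) (simp_all add: dual_bound[OF dual])
  define r where "r n y = (\<integral>z. cmod (g n z) \<partial>\<omega> (bar x) y)" for n y
  define R where "R y = (\<integral>z. cmod (\<alpha> z) \<partial>\<omega> (bar x) y)" for y
  have R: "T (bar x) a y = complex_of_real (R y)" for y
    unfolding a_def R_def by (rule translate_of_real)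
  have gcc: "(\<lambda>y. complex_of_real (cmod (g n y))) \<in> CC" for n
    using g[of n] by (auto simp: CC_def intro!: continuous_intros)
  have r: "T (bar x) (\<lambda>y. complex_of_real (cmod (g n y))) y = complex_of_real (r n y)" for n y
    unfolding r_def by (rule translate_of_real)
  have rcc: "(\<lambda>y. complex_of_real (r n y)) \<in> CC" for n
    using CC_translate[OF gcc, of "bar x" n] by (simp only: r[abs_def])
  have r0: "r n y \<ge> 0" and R0: "R y \<ge> 0" for n y by (simp_all add: r_def R_def integral_nonneg)
  have rint: "integrable m (r n)" for n
    using integrable_CC[OF rcc] complex_of_real_integrable_eq by blast
  have Rc: "continuous_on UNIV R"
  proof -
    have "continuous_on UNIV (\<lambda>y. Re (T (bar x) a y))"
      using bcontfun_continuous[OF translate_bcontfun[OF ab]] by (intro continuous_intros)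
    then show ?thesis by (simp add: R)
  qed
  have Rint: "integrable m R"
  proof -
    have "(\<integral>\<^sup>+y. ennreal (R y) \<partial>m) \<le> (\<integral>\<^sup>+y. ennreal (cmod (\<alpha> y)) \<partial>m)"
    proof (rule nn_integral_limit_le)
      show "r n \<in> borel_measurable m" for n using rint by auto
      show "(\<lambda>n. r n y) \<longlonglongrightarrow> R y" for y
      proof -
        have "(\<lambda>n. complex_of_real (r n y)) \<longlonglongrightarrow> complex_of_real (R y)"
        proof (rule lim)
          fix n
          have "complex_of_real (R y) - complex_of_real (r n y) =
              T (bar x) (\<lambda>y. a y - complex_of_real (cmod (g n y))) y"
            unfolding R[symmetric] r[symmetric]
            by (rule translate_diff[OF ac CC_continuous[OF gcc], symmetric])
          also have "cmod \<dots> \<le> 2 * d n"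
          proof (rule translate_bound)
            fix z
            have "cmod (a z - complex_of_real (cmod (g n z))) = \<bar>cmod (cnj (\<alpha> z)) - cmod (g n z)\<bar>"
              unfolding a_def by (simp only: of_real_diff[symmetric] norm_of_real complex_mod_cnj)
            also have "\<dots> \<le> cmod (cnj (\<alpha> z) - g n z)" by (rule norm_triangle_ineq3)
            finally show "cmod (a z - complex_of_real (cmod (g n z))) \<le> 2 * d n"
              using gclose[of z n] by simp
          qed
          finally show "cmod (complex_of_real (R y) - complex_of_real (r n y)) \<le> 2 * d n" .
        qed
        then show ?thesis by (simp add: tendsto_of_real_iff)
      qed
      fix n
      have "(\<integral>\<^sup>+y. ennreal (r n y) \<partial>m) = ennreal (\<integral>y. r n y \<partial>m)"
        by (intro nn_integral_eq_integral rint) (simp add: r0)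
      also have "(\<integral>y. r n y \<partial>m) = (\<integral>y. cmod (g n y) \<partial>m)"
      proof -
        have "complex_of_real (\<integral>y. r n y \<partial>m) = complex_of_real (\<integral>y. cmod (g n y) \<partial>m)"
          using haar_invariant[OF gcc, of "bar x" n] unfolding r integral_complex_of_real .
        then show ?thesis by (simp only: of_real_eq_iff)
      qed
      also have "ennreal (\<integral>y. cmod (g n y) \<partial>m) = (\<integral>\<^sup>+y. ennreal (cmod (g n y)) \<partial>m)"
        by (intro nn_integral_eq_integral[symmetric] integrable_norm integrable_CC g) simp
      also have "\<dots> \<le> (\<integral>\<^sup>+y. ennreal (cmod (\<alpha> y)) \<partial>m)"
        by (intro nn_integral_mono ennreal_leI g_le)
      finally show "(\<integral>\<^sup>+y. ennreal (r n y) \<partial>m) \<le> (\<integral>\<^sup>+y. ennreal (cmod (\<alpha> y)) \<partial>m)" .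
    qed
    also have "\<dots> < \<infinity>" using int unfolding integrable_iff_bounded by simp
    finally show ?thesis
      using R0 borel_measurable_sets_eq[OF sets_haar Rc] by (intro integrableI_bounded) auto
  qed
  have eq: "(\<integral>y. g n y * T x f y \<partial>m) = (\<integral>y. T (bar x) (g n) y * f y \<partial>m)" for n
    by (rule translate_adjoint[OF g f])
  have Tx: "continuous_on UNIV (T x f)" "\<And>y. cmod (T x f y) \<le> B"
    using bcontfun_continuous[OF translate_bcontfun[OF f]] translate_bound B by auto
  have "(\<lambda>n. \<integral>y. g n y * T x f y \<partial>m) \<longlonglongrightarrow> (\<integral>y. cnj (\<alpha> y) * T x f y \<partial>m)"
  proof (rule integral_dominated_convergence[where w = "\<lambda>y. cmod (\<alpha> y) * B"])
    show "(\<lambda>y. cnj (\<alpha> y) * T x f y) \<in> borel_measurable m"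
      using dual_continuous Tx(1) by (intro borel_measurable_sets_eq continuous_intros) auto
    show "(\<lambda>y. g n y * T x f y) \<in> borel_measurable m" for n
      using CC_continuous[OF g] Tx(1) by (intro borel_measurable_sets_eq continuous_intros) auto
    show "integrable m (\<lambda>y. cmod (\<alpha> y) * B)" using int by (intro integrable_mult_left integrable_norm)
    show "AE y in m. (\<lambda>n. g n y * T x f y) \<longlonglongrightarrow> cnj (\<alpha> y) * T x f y"
      by (intro AE_I2 tendsto_intros lim gclose)
    show "AE y in m. cmod (g n y * T x f y) \<le> cmod (\<alpha> y) * B" for n
      using g_le Tx(2) by (auto simp: norm_mult intro!: AE_I2 mult_mono)
  qed
  moreover have "(\<lambda>n. \<integral>y. T (bar x) (g n) y * f y \<partial>m) \<longlonglongrightarrow> (\<integral>y. (\<alpha> x * cnj (\<alpha> y)) * f y \<partial>m)"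
  proof (rule integral_dominated_convergence[where w = "\<lambda>y. R y * B"])
    show "(\<lambda>y. (\<alpha> x * cnj (\<alpha> y)) * f y) \<in> borel_measurable m"
      using dual_continuous bcontfun_continuous[OF f] by (intro borel_measurable_sets_eq continuous_intros) auto
    show "(\<lambda>y. T (bar x) (g n) y * f y) \<in> borel_measurable m" for n
      using CC_continuous[OF CC_translate[OF g]] bcontfun_continuous[OF f]
      by (intro borel_measurable_sets_eq continuous_intros) auto
    show "integrable m (\<lambda>y. R y * B)" using Rint by (intro integrable_mult_left)
    \<comment> \<open>The factor arises as \<open>cnj (\<alpha> (bar x))\<close>, which equals
      \<open>\<alpha> x\<close> because characters turn \<open>bar\<close> into conjugation.\<close>
    have "T (bar x) (\<lambda>y. cnj (\<alpha> y)) y = \<alpha> x * cnj (\<alpha> y)" for y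
    proof -
      have "T (bar x) (\<lambda>y. cnj (\<alpha> y)) y = cnj (T (bar x) \<alpha> y)" by (simp add: translate_def)
      then show ?thesis by (simp add: dual_translate[OF dual] dual_bar[OF dual])
    qed
    moreover have "(\<lambda>n. T (bar x) (g n) y) \<longlonglongrightarrow> T (bar x) (\<lambda>y. cnj (\<alpha> y)) y" for y
    proof (rule lim)
      fix n
      have "T (bar x) (\<lambda>y. cnj (\<alpha> y)) y - T (bar x) (g n) y = T (bar x) (\<lambda>y. cnj (\<alpha> y) - g n y) y"
        by (rule translate_diff[OF bcontfun_continuous[OF cb] CC_continuous[OF g], symmetric])
      also have "cmod \<dots> \<le> 2 * d n" by (rule translate_bound[OF gclose])
      finally show "cmod (T (bar x) (\<lambda>y. cnj (\<alpha> y)) y - T (bar x) (g n) y) \<le> 2 * d n" .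
    qed
    ultimately show "AE y in m. (\<lambda>n. T (bar x) (g n) y * f y) \<longlonglongrightarrow> (\<alpha> x * cnj (\<alpha> y)) * f y"
      by (intro AE_I2 tendsto_mult tendsto_const) simp
    have "cmod (T (bar x) (g n) y) \<le> R y" for n y
    proof -
      have "integrable (\<omega> (bar x) y) a" by (rule integrable_convolution[OF ac])
      then have "integrable (\<omega> (bar x) y) (\<lambda>z. cmod (\<alpha> z))"
        unfolding a_def complex_of_real_integrable_eq .
      then show ?thesis
        unfolding translate_def R_def by (rule norm_integral_le_AE) (simp add: g_le)
    qed
    then show "AE y in m. cmod (T (bar x) (g n) y * f y) \<le> R y * B" for n
      using B R0 by (auto simp: norm_mult intro!: AE_I2 mult_mono)
  qed
  ultimately have "(\<integral>y. cnj (\<alpha> y) * T x f y \<partial>m) = (\<integral>y. (\<alpha> x * cnj (\<alpha> y)) * f y \<partial>m)"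
    unfolding eq by (rule LIMSEQ_unique)
  then show ?thesis by (simp add: mult_ac)
qed

lemma alpha_mean_integral:
  assumes int: "integrable m \<alpha>"
  shows "alpha_mean \<omega> \<alpha> (\<lambda>f. complex_of_real (1 / (\<integral>x. (cmod (\<alpha> x))\<^sup>2 \<partial>m)) * (\<integral>x. f x * cnj (\<alpha> x) \<partial>m))"
    (is "alpha_mean _ _ (\<lambda>f. complex_of_real ?c * ?I f)")
  unfolding alpha_mean_def bounded_functional_UC_def
proof (intro conjI ballI allI)
  note i = integrable_mult_dual[OF int UC_bcontfun]
  fix f g assume "f \<in> UC \<omega>" "g \<in> UC \<omega>"
  then show "complex_of_real ?c * ?I (\<lambda>x. f x + g x) = complex_of_real ?c * ?I f + complex_of_real ?c * ?I g"
    by (simp add: distrib_right Bochner_Integration.integral_add[OF i i] distrib_left del: of_real_divide)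
next
  fix a f assume "f \<in> UC \<omega>"
  show "complex_of_real ?c * ?I (\<lambda>x. a * f x) = a * (complex_of_real ?c * ?I f)"
    by (simp add: mult.assoc del: of_real_divide)
next
  note pos = dual_sq_pos[OF int]
  have c: "?c > 0" using pos by simp
  have "cmod (complex_of_real ?c * ?I f) \<le> (?c * (\<integral>x. cmod (\<alpha> x) \<partial>m)) * norm (Bcontfun f)" if f: "f \<in> UC \<omega>" for f
  proof -
    have "cmod (?I f) \<le> (\<integral>x. norm (Bcontfun f) * cmod (\<alpha> x) \<partial>m)"
      using norm_le_norm_Bcontfun[OF UC_bcontfun[OF f]] int
      by (intro norm_integral_le_AE integrable_mult_right integrable_norm AE_I2)
        (auto simp: norm_mult intro!: mult_right_mono)
    then have "?c * cmod (?I f) \<le> ?c * (norm (Bcontfun f) * (\<integral>x. cmod (\<alpha> x) \<partial>m))"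
      using c by (intro mult_left_mono) auto
    moreover have "cmod (complex_of_real ?c) = ?c" using c by (simp only: norm_of_real abs_of_pos)
    ultimately show ?thesis by (simp only: norm_mult mult_ac)
  qed
  then show "\<exists>B. \<forall>f\<in>UC \<omega>. cmod (complex_of_real ?c * ?I f) \<le> B * norm (Bcontfun f)" by blast
next
  have "?I \<alpha> = complex_of_real (\<integral>x. (cmod (\<alpha> x))\<^sup>2 \<partial>m)"
    unfolding complex_norm_square[symmetric] by (rule integral_complex_of_real)
  then show "complex_of_real ?c * ?I \<alpha> = 1" using dual_sq_pos[OF int] by simp
next
  fix f x assume "f \<in> UC \<omega>"
  then show "complex_of_real ?c * ?I (T x f) = \<alpha> x * (complex_of_real ?c * ?I f)"
    using integral_translate_dual[OF int UC_bcontfun] by simp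
qed

end

end

section \<open>The dual space\<close>

text \<open>Finitely many discs of radius \<open>\<delta> / 3\<close> cover the image of
  \<open>C\<close>. Members of \<open>W\<close> send the part of \<open>C\<close> over each disc
  into the concentric disc of radius \<open>\<delta> / 2\<close>, so they differ from \<alpha> on
  \<open>C\<close> by less than the sum of the radii.\<close>

lemma compact_open_neighbourhood:
  fixes \<alpha> :: "'a::topological_space \<Rightarrow> complex"
  assumes "compact C" "continuous_on UNIV \<alpha>" "\<delta> > 0"
  obtains W where "openin compact_open_topology W" "\<alpha> \<in> W"
    "\<And>\<beta> x. \<beta> \<in> W \<Longrightarrow> x \<in> C \<Longrightarrow> cmod (\<beta> x - \<alpha> x) \<le> \<delta>"
proof -
  have *: "compact (\<alpha> ` C)"
    by (rule compact_continuous_image[OF continuous_on_subset[OF assms(2)] assms(1)]) simp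
  have "\<alpha> ` C \<subseteq> (\<Union>z\<in>\<alpha> ` C. ball z (\<delta> / 3))" using assms(3) by auto
  from compactE_image[OF * open_ball this] obtain Z where Z: "Z \<subseteq> \<alpha> ` C" "finite Z" "\<alpha> ` C \<subseteq> (\<Union>z\<in>Z. ball z (\<delta> / 3))"
    by metis
  define D where "D z = \<alpha> -` cball z (\<delta> / 3) \<inter> C" for z
  \<comment> \<open>The last factor keeps \<open>W\<close> inside the underlying space when
    \<open>Z\<close> is empty and the intersection over it is the whole type.\<close>
  define W where "W = \<Inter>((\<lambda>z. {f. continuous_on UNIV f \<and> f ` D z \<subseteq> ball z (\<delta> / 2)}) ` Z) \<inter> {f. continuous_on UNIV f}"
  have D: "compact (D z)" for z
    unfolding D_def by (intro closed_Int_compact closed_vimage assms) auto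
  have gen: "openin compact_open_topology {f :: 'a \<Rightarrow> complex. continuous_on UNIV f \<and> f ` C \<subseteq> U}"
    if "compact C" "open U" for C U
    unfolding compact_open_topology_def by (rule topology_generated_by_Basis) (use that in blast)
  have "openin compact_open_topology {f :: 'a \<Rightarrow> complex. continuous_on UNIV f}"
    using gen[of "{}" UNIV] by simp
  then have "openin compact_open_topology W"
    unfolding W_def using Z(2) D gen
    by (cases "Z = {}") (auto intro!: openin_Int openin_INT2)
  moreover have "\<alpha> \<in> W"
    using assms(2,3) by (auto simp: W_def D_def dist_norm)
  moreover have "cmod (\<beta> x - \<alpha> x) \<le> \<delta>" if \<beta>: "\<beta> \<in> W" and x: "x \<in> C" for \<beta> x
  proof -
    obtain z where z: "z \<in> Z" "dist z (\<alpha> x) < \<delta> / 3" using Z(3) x by (auto simp: subset_iff)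
    then have "x \<in> D z" using x by (simp add: D_def)
    then have "dist z (\<beta> x) < \<delta> / 2" using \<beta> z(1) by (auto simp: W_def image_subset_iff)
    then have "dist (\<beta> x) (\<alpha> x) \<le> \<delta>" using z(2) dist_triangle2[of "\<beta> x" "\<alpha> x" z] assms(3)
      by (simp add: dist_commute)
    then show ?thesis by (simp add: dist_norm)
  qed
  ultimately show ?thesis by (rule that)
qed

lemma topspace_dual_topology: "topspace (dual_topology \<omega> bar) = dual_space \<omega> bar"
proof -
  have "f \<in> topspace compact_open_topology" if "continuous_on UNIV f" for f :: "'a \<Rightarrow> complex"
  proof -
    have "openin compact_open_topology {f :: 'a \<Rightarrow> complex. continuous_on UNIV f \<and> f ` {} \<subseteq> UNIV}"
      unfolding compact_open_topology_def by (rule topology_generated_by_Basis) blast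
    from openin_subset[OF this] that show ?thesis by auto
  qed
  then show ?thesis by (auto simp: dual_topology_def dual_space_def bcontfun_def)
qed

context haar_hypergroup
begin

context
  fixes \<alpha> :: "'a \<Rightarrow> complex"
  assumes dual: "\<alpha> \<in> dual_space \<omega> bar"
    and vanishing: "\<And>\<epsilon>. \<epsilon> > 0 \<Longrightarrow> compact {x. \<epsilon> \<le> cmod (\<alpha> x)}"
    and int: "integrable m \<alpha>"
begin

lemma fourier_transform_self: "fourier_transform m \<alpha> \<alpha> = complex_of_real (\<integral>x. (cmod (\<alpha> x))\<^sup>2 \<partial>m)"
  unfolding fourier_transform_def complex_norm_square[symmetric] by (rule integral_complex_of_real)

text \<open>This is orthogonality of characters: translating \<beta> inside the integral multiplies
  it by \<open>\<beta> x\<close>, and by \<open>integral_translate_dual\<close> also by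
  \<open>\<alpha> x\<close>.\<close>

lemma fourier_transform_other:
  assumes \<beta>: "\<beta> \<in> dual_space \<omega> bar" "\<beta> \<noteq> \<alpha>"
  shows "fourier_transform m \<alpha> \<beta> = 0"
proof -
  let ?J = "\<integral>y. \<beta> y * cnj (\<alpha> y) \<partial>m"
  obtain x where x: "\<beta> x \<noteq> \<alpha> x" using \<beta>(2) by blast
  have "\<beta> x * ?J = (\<integral>y. T x \<beta> y * cnj (\<alpha> y) \<partial>m)"
    by (simp add: dual_translate[OF \<beta>(1)] mult.assoc)
  also have "\<dots> = \<alpha> x * ?J"
    by (rule integral_translate_dual[OF dual vanishing int dual_bcontfun[OF \<beta>(1)]])
  finally have "?J = 0" using x by simp
  moreover have "fourier_transform m \<alpha> \<beta> = cnj ?J"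
    unfolding fourier_transform_def
    by (simp add: Bochner_Integration.integral_cnj[symmetric] mult.commute del: Bochner_Integration.integral_cnj)
  ultimately show ?thesis by simp
qed

text \<open>The Fourier transform of \<alpha> takes the positive value \<open>c\<close> at \<alpha>
  and 0 at every other character. A character uniformly close to \<alpha> on a large compact set has
  transform within less than \<open>c\<close> of that value, so it must be \<alpha> itself.\<close>

lemma openin_dual_singleton: "openin (dual_topology \<omega> bar) {\<alpha>}"
proof -
  define c where "c = (\<integral>x. (cmod (\<alpha> x))\<^sup>2 \<partial>m)"
  have c: "c > 0" unfolding c_def by (rule dual_sq_pos[OF dual vanishing int])
  define A where "A = (\<integral>x. cmod (\<alpha> x) \<partial>m)"
  have A: "A \<ge> 0" by (simp add: A_def)
  note ac = bcontfun_continuous[OF dual_bcontfun[OF dual]]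
  text \<open>As \<open>w n\<close> is supported in \<open>{|\<alpha>| \<ge> 1/(n+1)}\<close>, its convergence to \<open>|\<alpha>|\<close> in mean shows that
    \<open>|\<alpha>|\<close> has small integral outside a compact set.\<close>
  define w where "w n x = cmod (\<alpha> x) * cutoff (inverse (real (Suc n))) (cmod (\<alpha> x))" for n x
  have w: "continuous_on UNIV (w n)" for n
    unfolding w_def using ac by (intro continuous_intros) auto
  have w01: "0 \<le> w n x" "w n x \<le> cmod (\<alpha> x)" for n x
    unfolding w_def by (auto intro!: mult_nonneg_nonneg mult_right_le_one_le cutoff_bounds)
  have wint: "integrable m (w n)" for n
    by (rule Bochner_Integration.integrable_bound[OF int])
      (use w01 borel_measurable_sets_eq[OF sets_haar w] in auto)
  have "(\<lambda>n. \<integral>x. w n x \<partial>m) \<longlonglongrightarrow> A"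
    unfolding A_def
  proof (rule integral_dominated_convergence[where w = "\<lambda>x. cmod (\<alpha> x)"])
    show "(\<lambda>x. cmod (\<alpha> x)) \<in> borel_measurable m" "w n \<in> borel_measurable m" for n
      using int wint by auto
    show "integrable m (\<lambda>x. cmod (\<alpha> x))" using int by (rule integrable_norm)
    show "AE x in m. (\<lambda>n. w n x) \<longlonglongrightarrow> cmod (\<alpha> x)"
      unfolding w_def by (intro AE_I2 cutoff_tendsto) simp
    show "AE x in m. norm (w n x) \<le> cmod (\<alpha> x)" for n using w01 by simp
  qed
  then have "\<forall>\<^sub>F n in sequentially. dist (\<integral>x. w n x \<partial>m) A < c / 4"
    using c by (intro tendstoD) auto
  then obtain n where n: "dist (\<integral>x. w n x \<partial>m) A < c / 4"
    by (meson eventually_happens sequentially_bot)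
  \<comment> \<open>With this choice the compact part contributes at most \<open>c / 4\<close>. The
    part outside contributes less than \<open>2 * (c / 4)\<close>, which leaves a total below
    \<open>c\<close>.\<close>
  define \<delta> where "\<delta> = c / (4 * (A + 1))"
  have \<delta>: "\<delta> > 0" using c A by (simp add: \<delta>_def)
  obtain W where W: "openin compact_open_topology W" "\<alpha> \<in> W"
    "\<And>\<beta> x. \<beta> \<in> W \<Longrightarrow> x \<in> {x. inverse (real (Suc n)) \<le> cmod (\<alpha> x)} \<Longrightarrow> cmod (\<beta> x - \<alpha> x) \<le> \<delta>"
    using compact_open_neighbourhood[OF vanishing ac \<delta>] by (metis inverse_positive_iff_positive of_nat_0_less_iff zero_less_Suc)
  have "W \<inter> dual_space \<omega> bar = {\<alpha>}"
  proof (intro equalityI subsetI)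
    fix \<beta> assume \<beta>: "\<beta> \<in> W \<inter> dual_space \<omega> bar"
    show "\<beta> \<in> {\<alpha>}"
    proof (rule ccontr)
      assume "\<beta> \<notin> {\<alpha>}"
      then have "fourier_transform m \<alpha> \<beta> = 0" using \<beta> by (intro fourier_transform_other) auto
      have bc: "\<And>\<gamma>. \<gamma> \<in> dual_space \<omega> bar \<Longrightarrow> integrable m (\<lambda>x. \<alpha> x * cnj (\<gamma> x))"
      proof -
        fix \<gamma> assume \<gamma>: "\<gamma> \<in> dual_space \<omega> bar"
        have "integrable m (\<lambda>x. cnj (\<gamma> x * cnj (\<alpha> x)))"
          unfolding complex_integrable_cnj
          by (rule integrable_mult_dual[OF dual vanishing int dual_bcontfun[OF \<gamma>]])
        then show "integrable m (\<lambda>x. \<alpha> x * cnj (\<gamma> x))" by (simp add: mult.commute)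
      qed
      have "complex_of_real c = fourier_transform m \<alpha> \<alpha> - fourier_transform m \<alpha> \<beta>"
        by (simp add: fourier_transform_self c_def \<open>fourier_transform m \<alpha> \<beta> = 0\<close>)
      also have "\<dots> = (\<integral>x. \<alpha> x * cnj (\<alpha> x - \<beta> x) \<partial>m)"
        unfolding fourier_transform_def using \<beta>
        by (subst Bochner_Integration.integral_diff[symmetric]) (auto intro!: bc dual simp: algebra_simps)
      \<comment> \<open>Where \<open>cmod (\<alpha> x)\<close> is at least
        \<open>inverse (real (Suc n))\<close> the two characters differ by at most \<delta>;
        elsewhere \<open>w n\<close> is 0 and the trivial bound 2 on the difference is used.\<close>
      also have "cmod \<dots> \<le> (\<integral>x. \<delta> * cmod (\<alpha> x) + 2 * (cmod (\<alpha> x) - w n x) \<partial>m)"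
      proof (rule norm_integral_le_AE[OF _ AE_I2])
        show "integrable m (\<lambda>x. \<delta> * cmod (\<alpha> x) + 2 * (cmod (\<alpha> x) - w n x))"
          using int wint by (intro Bochner_Integration.integrable_add Bochner_Integration.integrable_diff
              integrable_mult_right integrable_norm)
        fix x
        have two: "cmod (\<alpha> x - \<beta> x) \<le> 2"
          using norm_triangle_ineq4[of "\<alpha> x" "\<beta> x"] dual_bound[OF dual, of x] dual_bound[of \<beta> x] \<beta> by simp
        show "cmod (\<alpha> x * cnj (\<alpha> x - \<beta> x)) \<le> \<delta> * cmod (\<alpha> x) + 2 * (cmod (\<alpha> x) - w n x)"
        proof (cases "inverse (real (Suc n)) \<le> cmod (\<alpha> x)")
          case True
          then have "cmod (\<alpha> x - \<beta> x) \<le> \<delta>" using W(3)[of \<beta> x] \<beta> by (simp add: norm_minus_commute)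
          then have "cmod (\<alpha> x) * cmod (\<alpha> x - \<beta> x) \<le> cmod (\<alpha> x) * \<delta>" by (intro mult_left_mono) auto
          then show ?thesis using w01[of n x] by (simp add: norm_mult mult.commute flip: complex_cnj_diff)
        next
          case False
          then have "w n x = 0" by (simp add: w_def cutoff_eq_0)
          moreover have "cmod (\<alpha> x) * cmod (\<alpha> x - \<beta> x) \<le> cmod (\<alpha> x) * 2"
            by (intro mult_left_mono two) auto
          moreover have "\<delta> * cmod (\<alpha> x) \<ge> 0" using \<delta> by simp
          ultimately show ?thesis by (simp add: norm_mult flip: complex_cnj_diff)
        qed
      qed
      also have "\<dots> = \<delta> * A + 2 * (A - (\<integral>x. w n x \<partial>m))"
        using int wint by (simp add: A_def)
      also have "\<dots> < c"
      proof -
        have "\<delta> * A \<le> c / 4" using c A by (simp add: \<delta>_def field_simps)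
        moreover have "2 * (A - (\<integral>x. w n x \<partial>m)) < 2 * (c / 4)"
          using n abs_ge_minus_self[of "(\<integral>x. w n x \<partial>m) - A"] by (simp add: dist_real_def)
        ultimately show ?thesis using c by simp
      qed
      finally show False using c by simp
    qed
  qed (use W(2) dual in auto)
  then show ?thesis
    unfolding dual_topology_def openin_subtopology using W(1) by metis
qed

text \<open>The Plancherel identity for \<alpha> itself reads
  \<open>c = c\<^sup>2 * emeasure \<pi> {\<alpha>}\<close>, because its Fourier transform is
  concentrated at one point.\<close>

lemma plancherel_isolated:
  assumes \<pi>: "plancherel_measure \<omega> bar m \<pi>"
  shows "\<alpha> \<in> measure_support (dual_topology \<omega> bar) \<pi>"
    "openin (subtopology (dual_topology \<omega> bar) (measure_support (dual_topology \<omega> bar) \<pi>)) {\<alpha>}"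
proof -
  define c where "c = (\<integral>x. (cmod (\<alpha> x))\<^sup>2 \<partial>m)"
  have c: "c > 0" unfolding c_def by (rule dual_sq_pos[OF dual vanishing int])
  let ?X = "dual_topology \<omega> bar"
  have sets: "sets \<pi> = sets (borel_of ?X)" using \<pi> by (simp add: plancherel_measure_def radon_measure_def)
  have sub: "{U. openin ?X U} \<subseteq> Pow (topspace ?X)" using openin_subset by blast
  have space: "space \<pi> = dual_space \<omega> bar"
    using sets_eq_imp_space_eq[OF sets] sub by (simp add: borel_of_def space_measure_of topspace_dual_topology)
  have "{\<alpha>} \<in> sets \<pi>"
    unfolding sets borel_of_def sets_measure_of[OF sub] using openin_dual_singleton by (intro sigma_sets.Basic) simp
  have "integrable m (\<lambda>x. (cmod (\<alpha> x))\<^sup>2)" by (rule dual_sq_integrable[OF dual vanishing int])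
  then have L: "\<alpha> \<in> L1_L2 m" using int by (simp add: L1_L2_def)
  have "ennreal c = (\<integral>\<^sup>+x. ennreal ((cmod (\<alpha> x))\<^sup>2) \<partial>m)"
    unfolding c_def by (rule nn_integral_eq_integral[symmetric]) (use L in \<open>auto simp: L1_L2_def\<close>)
  also have "\<dots> = (\<integral>\<^sup>+\<beta>. ennreal ((cmod (fourier_transform m \<alpha> \<beta>))\<^sup>2) \<partial>\<pi>)"
    using \<pi> L by (simp add: plancherel_measure_def)
  also have "\<dots> = (\<integral>\<^sup>+\<beta>. ennreal (c\<^sup>2) * indicator {\<alpha>} \<beta> \<partial>\<pi>)"
  proof (rule nn_integral_cong)
    fix \<beta> assume "\<beta> \<in> space \<pi>"
    then show "ennreal ((cmod (fourier_transform m \<alpha> \<beta>))\<^sup>2) = ennreal (c\<^sup>2) * indicator {\<alpha>} \<beta>"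
      using c by (cases "\<beta> = \<alpha>")
        (auto simp: fourier_transform_self c_def[symmetric] fourier_transform_other space)
  qed
  also have "\<dots> = ennreal (c\<^sup>2) * emeasure \<pi> {\<alpha>}"
    using \<open>{\<alpha>} \<in> sets \<pi>\<close> by (rule nn_integral_cmult_indicator)
  finally have "emeasure \<pi> {\<alpha>} \<noteq> 0" using c by auto
  then have pos: "emeasure \<pi> {\<alpha>} > 0" by (simp add: zero_less_iff_neq_zero)
  show supp: "\<alpha> \<in> measure_support ?X \<pi>"
    unfolding measure_support_def
  proof (intro CollectI conjI allI impI)
    show "\<alpha> \<in> topspace ?X" using dual by (simp add: topspace_dual_topology)
    fix U assume U: "openin ?X U \<and> \<alpha> \<in> U"
    then have "U \<in> sets \<pi>"
      unfolding sets borel_of_def sets_measure_of[OF sub] by (intro sigma_sets.Basic) simp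
    then have "emeasure \<pi> {\<alpha>} \<le> emeasure \<pi> U" using U by (intro emeasure_mono) auto
    with pos show "emeasure \<pi> U > 0" by (rule less_le_trans)
  qed
  show "openin (subtopology ?X (measure_support ?X \<pi>)) {\<alpha>}"
    unfolding openin_subtopology using openin_dual_singleton supp by blast
qed

end

end

theorem theorem3p4:
  fixes \<omega> :: "'a::t2_space \<Rightarrow> 'a \<Rightarrow> 'a measure"
    and bar :: "'a \<Rightarrow> 'a"
    and m :: "'a measure"
    and \<alpha> :: "'a \<Rightarrow> complex"
    and M :: "('a \<Rightarrow> complex) \<Rightarrow> complex"
  assumes "commutative_hypergroup \<omega> bar"
    and "haar_measure \<omega> m"
    and "\<alpha> \<in> dual_space \<omega> bar"
    and "alpha_mean \<omega> \<alpha> M"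
    and "\<And>M'. alpha_mean \<omega> \<alpha> M' \<Longrightarrow> \<forall>f\<in>UC \<omega>. M' f = M f"
  shows "(\<exists>g\<in>L1_L2 m. \<forall>f\<in>UC \<omega>. M f = (\<integral>x. f x * g x \<partial>m)) \<and>
    (\<forall>\<pi>. plancherel_measure \<omega> bar m \<pi> \<longrightarrow>
       \<alpha> \<in> measure_support (dual_topology \<omega> bar) \<pi> \<and>
       openin (subtopology (dual_topology \<omega> bar) (measure_support (dual_topology \<omega> bar) \<pi>)) {\<alpha>}) \<and>
    \<alpha> \<in> L1_L2 m \<and>
    (\<forall>f\<in>UC \<omega>. M f =
       complex_of_real (1 / (\<integral>x. (cmod (\<alpha> x))\<^sup>2 \<partial>m)) * (\<integral>x. f x * cnj (\<alpha> x) \<partial>m)) \<and>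
    ((\<forall>x. \<alpha> x \<in> \<real>\<^sub>\<ge>\<^sub>0) \<longrightarrow> compact (UNIV :: 'a set))"
proof -
  note uniq = assms(5)
  interpret commutative_hypergroup \<omega> bar by (rule assms(1))
  interpret haar_hypergroup \<omega> bar m by unfold_locales (rule assms(2))
  note dual = assms(3)
  have vanishing: "compact {x. \<epsilon> \<le> cmod (\<alpha> x)}" if "\<epsilon> > 0" for \<epsilon>
    by (rule unique_mean_vanishing[OF dual assms(4) uniq that])
  have int: "integrable m \<alpha>" by (rule mean_integrable[OF dual vanishing assms(4)])
  define c where "c = (\<integral>x. (cmod (\<alpha> x))\<^sup>2 \<partial>m)"
  have c: "c > 0" unfolding c_def by (rule dual_sq_pos[OF dual vanishing int])
  have sq: "integrable m (\<lambda>x. (cmod (\<alpha> x))\<^sup>2)" by (rule dual_sq_integrable[OF dual vanishing int])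
  have formula: "M f = complex_of_real (1 / c) * (\<integral>x. f x * cnj (\<alpha> x) \<partial>m)" if "f \<in> UC \<omega>" for f
    using uniq[OF alpha_mean_integral[OF dual vanishing int]] that by (simp add: c_def)
  define g where "g x = complex_of_real (1 / c) * cnj (\<alpha> x)" for x
  have "g \<in> L1_L2 m"
  proof -
    have "integrable m g" unfolding g_def[abs_def] using int by simp
    moreover have "(cmod (g x))\<^sup>2 = (1 / c)\<^sup>2 * (cmod (\<alpha> x))\<^sup>2" for x
      by (simp only: g_def norm_mult power_mult_distrib norm_of_real complex_mod_cnj power2_abs)
    ultimately show ?thesis using sq unfolding L1_L2_def by simp
  qed
  moreover have "M f = (\<integral>x. f x * g x \<partial>m)" if "f \<in> UC \<omega>" for f
  proof -
    have "(\<integral>x. f x * g x \<partial>m) = (\<integral>x. complex_of_real (1 / c) * (f x * cnj (\<alpha> x)) \<partial>m)"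
      by (simp add: g_def mult_ac)
    then show ?thesis using formula[OF that] by (simp only: integral_mult_right_zero)
  qed
  moreover have "\<alpha> \<in> L1_L2 m" using int sq by (simp add: L1_L2_def)
  moreover have "compact (UNIV :: 'a set)" if pos: "\<forall>x. \<alpha> x \<in> \<real>\<^sub>\<ge>\<^sub>0"
  proof -
    have one: "(\<lambda>_. 1) \<in> UC \<omega>"
      unfolding UC_iff by (auto simp: const_bcontfun)
    have "cnj (\<alpha> x) = complex_of_real (cmod (\<alpha> x))" for x
      using pos by (metis complex_cnj_complex_of_real norm_of_real abs_of_nonneg nonneg_Reals_cases)
    then have "M (\<lambda>_. 1) = complex_of_real (1 / c) * complex_of_real (\<integral>x. cmod (\<alpha> x) \<partial>m)"
      using formula[OF one] by simp
    \<comment> \<open>Since characters are bounded by 1, the integral of the square is at most that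
      of the modulus. This makes \<open>M (\<lambda>_. 1)\<close> a real number that is at least
      1.\<close>
    moreover have "c \<le> (\<integral>x. cmod (\<alpha> x) \<partial>m)"
      unfolding c_def
    proof (rule integral_mono[OF sq integrable_norm[OF int]])
      fix x
      show "(cmod (\<alpha> x))\<^sup>2 \<le> cmod (\<alpha> x)"
        unfolding power2_eq_square by (intro mult_right_le_one_le dual_bound[OF dual]) auto
    qed
    ultimately have "M (\<lambda>_. 1) \<noteq> 0" using c by auto
    moreover have "M (\<lambda>_. 1) = \<alpha> x * M (\<lambda>_. 1)" for x
    proof -
      have "M (T x (\<lambda>_. 1)) = \<alpha> x * M (\<lambda>_. 1)"
        using assms(4) one unfolding alpha_mean_def by blast
      moreover have "T x (\<lambda>_. 1) = (\<lambda>_. 1)" by (rule ext) simp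
      ultimately show ?thesis by simp
    qed
    ultimately have "\<alpha> x = 1" for x by simp
    \<comment> \<open>For the constant character the compact set
      \<open>{x. 1 \<le> cmod (\<alpha> x)}\<close> is the whole space.\<close>
    then show ?thesis using vanishing[of 1] by simp
  qed
  ultimately show ?thesis
    using formula plancherel_isolated[OF dual vanishing int] unfolding c_def by blast
qed

end
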